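(* Let $m\ge2$. Any finite collection $\{V_j:1\le j\le n\}$ of linear subspaces of $\mathbb R^m$ of codimension one has the uniform power decay property.
   Context: $\pi_j$ denotes the orthogonal projection of $\mathbb R^m$ onto $V_j$. For $\lambda\in\mathbb R$, a real-valued polynomial $P$ on $\mathbb R^m$, a compactly supported $\eta\in C^1(\mathbb R^m)$ and functions $f_j:V_j\to\mathbb C$, define $$\Lambda_\lambda(f_1,\dots,f_n)=\int_{\mathbb R^m}e^{i\lambda P(x)}\prod_{j=1}^n f_j(\pi_j(x))\,\eta(x)\,dx .$$ Relative norm: for each $d$ fix a norm $\|\cdot\|_{\mathcal P_d}$ on the finite-dimensional space $\mathcal P_d$ of polynomials on $\mathbb R^m$ of degree $\le d$. The norm of $P\in\mathcal P_d$ relative to $\{V_j\}$ is $\inf\|P-\sum_j p_j\circ\pi_j\|_{\mathcal P_d}$, the infimum over all real-valued polynomials $p_j:V_j\to\mathbb R$ of degree $\le d$. If $n=0$ (empty collection) the infimum is instead over $\|P-a\|_{\mathcal P_d}$ with $a\in\mathbb R$ constant. Uniform power decay property of $\{V_j\}$: for every $d\in\mathbb N$, $c>0$ and compact $K\subset\mathbb R^m$ there exist $\varepsilon>0$ and $C<\infty$ such that $|\Lambda_\lambda(f_1,\dots,f_n)|\le C\|\eta\|_{C^1}(1+|\lambda|)^{-\varepsilon}\prod_j\|f_j\|_{L^\infty}$ for all $\lambda\in\mathbb R$, all $f_j\in L^\infty(V_j)$, all $\eta\in C^1(\mathbb R^m)$ supported in $K$, and all real-valued polynomials $P$ of degree $\le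 d$ whose norm relative to $\{V_j\}$ is $\ge c$. *)

theory Defs
  imports "HOL-Probability.Essential_Supremum"
begin

definition orth_proj :: "'a::euclidean_space set \<Rightarrow> 'a \<Rightarrow> 'a" where
  "orth_proj V x = (THE y. y \<in> V \<and> (\<forall>v\<in>V. orthogonal (x - y) v))"

definition onb :: "'a::euclidean_space set \<Rightarrow> 'a set" where
  "onb V = (SOME B. B \<subseteq> V \<and> pairwise orthogonal B \<and> (\<forall>b\<in>B. norm b = 1) \<and> span B = V)"

text \<open>
  Lebesgue measure on a linear subspace, transported from the coordinate space of an orthonormal
  basis just as \<^const>\<open>lborel\<close> is built from the standard basis; the result does not depend on the
  basis. The space of this measure is \<open>V\<close>, so a function of type \<open>'a \<Rightarrow> _\<close> regarded over it is a
  function on \<open>V\<close>, and its values elsewhere play no role.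
\<close>

definition subspace_lebesgue :: "'a::euclidean_space set \<Rightarrow> 'a measure" where
  "subspace_lebesgue V = completion
     (distr (\<Pi>\<^sub>M b\<in>onb V. lborel) (restrict_space borel V) (\<lambda>g. \<Sum>b\<in>onb V. g b *\<^sub>R b))"

definition Linf_norm :: "'a::euclidean_space set \<Rightarrow> ('a \<Rightarrow> complex) \<Rightarrow> ennreal" where
  "Linf_norm V f = esssup (subspace_lebesgue V) (\<lambda>v. ennreal (cmod (f v)))"

definition Linf :: "'a::euclidean_space set \<Rightarrow> ('a \<Rightarrow> complex) set" where
  "Linf V = {f. f \<in> borel_measurable (subspace_lebesgue V) \<and> Linf_norm V f < \<infinity>}"

text \<open>
  Real polynomial functions of degree at most \<open>d\<close> in the coordinates \<open>x \<bullet> b\<close>, \<open>b \<in> B\<close>; the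
  multi-indices are functions \<open>B \<rightarrow> nat\<close>.
\<close>

definition polys_in :: "'a::euclidean_space set \<Rightarrow> nat \<Rightarrow> ('a \<Rightarrow> real) set" where
  "polys_in B d = {p. \<exists>c :: ('a \<Rightarrow> nat) \<Rightarrow> real.
     p = (\<lambda>x. \<Sum>\<alpha>\<in>{\<alpha> \<in> B \<rightarrow>\<^sub>E UNIV. (\<Sum>b\<in>B. \<alpha> b) \<le> d}. c \<alpha> * (\<Prod>b\<in>B. (x \<bullet> b) ^ \<alpha> b))}"

abbreviation polys :: "nat \<Rightarrow> ('a::euclidean_space \<Rightarrow> real) set" where
  "polys \<equiv> polys_in Basis"

definition polys_on :: "'a::euclidean_space set \<Rightarrow> nat \<Rightarrow> ('a \<Rightarrow> real) set" where
  "polys_on V d = {p. \<exists>q\<in>polys_in (onb V) d. \<forall>v\<in>V. p v = q v}"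

definition is_norm_on :: "('a \<Rightarrow> real) set \<Rightarrow> (('a \<Rightarrow> real) \<Rightarrow> real) \<Rightarrow> bool" where
  "is_norm_on X N \<longleftrightarrow>
     (\<forall>p\<in>X. 0 \<le> N p \<and> (N p = 0 \<longleftrightarrow> p = (\<lambda>x. 0))) \<and>
     (\<forall>p\<in>X. \<forall>a. N (\<lambda>x. a * p x) = \<bar>a\<bar> * N p) \<and>
     (\<forall>p\<in>X. \<forall>q\<in>X. N (\<lambda>x. p x + q x) \<le> N p + N q)"

text \<open>Here \<open>N\<close> is the norm fixed on the polynomials of degree at most \<open>d\<close>.\<close>

definition relative_norm ::
  "(('a::euclidean_space \<Rightarrow> real) \<Rightarrow> real) \<Rightarrow> nat \<Rightarrow> nat \<Rightarrow> (nat \<Rightarrow> 'a set) \<Rightarrow> ('a \<Rightarrow> real) \<Rightarrow> real" where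
  "relative_norm N d n V P =
     (if n = 0 then (INF a. N (\<lambda>x. P x - a))
      else (INF p\<in>{p. \<forall>j\<in>{1..n}. p j \<in> polys_on (V j) d}.
              N (\<lambda>x. P x - (\<Sum>j=1..n. p j (orth_proj (V j) x)))))"

definition C1 :: "('a::euclidean_space \<Rightarrow> complex) \<Rightarrow> bool" where
  "C1 \<eta> \<longleftrightarrow> (\<exists>D :: 'a \<Rightarrow> 'a \<Rightarrow>\<^sub>L complex.
     (\<forall>x. (\<eta> has_derivative blinfun_apply (D x)) (at x)) \<and> continuous_on UNIV D)"

text \<open>Only used for compactly supported functions, where both suprema are finite.\<close>

definition C1_norm :: "('a::euclidean_space \<Rightarrow> complex) \<Rightarrow> real" where
  "C1_norm \<eta> = (SUP x. cmod (\<eta> x)) + (SUP x. onorm (frechet_derivative \<eta> (at x)))"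

text \<open>
  The integral is taken over the completed measure because \<open>f j \<circ> orth_proj (V j)\<close> is in general
  only Lebesgue measurable.
\<close>

definition osc_form ::
  "nat \<Rightarrow> (nat \<Rightarrow> 'a::euclidean_space set) \<Rightarrow> ('a \<Rightarrow> real) \<Rightarrow> ('a \<Rightarrow> complex) \<Rightarrow> real
     \<Rightarrow> (nat \<Rightarrow> 'a \<Rightarrow> complex) \<Rightarrow> complex" where
  "osc_form n V P \<eta> l f =
     (LINT x|lebesgue. exp (\<i> * of_real (l * P x)) * (\<Prod>j=1..n. f j (orth_proj (V j) x)) * \<eta> x)"

definition uniform_power_decay ::
  "(nat \<Rightarrow> ('a::euclidean_space \<Rightarrow> real) \<Rightarrow> real) \<Rightarrow> nat \<Rightarrow> (nat \<Rightarrow> 'a set) \<Rightarrow> bool" where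
  "uniform_power_decay N n V \<longleftrightarrow>
     (\<forall>d. \<forall>c>0. \<forall>K. compact K \<longrightarrow>
       (\<exists>\<epsilon>>0. \<exists>C. \<forall>l f \<eta> P.
          (\<forall>j\<in>{1..n}. f j \<in> Linf (V j)) \<longrightarrow>
          C1 \<eta> \<longrightarrow> closure {x. \<eta> x \<noteq> 0} \<subseteq> K \<longrightarrow>
          P \<in> polys d \<longrightarrow> relative_norm (N d) d n V P \<ge> c \<longrightarrow>
          cmod (osc_form n V P \<eta> l f)
            \<le> C * C1_norm \<eta> * (1 + \<bar>l\<bar>) powr (- \<epsilon>) * (\<Prod>j=1..n. enn2real (Linf_norm (V j) (f j)))))"

lemma onb:
  assumes "subspace V"
  shows "onb V \<subseteq> V" "pairwise orthogonal (onb V)" "\<And>b. b \<in> onb V \<Longrightarrow> norm b = 1" "span (onb V) = V"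
proof -
  obtain B where "B \<subseteq> V \<and> pairwise orthogonal B \<and> (\<forall>b\<in>B. norm b = 1) \<and> span B = V"
    using orthonormal_basis_subspace[OF assms] by metis
  then have "onb V \<subseteq> V \<and> pairwise orthogonal (onb V) \<and> (\<forall>b\<in>onb V. norm b = 1) \<and> span (onb V) = V"
    unfolding onb_def by (rule someI)
  then show "onb V \<subseteq> V" "pairwise orthogonal (onb V)" "\<And>b. b \<in> onb V \<Longrightarrow> norm b = 1" "span (onb V) = V"
    by auto
qed

lemma orth_proj:
  assumes "subspace V"
  shows "orth_proj V x \<in> V" "\<And>v. v \<in> V \<Longrightarrow> orthogonal (x - orth_proj V x) v"
proof -
  obtain y z where y: "y \<in> V" "\<And>w. w \<in> V \<Longrightarrow> orthogonal z w" "x = y + z"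
    using orthogonal_subspace_decomp_exists[of V x] assms by (metis span_eq_iff)
  have "\<exists>!y. y \<in> V \<and> (\<forall>v\<in>V. orthogonal (x - y) v)"
  proof (rule ex1I[of _ y])
    show "y \<in> V \<and> (\<forall>v\<in>V. orthogonal (x - y) v)" using y by simp
  next
    fix u assume u: "u \<in> V \<and> (\<forall>v\<in>V. orthogonal (x - u) v)"
    then have "u - y \<in> V" using y(1) assms subspace_diff by blast
    then have "(x - y) \<bullet> (u - y) = 0" "(x - u) \<bullet> (u - y) = 0"
      using u y by (auto simp: orthogonal_def)
    then have "(u - y) \<bullet> (u - y) = 0" by (simp add: inner_diff_left)
    then show "u = y" by simp
  qed
  then have "orth_proj V x \<in> V \<and> (\<forall>v\<in>V. orthogonal (x - orth_proj V x) v)"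
    unfolding orth_proj_def by (rule theI')
  then show "orth_proj V x \<in> V" "\<And>v. v \<in> V \<Longrightarrow> orthogonal (x - orth_proj V x) v" by auto
qed

end

theory Submission
  imports Defs "HOL-Computational_Algebra.Fundamental_Theorem_Algebra"
begin

text \<open>
  Let \<open>w\<close> range over the distinct unit normals of the hyperplanes and let \<open>L\<close> be the product of the
  derivatives along the \<open>w\<close>. The kernel of \<open>L\<close> on polynomials consists of the sums of polynomials
  invariant along some \<open>w\<close>, so a lower bound on the relative norm of \<open>P\<close> bounds \<open>L P\<close> from below at
  one of finitely many fixed nodes. Decay in terms of \<open>\<bar>L P x\<bar>\<close> follows by induction on the number of
  normals. Cauchy--Schwarz removes the factor invariant along \<open>w\<close> and replaces \<open>P\<close> by the differences
  \<open>P - P (\<cdot> + s w)\<close>; these remain nondegenerate for most \<open>s\<close>, because a polynomial in one variable is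
  small only near its complex roots. A single factor is handled by integration by parts along \<open>w\<close>,
  away from a small sublevel set of the derivative of \<open>P\<close> along \<open>w\<close>.

  The averages over \<open>s\<close>, and over homotheties in the sublevel set estimate, are finite sums, so the
  estimates use only translation invariance and scaling of Lebesgue measure. Fubini's theorem enters
  only to show that preimages of null sets under the projection onto a hyperplane are null.
\<close>

section \<open>Polynomial functions\<close>

text \<open>Nondegeneracy is carried as one number: a lower bound A for
  \<open>\<bar>L P x\<bar>\<close> at a single point x, with decay a power of A. The frequency is
  absorbed into P until the end. This number survives Cauchy--Schwarz: if L' omits the direction w
  and G = L' P, then L' applied to P - P(. + s w) at x equals G(x) - G(x + s w), a polynomial in s
  that vanishes at 0 with derivative -L P(x). So the same point, support radius and degree bound
  serve at every stage, and only the exponent deteriorates. The factors are merely bounded, so a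
  derivative may be moved only along a direction in which every remaining factor is constant; this
  is why all factors but one have to be removed before integrating by parts. The decay estimate
  holds for every nonempty list of directions. The geometry of the hyperplanes enters through the
  kernel of L: if a direction were repeated, L would contain a higher power of one derivative, whose
  kernel is larger than the invariant polynomials. Hence there is one normal for each distinct
  hyperplane.\<close>

inductive poly_fun :: "nat \<Rightarrow> ('a::euclidean_space \<Rightarrow> real) \<Rightarrow> bool" where
  const: "poly_fun d (\<lambda>x. c)"
| inner: "poly_fun d p \<Longrightarrow> poly_fun (Suc d) (\<lambda>x. (x \<bullet> v) * p x)"
| add: "poly_fun d p \<Longrightarrow> poly_fun d q \<Longrightarrow> poly_fun d (\<lambda>x. p x + q x)"

lemma poly_fun_Suc: "poly_fun d p \<Longrightarrow> poly_fun (Suc d) p"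
  by (induction rule: poly_fun.induct) (auto intro: poly_fun.intros)

lemma poly_fun_mono: "poly_fun d p \<Longrightarrow> d \<le> e \<Longrightarrow> poly_fun e p"
  by (induction e) (auto intro: poly_fun_Suc simp: le_Suc_eq)

lemma poly_fun_cmult: "poly_fun d p \<Longrightarrow> poly_fun d (\<lambda>x. c * p x)"
proof (induction rule: poly_fun.induct)
  case (inner d p v)
  then have "poly_fun (Suc d) (\<lambda>x. (x \<bullet> v) * (c * p x))"
    by (intro poly_fun.inner)
  then show ?case by (simp add: mult.left_commute)
qed (auto intro: poly_fun.intros simp: distrib_left)

lemma poly_fun_diff: "poly_fun d p \<Longrightarrow> poly_fun d q \<Longrightarrow> poly_fun d (\<lambda>x. p x - q x)"
  using poly_fun.add[of d p "\<lambda>x. - 1 * q x"] poly_fun_cmult[of d q "-1"] by simp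

lemma poly_fun_sum: "(\<And>i. i \<in> I \<Longrightarrow> poly_fun d (p i)) \<Longrightarrow> poly_fun d (\<lambda>x. \<Sum>i\<in>I. p i x)"
  by (induction I rule: infinite_finite_induct) (auto intro: poly_fun.intros)

lemma poly_fun_mult: "poly_fun d p \<Longrightarrow> poly_fun e q \<Longrightarrow> poly_fun (d + e) (\<lambda>x. p x * q x)"
proof (induction rule: poly_fun.induct)
  case (const d c)
  then show ?case by (auto intro: poly_fun_cmult poly_fun_mono)
next
  case (inner d p v)
  then have "poly_fun (Suc (d + e)) (\<lambda>x. (x \<bullet> v) * (p x * q x))"
    by (intro poly_fun.inner)
  then show ?case by (simp add: mult.assoc)
next
  case (add d p1 p2)
  then show ?case using poly_fun.add by (fastforce simp: distrib_right)
qed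

lemma poly_fun_inner_power: "poly_fun k (\<lambda>x. (x \<bullet> v) ^ k)"
  by (induction k) (auto intro: poly_fun.intros)

lemma poly_fun_prod:
  "finite I \<Longrightarrow> (\<And>i. i \<in> I \<Longrightarrow> poly_fun (d i) (p i)) \<Longrightarrow> poly_fun (\<Sum>i\<in>I. d i) (\<lambda>x. \<Prod>i\<in>I. p i x)"
  by (induction I rule: finite_induct) (auto intro: poly_fun.const poly_fun_mult)

lemma poly_fun_translate: "poly_fun d p \<Longrightarrow> poly_fun d (\<lambda>x. p (x + a))"
proof (induction rule: poly_fun.induct)
  case (inner d p v)
  then have "poly_fun (Suc d) (\<lambda>x. (x \<bullet> v) * p (x + a) + (a \<bullet> v) * p (x + a))"
    by (intro poly_fun.add poly_fun.inner poly_fun_cmult poly_fun_Suc)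
  then show ?case by (simp add: inner_add_left distrib_right)
qed (auto intro: poly_fun.intros)

text \<open>The generators \<open>x \<bullet> v\<close> admit every vector v, so a linear
  substitution only replaces v by its image under the adjoint; in coordinates it would require
  expanding powers of linear forms. It is needed for composition with
  \<open>orth_proj\<close>.\<close>

lemma poly_fun_linear: "poly_fun d p \<Longrightarrow> linear f \<Longrightarrow> poly_fun d (\<lambda>x. p (f x))"
proof (induction rule: poly_fun.induct)
  case (inner d p v)
  then have "poly_fun (Suc d) (\<lambda>x. (x \<bullet> adjoint f v) * p (f x))"
    by (intro poly_fun.inner)
  moreover have "x \<bullet> adjoint f v = f x \<bullet> v" for x
    using inner(3) by (simp add: adjoint_works inner_commute)
  ultimately show ?case by simp
qed (auto intro: poly_fun.intros)

lemma poly_fun_continuous: "poly_fun d p \<Longrightarrow> continuous_on S p"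
  by (induction rule: poly_fun.induct) (auto intro!: continuous_intros)

lemma poly_fun_measurable: "poly_fun d p \<Longrightarrow> p \<in> borel_measurable borel"
  by (intro borel_measurable_continuous_onI poly_fun_continuous)

lemma poly_fun_line: "poly_fun d p \<Longrightarrow> \<exists>q. degree q \<le> d \<and> (\<forall>t. p (x + t *\<^sub>R v) = poly q t)"
proof (induction rule: poly_fun.induct)
  case (const d c)
  show ?case by (intro exI[of _ "[:c:]"]) auto
next
  case (inner d p u)
  then obtain q where q: "degree q \<le> d" "\<And>t. p (x + t *\<^sub>R v) = poly q t" by blast
  have "degree ([:x \<bullet> u, v \<bullet> u:] * q) \<le> degree [:x \<bullet> u, v \<bullet> u:] + degree q"
    by (rule degree_mult_le)
  also have "\<dots> \<le> Suc d" using q(1) by simp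
  finally have "degree ([:x \<bullet> u, v \<bullet> u:] * q) \<le> Suc d" .
  moreover have "((x + t *\<^sub>R v) \<bullet> u) * p (x + t *\<^sub>R v) = poly ([:x \<bullet> u, v \<bullet> u:] * q) t" for t
    by (simp add: q inner_add_left algebra_simps)
  ultimately show ?case by blast
next
  case (add d p1 p2)
  then obtain q1 q2 where "degree q1 \<le> d" "\<And>t. p1 (x + t *\<^sub>R v) = poly q1 t"
    "degree q2 \<le> d" "\<And>t. p2 (x + t *\<^sub>R v) = poly q2 t" by blast
  then show ?case by (intro exI[of _ "q1 + q2"]) (auto intro: degree_add_le)
qed

subsection \<open>Comparison with the coordinate description\<close>

lemma finite_multi_index:
  assumes "finite B"
  shows "finite {\<alpha> \<in> B \<rightarrow>\<^sub>E (UNIV :: nat set). (\<Sum>b\<in>B. \<alpha> b) \<le> d}"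
proof (rule finite_subset)
  show "{\<alpha> \<in> B \<rightarrow>\<^sub>E (UNIV :: nat set). (\<Sum>b\<in>B. \<alpha> b) \<le> d} \<subseteq> B \<rightarrow>\<^sub>E {..d}"
  proof
    fix \<alpha> assume "\<alpha> \<in> {\<alpha> \<in> B \<rightarrow>\<^sub>E (UNIV :: nat set). (\<Sum>b\<in>B. \<alpha> b) \<le> d}"
    then have "\<alpha> \<in> B \<rightarrow>\<^sub>E UNIV" and "\<And>b. b \<in> B \<Longrightarrow> \<alpha> b \<le> d"
      using assms member_le_sum[of _ B \<alpha>] by fastforce+
    then show "\<alpha> \<in> B \<rightarrow>\<^sub>E {..d}" by (auto simp: PiE_iff)
  qed
  show "finite (B \<rightarrow>\<^sub>E {..d})" using assms by (intro finite_PiE) auto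
qed

lemma polys_in_imp_poly_fun:
  assumes "finite B" "p \<in> polys_in B d"
  shows "poly_fun d p"
proof -
  obtain c where p: "p = (\<lambda>x. \<Sum>\<alpha>\<in>{\<alpha> \<in> B \<rightarrow>\<^sub>E UNIV. (\<Sum>b\<in>B. \<alpha> b) \<le> d}. c \<alpha> * (\<Prod>b\<in>B. (x \<bullet> b) ^ \<alpha> b))"
    using assms(2) unfolding polys_in_def by blast
  show ?thesis unfolding p
  proof (intro poly_fun_sum poly_fun_cmult)
    fix \<alpha> assume "\<alpha> \<in> {\<alpha> \<in> B \<rightarrow>\<^sub>E (UNIV :: nat set). (\<Sum>b\<in>B. \<alpha> b) \<le> d}"
    then show "poly_fun d (\<lambda>x. \<Prod>b\<in>B. (x \<bullet> b) ^ \<alpha> b)"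
      using poly_fun_mono[OF poly_fun_prod[of B \<alpha> "\<lambda>b x. (x \<bullet> b) ^ \<alpha> b"]] assms(1) poly_fun_inner_power
      by auto
  qed
qed

lemma polys_in_add:
  assumes "p \<in> polys_in B d" "q \<in> polys_in B d"
  shows "(\<lambda>x. p x + q x) \<in> polys_in B d"
proof -
  obtain a b where "p = (\<lambda>x. \<Sum>\<alpha>\<in>{\<alpha> \<in> B \<rightarrow>\<^sub>E UNIV. (\<Sum>b\<in>B. \<alpha> b) \<le> d}. a \<alpha> * (\<Prod>b\<in>B. (x \<bullet> b) ^ \<alpha> b))"
    "q = (\<lambda>x. \<Sum>\<alpha>\<in>{\<alpha> \<in> B \<rightarrow>\<^sub>E UNIV. (\<Sum>b\<in>B. \<alpha> b) \<le> d}. b \<alpha> * (\<Prod>b\<in>B. (x \<bullet> b) ^ \<alpha> b))"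
    using assms unfolding polys_in_def by blast
  then show ?thesis unfolding polys_in_def
    by (intro CollectI exI[of _ "\<lambda>\<alpha>. a \<alpha> + b \<alpha>"]) (simp add: sum.distrib distrib_right)
qed

lemma polys_in_cmult:
  assumes "p \<in> polys_in B d"
  shows "(\<lambda>x. c * p x) \<in> polys_in B d"
proof -
  obtain a where "p = (\<lambda>x. \<Sum>\<alpha>\<in>{\<alpha> \<in> B \<rightarrow>\<^sub>E UNIV. (\<Sum>b\<in>B. \<alpha> b) \<le> d}. a \<alpha> * (\<Prod>b\<in>B. (x \<bullet> b) ^ \<alpha> b))"
    using assms unfolding polys_in_def by blast
  then show ?thesis unfolding polys_in_def
    by (intro CollectI exI[of _ "\<lambda>\<alpha>. c * a \<alpha>"]) (simp add: sum_distrib_left mult.assoc)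
qed

lemma polys_in_monomial:
  assumes "finite B" "\<alpha> \<in> B \<rightarrow>\<^sub>E (UNIV :: nat set)" "(\<Sum>b\<in>B. \<alpha> b) \<le> d"
  shows "(\<lambda>x. \<Prod>b\<in>B. (x \<bullet> b) ^ \<alpha> b) \<in> polys_in B d"
  unfolding polys_in_def
proof (intro CollectI exI[of _ "\<lambda>\<beta>. if \<beta> = \<alpha> then 1 else 0"] ext)
  fix x
  have "(\<Sum>\<beta>\<in>{\<alpha> \<in> B \<rightarrow>\<^sub>E UNIV. (\<Sum>b\<in>B. \<alpha> b) \<le> d}. (if \<beta> = \<alpha> then 1 else 0) * (\<Prod>b\<in>B. (x \<bullet> b) ^ \<beta> b))
     = (\<Sum>\<beta>\<in>{\<alpha> \<in> B \<rightarrow>\<^sub>E UNIV. (\<Sum>b\<in>B. \<alpha> b) \<le> d}. if \<beta> = \<alpha> then (\<Prod>b\<in>B. (x \<bullet> b) ^ \<beta> b) else 0)"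
    by (intro sum.cong) auto
  also have "\<dots> = (\<Prod>b\<in>B. (x \<bullet> b) ^ \<alpha> b)"
    using assms finite_multi_index[OF assms(1), of d] by (subst sum.delta) auto
  finally show "(\<Prod>b\<in>B. (x \<bullet> b) ^ \<alpha> b)
    = (\<Sum>\<beta>\<in>{\<alpha> \<in> B \<rightarrow>\<^sub>E UNIV. (\<Sum>b\<in>B. \<alpha> b) \<le> d}. (if \<beta> = \<alpha> then 1 else 0) * (\<Prod>b\<in>B. (x \<bullet> b) ^ \<beta> b))"
    by simp
qed

lemma polys_in_const:
  assumes "finite B"
  shows "(\<lambda>x. c) \<in> polys_in B d"
proof -
  have "(\<lambda>x. \<Prod>b\<in>B. (x \<bullet> b) ^ (\<lambda>b\<in>B. 0) b) \<in> polys_in B d"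
    using assms by (intro polys_in_monomial) auto
  moreover have "(\<lambda>x. \<Prod>b\<in>B. (x \<bullet> b) ^ (\<lambda>b\<in>B. 0) b) = (\<lambda>x. 1)"
    by (auto intro!: prod.neutral)
  ultimately show ?thesis using polys_in_cmult[of "\<lambda>x. 1" B d c] by simp
qed

lemma polys_in_sum:
  assumes "finite B" "\<And>i. i \<in> I \<Longrightarrow> p i \<in> polys_in B d"
  shows "(\<lambda>x. \<Sum>i\<in>I. p i x) \<in> polys_in B d"
  using assms(2)
  by (induction I rule: infinite_finite_induct) (auto intro: polys_in_const[OF assms(1)] polys_in_add)

lemma polys_in_coord:
  assumes B: "finite B" "e \<in> B" and p: "p \<in> polys_in B d"
  shows "(\<lambda>x. (x \<bullet> e) * p x) \<in> polys_in B (Suc d)"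
proof -
  let ?I = "{\<alpha> \<in> B \<rightarrow>\<^sub>E (UNIV :: nat set). (\<Sum>b\<in>B. \<alpha> b) \<le> d}"
  obtain c where c: "p = (\<lambda>x. \<Sum>\<alpha>\<in>?I. c \<alpha> * (\<Prod>b\<in>B. (x \<bullet> b) ^ \<alpha> b))"
    using p unfolding polys_in_def by blast
  have "(\<lambda>x. \<Sum>\<alpha>\<in>?I. c \<alpha> * (\<Prod>b\<in>B. (x \<bullet> b) ^ (\<alpha>(e := Suc (\<alpha> e))) b)) \<in> polys_in B (Suc d)"
  proof (intro polys_in_sum polys_in_cmult polys_in_monomial B(1))
    fix \<alpha> assume \<alpha>: "\<alpha> \<in> ?I"
    then show "\<alpha>(e := Suc (\<alpha> e)) \<in> B \<rightarrow>\<^sub>E UNIV" using B(2) by (auto simp: PiE_iff extensional_def)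
    show "(\<Sum>b\<in>B. (\<alpha>(e := Suc (\<alpha> e))) b) \<le> Suc d"
      using \<alpha> B by (simp add: sum.remove[OF B])
  qed
  moreover have "(\<Prod>b\<in>B. (x \<bullet> b) ^ (\<alpha>(e := Suc (\<alpha> e))) b) = (x \<bullet> e) * (\<Prod>b\<in>B. (x \<bullet> b) ^ \<alpha> b)" for x and \<alpha> :: "'a \<Rightarrow> nat"
    using B by (simp add: prod.remove[OF B])
  ultimately show ?thesis unfolding c by (simp add: sum_distrib_left mult.left_commute)
qed

text \<open>The condition on x says that x is recovered from its coordinates. For the standard basis
  this is every point, for \<open>onb V\<close> exactly the points of V, so one induction serves
  both \<open>polys\<close> and \<open>polys_on\<close>.\<close>

lemma poly_fun_imp_polys_in:
  assumes "poly_fun d p" "finite B"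
  shows "\<exists>q\<in>polys_in B d. \<forall>x. x = (\<Sum>b\<in>B. (x \<bullet> b) *\<^sub>R b) \<longrightarrow> p x = q x"
  using assms(1)
proof (induction rule: poly_fun.induct)
  case (const d c)
  then show ?case using polys_in_const[OF assms(2)] by (intro bexI[of _ "\<lambda>x. c"]) auto
next
  case (inner d p v)
  then obtain q where q: "q \<in> polys_in B d" "\<And>x. x = (\<Sum>b\<in>B. (x \<bullet> b) *\<^sub>R b) \<Longrightarrow> p x = q x" by blast
  have "(\<lambda>x. \<Sum>b\<in>B. (b \<bullet> v) * ((x \<bullet> b) * q x)) \<in> polys_in B (Suc d)"
    using assms(2) q(1) by (intro polys_in_sum polys_in_cmult polys_in_coord)
  moreover have "(x \<bullet> v) * p x = (\<Sum>b\<in>B. (b \<bullet> v) * ((x \<bullet> b) * q x))"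
    if x: "x = (\<Sum>b\<in>B. (x \<bullet> b) *\<^sub>R b)" for x
  proof -
    have "x \<bullet> v = (\<Sum>b\<in>B. (b \<bullet> v) * (x \<bullet> b))"
      using arg_cong[OF x, of "\<lambda>y. y \<bullet> v"] by (simp only: inner_sum_left inner_scaleR_left mult.commute)
    then show ?thesis using q(2)[OF x] by (simp add: sum_distrib_right mult.assoc)
  qed
  ultimately show ?case
    by (intro bexI[of _ "\<lambda>x. \<Sum>b\<in>B. (b \<bullet> v) * ((x \<bullet> b) * q x)"]) auto
next
  case (add d p1 p2)
  then obtain q1 q2 where q: "q1 \<in> polys_in B d" "\<And>x. x = (\<Sum>b\<in>B. (x \<bullet> b) *\<^sub>R b) \<Longrightarrow> p1 x = q1 x"
    "q2 \<in> polys_in B d" "\<And>x. x = (\<Sum>b\<in>B. (x \<bullet> b) *\<^sub>R b) \<Longrightarrow> p2 x = q2 x"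
    by blast
  then show ?case by (intro bexI[OF _ polys_in_add[OF q(1,3)]]) auto
qed

lemma polys_iff_poly_fun: "p \<in> polys d \<longleftrightarrow> poly_fun d p"
proof
  show "poly_fun d p" if "p \<in> polys d" using polys_in_imp_poly_fun[OF _ that] by simp
  assume "poly_fun d p"
  then obtain q where "q \<in> polys d" "\<forall>x. x = (\<Sum>b\<in>Basis. (x \<bullet> b) *\<^sub>R b) \<longrightarrow> p x = q x"
    using poly_fun_imp_polys_in[of d p Basis] by auto
  then have "p = q" by (auto simp: euclidean_representation)
  then show "p \<in> polys d" using \<open>q \<in> polys d\<close> by simp
qed

lemma orthonormal_expansion:
  assumes "pairwise orthogonal B" "\<And>b. b \<in> B \<Longrightarrow> norm b = 1" "x \<in> span B" "finite B"
  shows "x = (\<Sum>b\<in>B. (x \<bullet> b) *\<^sub>R b)"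
proof -
  obtain u where u: "x = (\<Sum>b\<in>B. u b *\<^sub>R b)"
    using assms(3,4) by (auto simp: span_finite)
  have "x \<bullet> b = u b" if b: "b \<in> B" for b
  proof -
    have "x \<bullet> b = (\<Sum>c\<in>B. u c * (c \<bullet> b))" unfolding u by (simp add: inner_sum_left)
    also have "\<dots> = (\<Sum>c\<in>B. if c = b then u b else 0)"
      using assms(1,2) b by (intro sum.cong) (auto simp: pairwise_def orthogonal_def dot_square_norm)
    finally show ?thesis using assms(4) b by simp
  qed
  then show ?thesis using u by simp
qed

lemma onb_finite: "subspace V \<Longrightarrow> finite (onb V)"
  using onb[of V] by (metis norm_zero pairwise_orthogonal_imp_finite zero_neq_one)

lemma poly_fun_imp_polys_on:
  assumes "subspace V" "poly_fun d p"
  shows "p \<in> polys_on V d"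
proof -
  obtain q where "q \<in> polys_in (onb V) d" "\<forall>x. x = (\<Sum>b\<in>onb V. (x \<bullet> b) *\<^sub>R b) \<longrightarrow> p x = q x"
    using poly_fun_imp_polys_in[OF assms(2) onb_finite[OF assms(1)]] by blast
  then show ?thesis unfolding polys_on_def
    using orthonormal_expansion[OF onb(2,3)[OF assms(1)] _ onb_finite[OF assms(1)]] onb(4)[OF assms(1)] by blast
qed

section \<open>Sublevel sets of polynomials in one variable\<close>

text \<open>Only the real parts of the roots near the unit disc can make the polynomial small.\<close>

lemma complex_poly_sublevel:
  fixes q :: "complex poly"
  assumes "degree q \<le> d" "A \<le> cmod (poly q 0)" "0 \<le> A"
  shows "\<exists>Z::real set. finite Z \<and> card Z \<le> d \<and>
    (\<forall>t \<rho>. \<bar>t\<bar> \<le> 1 \<longrightarrow> 0 < \<rho> \<longrightarrow> \<rho> \<le> 1 \<longrightarrow> (\<forall>z\<in>Z. \<rho> \<le> \<bar>t - z\<bar>) \<longrightarrow>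
       A * (\<rho> / 4) ^ d \<le> cmod (poly q (of_real t)))"
  using assms
proof (induction d arbitrary: q A)
  case 0
  then obtain c where "q = [:c:]" using degree_eq_zeroE[of q] by auto
  then show ?case using 0 by (intro exI[of _ "{}"]) auto
next
  case (Suc d)
  show ?case
  \<comment> \<open>Once A is positive, 0 is not a root, so \<open>cmod z\<close> may be divided by
    below.\<close>
  proof (cases "degree q = 0 \<or> A = 0")
    case True
    have "A * (\<rho> / 4) ^ Suc d \<le> cmod (poly q (of_real t))" if "0 < \<rho>" "\<rho> \<le> 1" for \<rho> t
    proof -
      have "(\<rho> / 4) ^ Suc d \<le> 1" using that by (intro power_le_one) auto
      then have "A * (\<rho> / 4) ^ Suc d \<le> A" using Suc(4) by (rule mult_left_le)
      moreover have "A \<le> cmod (poly q (of_real t))"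
        using True Suc(3) by (auto elim!: degree_eq_zeroE)
      ultimately show ?thesis by linarith
    qed
    then show ?thesis by (intro exI[of _ "{}"]) auto
  next
    case False
    then have "A > 0" using Suc(4) by simp
    obtain z where z: "poly q z = 0"
      using False by (metis fundamental_theorem_of_algebra_alt degree_pCons_0)
    then obtain h where h: "q = [:- z, 1:] * h" by (auto simp: poly_eq_0_iff_dvd elim: dvdE)
    have "h \<noteq> 0" using False h by auto
    then have "degree q = Suc (degree h)" unfolding h by (subst degree_mult_eq) auto
    then have dh: "degree h \<le> d" using Suc(2) by simp
    have A: "A \<le> cmod z * cmod (poly h 0)" using Suc(3) by (simp add: h norm_mult)
    have z0: "cmod z > 0" using A \<open>A > 0\<close> by (auto intro: ccontr)
    have A': "A / cmod z \<le> cmod (poly h 0)"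
      using A z0 by (simp add: field_simps)
    obtain Z where Z: "finite Z" "card Z \<le> d" and lower: "\<And>t \<rho>. \<bar>t\<bar> \<le> 1 \<Longrightarrow> 0 < \<rho> \<Longrightarrow> \<rho> \<le> 1 \<Longrightarrow>
        (\<forall>z\<in>Z. \<rho> \<le> \<bar>t - z\<bar>) \<Longrightarrow> A / cmod z * (\<rho> / 4) ^ d \<le> cmod (poly h (of_real t))"
      using Suc.IH[OF dh A'] \<open>A > 0\<close> by auto
    have "A * (\<rho> / 4) ^ Suc d \<le> cmod (poly q (of_real t))"
      if t: "\<bar>t\<bar> \<le> 1" "0 < \<rho>" "\<rho> \<le> 1" and avoid: "\<forall>z\<in>insert (Re z) Z. \<rho> \<le> \<bar>t - z\<bar>" for t \<rho>
    proof -
      \<comment> \<open>Dividing out the root z changes the value at 0 by the factor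
        \<open>cmod z\<close>, so the linear factor is compared with \<open>cmod z\<close>. If
        \<open>cmod z \<ge> 2\<close>, its modulus is at least half of \<open>cmod z\<close> for all
        admissible t; for smaller roots the distance of t from the real part gives at least
        \<rho>.\<close>
      have factor: "\<rho> / 4 * cmod z \<le> cmod (of_real t - z)"
      proof (cases "cmod z \<ge> 2")
        case True
        have "cmod z - \<bar>t\<bar> \<le> cmod (of_real t - z)"
          using norm_triangle_ineq2[of z "of_real t"] by (simp add: norm_minus_commute)
        moreover have "\<rho> / 4 * cmod z \<le> 1 / 4 * cmod z"
          using t(3) by (intro mult_right_mono) auto
        ultimately show ?thesis using t(1) True by linarith
      next
        case False
        have "\<rho> \<le> \<bar>Re (of_real t - z)\<bar>" using avoid by simp
        also have "\<dots> \<le> cmod (of_real t - z)" by (rule abs_Re_le_cmod)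
        finally have "\<rho> \<le> cmod (of_real t - z)" .
        moreover have "\<rho> / 4 * cmod z \<le> \<rho> / 4 * 2" using False t(2) by (intro mult_left_mono) auto
        ultimately show ?thesis using t(2) by linarith
      qed
      have "A * (\<rho> / 4) ^ Suc d = (\<rho> / 4 * cmod z) * (A / cmod z * (\<rho> / 4) ^ d)"
        using z0 by simp
      also have "\<dots> \<le> cmod (of_real t - z) * cmod (poly h (of_real t))"
        using factor lower[OF t] avoid t \<open>A > 0\<close> by (intro mult_mono) auto
      also have "\<dots> = cmod (poly q (of_real t))" by (simp add: h norm_mult[symmetric] algebra_simps)
      finally show ?thesis .
    qed
    moreover have "card (insert (Re z) Z) \<le> Suc d" using Z by (simp add: card_insert_if)
    ultimately show ?thesis using Z(1) by (intro exI[of _ "insert (Re z) Z"]) auto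
  qed
qed

lemma real_poly_sublevel:
  fixes q :: "real poly"
  assumes "degree q \<le> d" "A \<le> \<bar>poly q 0\<bar>" "0 \<le> A"
  shows "\<exists>Z::real set. finite Z \<and> card Z \<le> d \<and>
    (\<forall>t \<rho>. \<bar>t\<bar> \<le> 1 \<longrightarrow> 0 < \<rho> \<longrightarrow> \<rho> \<le> 1 \<longrightarrow> (\<forall>z\<in>Z. \<rho> \<le> \<bar>t - z\<bar>) \<longrightarrow>
       A * (\<rho> / 4) ^ d \<le> \<bar>poly q t\<bar>)"
proof -
  have "poly (map_poly of_real q) (of_real t) = complex_of_real (poly q t)" for t
    by (induction q) (simp_all add: map_poly_pCons)
  then have eq: "cmod (poly (map_poly of_real q) (of_real t)) = \<bar>poly q t\<bar>" for t
    by simp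
  have "degree (map_poly of_real q :: complex poly) \<le> d"
    using assms(1) map_poly_degree_leq le_trans by blast
  moreover have "A \<le> cmod (poly (map_poly of_real q) 0)" using assms(2) eq[of 0] by simp
  ultimately show ?thesis using complex_poly_sublevel[OF _ _ assms(3)] unfolding eq[symmetric] by blast
qed

lemma poly_fun_sublevel:
  assumes "poly_fun d p" "A \<le> \<bar>p x\<bar>" "0 \<le> A"
  shows "\<exists>Z::real set. finite Z \<and> card Z \<le> d \<and>
    (\<forall>t \<rho>. \<bar>t\<bar> \<le> 1 \<longrightarrow> 0 < \<rho> \<longrightarrow> \<rho> \<le> 1 \<longrightarrow> (\<forall>z\<in>Z. \<rho> \<le> \<bar>t - z\<bar>) \<longrightarrow>
       A * (\<rho> / 4) ^ d \<le> \<bar>p (x + t *\<^sub>R v)\<bar>)"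
proof -
  obtain q where q: "degree q \<le> d" "\<And>t. p (x + t *\<^sub>R v) = poly q t"
    using poly_fun_line[OF assms(1)] by blast
  have "A \<le> \<bar>poly q 0\<bar>" using assms(2) q(2)[of 0] by simp
  from real_poly_sublevel[OF q(1) this assms(3)] show ?thesis by (simp add: q(2))
qed

section \<open>Directional derivatives\<close>

definition dirderiv :: "'a::real_normed_vector \<Rightarrow> ('a \<Rightarrow> real) \<Rightarrow> 'a \<Rightarrow> real" where
  "dirderiv w p x = deriv (\<lambda>t. p (x + t *\<^sub>R w)) 0"

definition invariant_along :: "'a::real_vector \<Rightarrow> ('a \<Rightarrow> 'b) \<Rightarrow> bool" where
  "invariant_along w f \<longleftrightarrow> (\<forall>x t. f (x + t *\<^sub>R w) = f x)"

text \<open>Truncated subtraction gives d - 1 = 0 also for d = 0, which would leave room for a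
  nonzero constant. The separate clause excludes it, and the \<open>inner\<close> case with d = 0
  depends on this: there \<open>(x \<bullet> v) * q x\<close> must have degree 0.\<close>

lemma poly_fun_has_derivative_ex:
  assumes "poly_fun d p"
  shows "\<exists>q. poly_fun (d - 1) q \<and> (d = 0 \<longrightarrow> q = (\<lambda>x. 0)) \<and>
    (\<forall>x t. ((\<lambda>t. p (x + t *\<^sub>R w)) has_real_derivative q (x + t *\<^sub>R w)) (at t))"
  using assms
proof (induction rule: poly_fun.induct)
  case (const d c)
  then show ?case by (intro exI[of _ "\<lambda>x. 0"]) (auto intro: poly_fun.const)
next
  case (inner d p v)
  then obtain q where q: "poly_fun (d - 1) q" "d = 0 \<Longrightarrow> q = (\<lambda>x. 0)"
    "\<And>x t. ((\<lambda>t. p (x + t *\<^sub>R w)) has_real_derivative q (x + t *\<^sub>R w)) (at t)" by blast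
  have "poly_fun d (\<lambda>x. (x \<bullet> v) * q x)"
    using q(1,2) by (cases d) (auto intro: poly_fun.intros)
  then have "poly_fun d (\<lambda>x. (w \<bullet> v) * p x + (x \<bullet> v) * q x)"
    using inner(1) by (intro poly_fun.add poly_fun_cmult)
  moreover have "((\<lambda>t. ((x + t *\<^sub>R w) \<bullet> v) * p (x + t *\<^sub>R w)) has_real_derivative
      (w \<bullet> v) * p (x + t *\<^sub>R w) + ((x + t *\<^sub>R w) \<bullet> v) * q (x + t *\<^sub>R w)) (at t)" for x t
  proof -
    have "((\<lambda>t. (x + t *\<^sub>R w) \<bullet> v) has_real_derivative w \<bullet> v) (at t)"
      unfolding inner_add_left inner_scaleR_left by (auto intro!: derivative_eq_intros)
    from DERIV_mult[OF this q(3)[of x t]] show ?thesis by (simp add: algebra_simps)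
  qed
  ultimately show ?case by (intro exI[of _ "\<lambda>x. (w \<bullet> v) * p x + (x \<bullet> v) * q x"]) auto
next
  case (add d p1 p2)
  then obtain q1 q2 where "poly_fun (d - 1) q1" "d = 0 \<Longrightarrow> q1 = (\<lambda>x. 0)"
    "\<And>x t. ((\<lambda>t. p1 (x + t *\<^sub>R w)) has_real_derivative q1 (x + t *\<^sub>R w)) (at t)"
    "poly_fun (d - 1) q2" "d = 0 \<Longrightarrow> q2 = (\<lambda>x. 0)"
    "\<And>x t. ((\<lambda>t. p2 (x + t *\<^sub>R w)) has_real_derivative q2 (x + t *\<^sub>R w)) (at t)" by blast
  then show ?case
    by (intro exI[of _ "\<lambda>x. q1 x + q2 x"]) (auto intro: poly_fun.add DERIV_add)
qed

lemma
  assumes "poly_fun d p"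
  shows poly_fun_dirderiv: "poly_fun (d - 1) (dirderiv w p)"
    and dirderiv_degree_0: "d = 0 \<Longrightarrow> dirderiv w p = (\<lambda>x. 0)"
    and poly_fun_DERIV: "((\<lambda>t. p (x + t *\<^sub>R w)) has_real_derivative dirderiv w p (x + t *\<^sub>R w)) (at t)"
proof -
  obtain q where q: "poly_fun (d - 1) q" "d = 0 \<Longrightarrow> q = (\<lambda>x. 0)"
    "\<And>x t. ((\<lambda>t. p (x + t *\<^sub>R w)) has_real_derivative q (x + t *\<^sub>R w)) (at t)"
    using poly_fun_has_derivative_ex[OF assms] by blast
  have "dirderiv w p = q"
    unfolding dirderiv_def using q(3)[of _ 0] by (auto intro: DERIV_imp_deriv)
  then show "poly_fun (d - 1) (dirderiv w p)" "d = 0 \<Longrightarrow> dirderiv w p = (\<lambda>x. 0)"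
    "((\<lambda>t. p (x + t *\<^sub>R w)) has_real_derivative dirderiv w p (x + t *\<^sub>R w)) (at t)"
    using q by auto
qed

lemma dirderiv_eqI:
  assumes "\<And>x. ((\<lambda>t. p (x + t *\<^sub>R w)) has_real_derivative q x) (at 0)"
  shows "dirderiv w p = q"
  unfolding dirderiv_def using assms by (auto intro: DERIV_imp_deriv)

lemma poly_fun_DERIV_0:
  "poly_fun d p \<Longrightarrow> ((\<lambda>t. p (x + t *\<^sub>R w)) has_real_derivative dirderiv w p x) (at 0)"
  using poly_fun_DERIV[of d p x w 0] by simp

lemma poly_fun_dirderiv': "poly_fun d p \<Longrightarrow> poly_fun d (dirderiv w p)"
  by (rule poly_fun_mono[OF poly_fun_dirderiv]) auto

lemma dirderiv_add:
  "poly_fun d p \<Longrightarrow> poly_fun d q \<Longrightarrow>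
    dirderiv w (\<lambda>x. p x + q x) = (\<lambda>x. dirderiv w p x + dirderiv w q x)"
  by (rule dirderiv_eqI) (auto intro!: DERIV_add intro: poly_fun_DERIV_0)

lemma dirderiv_diff:
  "poly_fun d p \<Longrightarrow> poly_fun d q \<Longrightarrow>
    dirderiv w (\<lambda>x. p x - q x) = (\<lambda>x. dirderiv w p x - dirderiv w q x)"
  by (rule dirderiv_eqI) (auto intro!: DERIV_diff intro: poly_fun_DERIV_0)

lemma dirderiv_cmult:
  "poly_fun d p \<Longrightarrow> dirderiv w (\<lambda>x. c * p x) = (\<lambda>x. c * dirderiv w p x)"
  by (rule dirderiv_eqI) (auto intro!: DERIV_cmult intro: poly_fun_DERIV_0)

lemma dirderiv_sum:
  "(\<And>i. i \<in> I \<Longrightarrow> poly_fun d (p i)) \<Longrightarrow>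
    dirderiv w (\<lambda>x. \<Sum>i\<in>I. p i x) = (\<lambda>x. \<Sum>i\<in>I. dirderiv w (p i) x)"
  by (rule dirderiv_eqI) (auto intro!: DERIV_sum intro: poly_fun_DERIV_0)

lemma dirderiv_translate: "dirderiv w (\<lambda>x. p (x + a)) = (\<lambda>x. dirderiv w p (x + a))"
  by (simp add: fun_eq_iff dirderiv_def add_ac)

lemma invariant_along_dirderiv:
  assumes "invariant_along v p"
  shows "invariant_along v (dirderiv w p)"
proof -
  have "p (x + s *\<^sub>R v + t *\<^sub>R w) = p (x + t *\<^sub>R w)" for x s t
    using assms unfolding invariant_along_def by (metis add.commute add.left_commute)
  then show ?thesis by (simp add: invariant_along_def dirderiv_def)
qed

lemma dirderiv_zero_imp_invariant:
  assumes "poly_fun d p" "dirderiv w p = (\<lambda>x. 0)"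
  shows "invariant_along w p"
  unfolding invariant_along_def
proof (intro allI)
  fix x t
  have "((\<lambda>t. p (x + t *\<^sub>R w)) has_real_derivative 0) (at t)" for t
    using poly_fun_DERIV[OF assms(1), of x w t] assms(2) by simp
  from DERIV_isconst_all[of "\<lambda>t. p (x + t *\<^sub>R w)", OF allI[OF this], of t 0]
  show "p (x + t *\<^sub>R w) = p x" by simp
qed

abbreviation dirderivs :: "'a::real_normed_vector list \<Rightarrow> ('a \<Rightarrow> real) \<Rightarrow> 'a \<Rightarrow> real" where
  "dirderivs ws \<equiv> foldr dirderiv ws"

lemma poly_fun_dirderivs: "poly_fun d p \<Longrightarrow> poly_fun d (dirderivs ws p)"
  by (induction ws) (auto intro: poly_fun_dirderiv')

lemma dirderivs_add:
  "poly_fun d p \<Longrightarrow> poly_fun d q \<Longrightarrow>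
    dirderivs ws (\<lambda>x. p x + q x) = (\<lambda>x. dirderivs ws p x + dirderivs ws q x)"
  by (induction ws) (simp_all add: dirderiv_add[OF poly_fun_dirderivs poly_fun_dirderivs])

lemma dirderivs_diff:
  "poly_fun d p \<Longrightarrow> poly_fun d q \<Longrightarrow>
    dirderivs ws (\<lambda>x. p x - q x) = (\<lambda>x. dirderivs ws p x - dirderivs ws q x)"
  by (induction ws) (simp_all add: dirderiv_diff[OF poly_fun_dirderivs poly_fun_dirderivs])

lemma dirderivs_cmult:
  "poly_fun d p \<Longrightarrow> dirderivs ws (\<lambda>x. c * p x) = (\<lambda>x. c * dirderivs ws p x)"
  by (induction ws) (simp_all add: dirderiv_cmult[OF poly_fun_dirderivs])

lemma dirderivs_translate: "dirderivs ws (\<lambda>x. p (x + a)) = (\<lambda>x. dirderivs ws p (x + a))"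
  by (induction ws) (simp_all add: dirderiv_translate)

text \<open>Up to sign the increment is t times a polynomial h in t, and h at 0 is the directional
  derivative. The exceptional points for h are joined by 0, on account of the factor t; hence d + 1
  in both the count and the exponent.\<close>

lemma poly_fun_increment_sublevel:
  assumes "poly_fun d p" "A \<le> \<bar>dirderiv w p x\<bar>" "0 \<le> A"
  shows "\<exists>Z::real set. finite Z \<and> card Z \<le> d + 1 \<and>
    (\<forall>t \<rho>. \<bar>t\<bar> \<le> 1 \<longrightarrow> 0 < \<rho> \<longrightarrow> \<rho> \<le> 1 \<longrightarrow> (\<forall>z\<in>Z. \<rho> \<le> \<bar>t - z\<bar>) \<longrightarrow>
       A * (\<rho> / 4) ^ (d + 1) \<le> \<bar>p x - p (x + t *\<^sub>R w)\<bar>)"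
proof -
  obtain q where q: "degree q \<le> d" "\<And>t. p (x + t *\<^sub>R w) = poly q t"
    using poly_fun_line[OF assms(1)] by blast
  obtain a h where ah: "q = pCons a h" by (cases q)
  have inc: "p (x + t *\<^sub>R w) = p x + t * poly h t" for t
    using q(2)[of t] q(2)[of 0] by (simp add: ah)
  have "((\<lambda>t. p (x + t *\<^sub>R w)) has_real_derivative poly h 0) (at 0)"
    unfolding inc by (auto intro!: derivative_eq_intros poly_DERIV)
  then have "dirderiv w p x = poly h 0" unfolding dirderiv_def by (rule DERIV_imp_deriv)
  then have A: "A \<le> \<bar>poly h 0\<bar>" using assms(2) by simp
  have "degree h \<le> d" using q(1) unfolding ah by (metis degree_pCons_eq degree_0 le0 Suc_leD)
  from real_poly_sublevel[OF this A assms(3)] obtain Z where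
    Z: "finite Z" "card Z \<le> d" and lower: "\<And>t \<rho>. \<bar>t\<bar> \<le> 1 \<Longrightarrow> 0 < \<rho> \<Longrightarrow> \<rho> \<le> 1 \<Longrightarrow>
       (\<forall>z\<in>Z. \<rho> \<le> \<bar>t - z\<bar>) \<Longrightarrow> A * (\<rho> / 4) ^ d \<le> \<bar>poly h t\<bar>" by blast
  have "A * (\<rho> / 4) ^ (d + 1) \<le> \<bar>p x - p (x + t *\<^sub>R w)\<bar>"
    if t: "\<bar>t\<bar> \<le> 1" "0 < \<rho>" "\<rho> \<le> 1" and avoid: "\<forall>z\<in>insert 0 Z. \<rho> \<le> \<bar>t - z\<bar>" for t \<rho>
  proof -
    have "A * (\<rho> / 4) ^ (d + 1) = (\<rho> / 4) * (A * (\<rho> / 4) ^ d)" by simp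
    also have "\<dots> \<le> \<bar>t\<bar> * \<bar>poly h t\<bar>"
      using lower[OF t] avoid t assms(3) by (intro mult_mono) auto
    also have "\<dots> = \<bar>p x - p (x + t *\<^sub>R w)\<bar>" by (simp add: inc abs_mult)
    finally show ?thesis .
  qed
  moreover have "card (insert 0 Z) \<le> d + 1" using Z by (simp add: card_insert_if)
  ultimately show ?thesis using Z(1) by (intro exI[of _ "insert 0 Z"]) auto
qed

section \<open>The kernel of a product of directional derivatives\<close>

lemma DERIV_inner_power:
  assumes "w \<bullet> a = 1"
  shows "((\<lambda>t. ((x + t *\<^sub>R w) \<bullet> a) ^ Suc k) has_real_derivative real (Suc k) * (x \<bullet> a) ^ k) (at 0)"
proof -
  have "((\<lambda>t. (x + t *\<^sub>R w) \<bullet> a) has_real_derivative 1) (at 0)"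
    unfolding inner_add_left inner_scaleR_left by (auto intro!: derivative_eq_intros simp: assms)
  from DERIV_power[OF this, of "Suc k"] show ?thesis
    by (simp del: of_nat_Suc power_Suc)
qed

text \<open>Repeated integration by parts: \<open>x \<bullet> a\<close> grows with unit speed along
  w, so differentiating \<open>(x \<bullet> a) ^ Suc k * p x / Suc k\<close> gives the desired
  function plus a term containing the derivative of p, whose degree is smaller. Hence the induction
  on d with k free, although only k = 0 is used later. The construction involves only
  \<open>x \<bullet> a\<close>, p and derivatives of p, so invariance along directions orthogonal to
  a is inherited.\<close>

lemma dirderiv_antiderivative:
  assumes "w \<bullet> a = 1"
  shows "poly_fun d p \<Longrightarrow> \<exists>q. poly_fun (Suc (k + d)) q \<and> dirderiv w q = (\<lambda>x. (x \<bullet> a) ^ k * p x) \<and>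
    (\<forall>v. v \<bullet> a = 0 \<longrightarrow> invariant_along v p \<longrightarrow> invariant_along v q)"
proof (induction d arbitrary: p k)
  case (0 p k)
  let ?q = "\<lambda>x. (x \<bullet> a) ^ Suc k * (inverse (Suc k) * p x)"
  have "poly_fun (Suc (k + 0)) ?q"
    using poly_fun_mult[OF poly_fun_inner_power[of "Suc k" a] poly_fun_cmult[OF 0]] by simp
  moreover have "dirderiv w ?q = (\<lambda>x. (x \<bullet> a) ^ k * p x)"
  proof (rule dirderiv_eqI)
    fix x
    have "((\<lambda>t. p (x + t *\<^sub>R w)) has_real_derivative 0) (at 0)"
      using poly_fun_DERIV_0[OF 0, of x w] dirderiv_degree_0[OF 0 refl, of w] by simp
    from DERIV_mult[OF DERIV_inner_power[OF assms, of x k] DERIV_cmult[OF this, of "inverse (Suc k)"]]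
    have "((\<lambda>t. ?q (x + t *\<^sub>R w)) has_real_derivative
        real (Suc k) * (x \<bullet> a) ^ k * (inverse (Suc k) * p x)) (at 0)"
      by (simp del: of_nat_Suc power_Suc)
    moreover have "real (Suc k) * (x \<bullet> a) ^ k * (inverse (Suc k) * p x) = (x \<bullet> a) ^ k * p x"
      by (simp add: field_simps del: of_nat_Suc)
    ultimately show "((\<lambda>t. ?q (x + t *\<^sub>R w)) has_real_derivative (x \<bullet> a) ^ k * p x) (at 0)"
      by metis
  qed
  moreover have "invariant_along v ?q" if "v \<bullet> a = 0" "invariant_along v p" for v
    using that by (simp add: invariant_along_def inner_add_left)
  ultimately show ?case by blast
next
  case (Suc d p k)
  have "poly_fun d (dirderiv w p)" using poly_fun_dirderiv[OF Suc(2)] by simp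
  from Suc.IH[OF this, of "Suc k"] obtain q where
    q: "poly_fun (Suc (Suc k + d)) q" "dirderiv w q = (\<lambda>x. (x \<bullet> a) ^ Suc k * dirderiv w p x)"
    "\<And>v. v \<bullet> a = 0 \<Longrightarrow> invariant_along v (dirderiv w p) \<Longrightarrow> invariant_along v q" by blast
  let ?q = "\<lambda>x. inverse (Suc k) * ((x \<bullet> a) ^ Suc k * p x - q x)"
  have "poly_fun (Suc (k + Suc d)) (\<lambda>x. (x \<bullet> a) ^ Suc k * p x)"
    using poly_fun_mult[OF poly_fun_inner_power[of "Suc k" a] Suc(2)] by simp
  then have "poly_fun (Suc (k + Suc d)) ?q"
    using q(1) by (intro poly_fun_cmult poly_fun_diff) auto
  moreover have "dirderiv w ?q = (\<lambda>x. (x \<bullet> a) ^ k * p x)"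
  proof (rule dirderiv_eqI)
    fix x
    note P = poly_fun_DERIV_0[OF Suc(2), of x w]
      and Q = poly_fun_DERIV_0[OF q(1), of x w, unfolded q(2)]
    from DERIV_cmult[OF DERIV_diff[OF DERIV_mult[OF DERIV_inner_power[OF assms, of x k] P] Q],
        of "inverse (Suc k)"]
    have "((\<lambda>t. ?q (x + t *\<^sub>R w)) has_real_derivative
        inverse (Suc k) * (real (Suc k) * (x \<bullet> a) ^ k * p x)) (at 0)"
      by (simp del: of_nat_Suc power_Suc)
    moreover have "inverse (Suc k) * (real (Suc k) * (x \<bullet> a) ^ k * p x) = (x \<bullet> a) ^ k * p x"
      by (simp add: field_simps del: of_nat_Suc)
    ultimately show "((\<lambda>t. ?q (x + t *\<^sub>R w)) has_real_derivative (x \<bullet> a) ^ k * p x) (at 0)"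
      by metis
  qed
  moreover have "invariant_along v ?q" if "v \<bullet> a = 0" "invariant_along v p" for v
    using that q(3)[OF that(1) invariant_along_dirderiv[OF that(2)]]
    by (simp add: invariant_along_def inner_add_left)
  ultimately show ?case by blast
qed

lemma separating_functional:
  fixes v w :: "'a::euclidean_space"
  assumes "w \<notin> span {v}"
  shows "\<exists>a. w \<bullet> a = 1 \<and> v \<bullet> a = 0"
proof -
  define u where "u = w - ((w \<bullet> v) / (v \<bullet> v)) *\<^sub>R v"
  have "u \<noteq> 0" using assms by (auto simp: u_def span_singleton)
  have "v \<bullet> u = 0" by (simp add: u_def inner_diff_right inner_commute)
  then have "w \<bullet> u = u \<bullet> u" by (simp add: u_def inner_diff_left inner_diff_right inner_commute)
  with \<open>u \<noteq> 0\<close> \<open>v \<bullet> u = 0\<close> show ?thesis by (intro exI[of _ "inverse (u \<bullet> u) *\<^sub>R u"]) auto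
qed

text \<open>\<open>foldr\<close> applies the last derivative first, hence \<open>rev_induct\<close>.
  The derivative of p along w splits into pieces invariant along the other directions v; each piece
  has an antiderivative along w that is still invariant along v, since w is not a multiple of v.
  Subtracting these from p leaves a polynomial with vanishing derivative along w.\<close>

lemma dirderivs_kernel:
  fixes p :: "'a::euclidean_space \<Rightarrow> real"
  assumes "poly_fun d p" "dirderivs ws p = (\<lambda>x. 0)" "distinct ws"
    and "pairwise (\<lambda>w v. w \<notin> span {v}) (set ws)"
  shows "\<exists>q. (\<forall>w\<in>set ws. poly_fun d (q w) \<and> invariant_along w (q w)) \<and>
    p = (\<lambda>x. \<Sum>w\<in>set ws. q w x)"
  using assms
proof (induction ws arbitrary: d p rule: rev_induct)
  case Nil
  then show ?case by simp
next
  case (snoc w ws d p)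
  have w: "w \<notin> set ws" using snoc.prems(3) by simp
  obtain r where r: "\<And>v. v \<in> set ws \<Longrightarrow> poly_fun d (r v) \<and> invariant_along v (r v)"
    "dirderiv w p = (\<lambda>x. \<Sum>v\<in>set ws. dirderiv w (r v) x)"
  \<comment> \<open>For positive d differentiation lowers the degree bound by one and the
    antiderivatives restore it. For d = 0 they would have degree 1, but there the derivative of p
    vanishes anyway.\<close>
  proof (cases d)
    case 0
    show ?thesis
      by (rule that[of "\<lambda>v x. 0"])
        (use dirderiv_degree_0[OF snoc.prems(1) 0] in \<open>auto simp: poly_fun.const invariant_along_def dirderiv_def\<close>)
  next
    case (Suc e)
    have "poly_fun e (dirderiv w p)" using poly_fun_dirderiv[OF snoc.prems(1)] Suc by simp
    moreover have "dirderivs ws (dirderiv w p) = (\<lambda>x. 0)" using snoc.prems(2) by simp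
    ultimately obtain q where q: "\<And>v. v \<in> set ws \<Longrightarrow> poly_fun e (q v) \<and> invariant_along v (q v)"
      "dirderiv w p = (\<lambda>x. \<Sum>v\<in>set ws. q v x)"
      using snoc.IH[of e "dirderiv w p"] snoc.prems(3,4) by (auto simp: pairwise_insert)
    have "\<exists>r. poly_fun d r \<and> invariant_along v r \<and> dirderiv w r = q v" if v: "v \<in> set ws" for v
    proof -
      have "w \<notin> span {v}" using snoc.prems(4) v w by (auto simp: pairwise_def)
      then obtain a where a: "w \<bullet> a = 1" "v \<bullet> a = 0" using separating_functional by blast
      show ?thesis using dirderiv_antiderivative[OF a(1), of e "q v" 0] q(1)[OF v] a(2) Suc by auto
    qed
    then obtain r where "\<And>v. v \<in> set ws \<Longrightarrow> poly_fun d (r v) \<and> invariant_along v (r v) \<and> dirderiv w (r v) = q v"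
      by metis
    then show ?thesis using that[of r] q(2) by auto
  qed
  let ?s = "\<lambda>x. \<Sum>v\<in>set ws. r v x"
  have s: "poly_fun d ?s" using r(1) by (intro poly_fun_sum) auto
  have "dirderiv w (\<lambda>x. p x - ?s x) = (\<lambda>x. 0)"
    using dirderiv_diff[OF snoc.prems(1) s] dirderiv_sum[of "set ws" d r w] r by simp
  then have inv: "invariant_along w (\<lambda>x. p x - ?s x)"
    using dirderiv_zero_imp_invariant poly_fun_diff[OF snoc.prems(1) s] by blast
  let ?q = "\<lambda>v. if v = w then (\<lambda>x. p x - ?s x) else r v"
  have "(\<Sum>v\<in>set (ws @ [w]). ?q v x) = p x" for x
  proof -
    have "(\<Sum>v\<in>set ws. ?q v x) = ?s x" using w by (intro sum.cong) auto
    then show ?thesis using w by simp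
  qed
  then show ?case
    using r(1) inv poly_fun_diff[OF snoc.prems(1) s] w by (intro exI[of _ ?q]) auto
qed

section \<open>Interpolation nodes\<close>

text \<open>The \<open>a s\<close> are the coefficients of functions in the span of g that are dual
  to evaluation at the nodes. A new function is interpolated at the old nodes, leaving a remainder r
  that vanishes on them. If r is zero everywhere, nothing changes; otherwise any y with
  \<open>r y \<noteq> 0\<close> becomes a node with dual function r / r y, and multiples of r
  correct the old dual functions at y. The family may be dependent: the number of nodes is its
  rank.\<close>

lemma interpolation_nodes:
  fixes g :: "'i \<Rightarrow> 'x \<Rightarrow> real"
  assumes "finite I"
  shows "\<exists>S a. finite S \<and>
    (\<forall>s\<in>S. \<forall>s'\<in>S. (\<Sum>i\<in>I. a s i * g i s') = of_bool (s = s')) \<and>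
    (\<forall>c x. (\<Sum>i\<in>I. c i * g i x) = (\<Sum>s\<in>S. (\<Sum>i\<in>I. c i * g i s) * (\<Sum>i\<in>I. a s i * g i x)))"
  using assms
proof (induction I rule: finite_induct)
  case empty
  then show ?case by (intro exI[of _ "{}"]) auto
next
  case (insert j I)
  from insert.IH obtain S a where S: "finite S"
    and delta: "\<And>s s'. s \<in> S \<Longrightarrow> s' \<in> S \<Longrightarrow> (\<Sum>i\<in>I. a s i * g i s') = of_bool (s = s')"
    and repr: "\<And>c x. (\<Sum>i\<in>I. c i * g i x) = (\<Sum>s\<in>S. (\<Sum>i\<in>I. c i * g i s) * (\<Sum>i\<in>I. a s i * g i x))"
    by blast
  define e where "e s x = (\<Sum>i\<in>I. a s i * g i x)" for s x
  define r where "r x = g j x - (\<Sum>s\<in>S. g j s * e s x)" for x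
  define f where "f c x = (\<Sum>i\<in>insert j I. c i * g i x)" for c x
  have f: "f c x = c j * g j x + (\<Sum>i\<in>I. c i * g i x)" for c x
    using insert by (simp add: f_def)
  have r0: "r s = 0" if "s \<in> S" for s
  proof -
    have "(\<Sum>s'\<in>S. g j s' * e s' s) = (\<Sum>s'\<in>S. if s' = s then g j s' else 0)"
      using that delta by (intro sum.cong) (auto simp: e_def)
    then show ?thesis using that S by (simp add: r_def)
  qed
  have main: "f c x = (\<Sum>s\<in>S. f c s * e s x) + c j * r x" for c x
    unfolding f r_def using repr[of c x]
    by (simp add: e_def[symmetric] distrib_right sum.distrib sum_distrib_left right_diff_distrib mult.assoc)
  define a0 where "a0 s i = (if i = j then 0 else a s i)" for s i
  have fa0: "f (a0 s) = e s" for s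
  proof
    show "f (a0 s) x = e s x" for x
      using insert(2) by (auto simp: f a0_def e_def intro!: sum.cong)
  qed
  define b where "b i = (if i = j then 1 else - (\<Sum>s\<in>S. g j s * a s i))" for i
  have fb: "f b = r"
  proof
    fix x
    have "(\<Sum>i\<in>I. b i * g i x) = (\<Sum>i\<in>I. - (\<Sum>s\<in>S. g j s * (a s i * g i x)))"
      using insert(2) by (intro sum.cong) (auto simp: b_def sum_distrib_right mult.assoc)
    also have "\<dots> = - (\<Sum>s\<in>S. g j s * e s x)"
      unfolding sum_negf e_def sum_distrib_left by (subst sum.swap) simp
    finally show "f b x = r x" by (simp add: f b_def r_def)
  qed
  have lin: "f (\<lambda>i. c1 i + k * c2 i) x = f c1 x + k * f c2 x" for c1 c2 k x
    by (simp add: f_def distrib_right sum.distrib sum_distrib_left mult.assoc)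
  show ?case
  proof (cases "\<forall>x. r x = 0")
    case True
    show ?thesis
    proof (intro exI[of _ S] exI[of _ a0] conjI ballI allI)
      show "(\<Sum>i\<in>insert j I. a0 s i * g i s') = of_bool (s = s')" if "s \<in> S" "s' \<in> S" for s s'
        using that delta fa0[of s] unfolding f_def e_def by metis
      show "(\<Sum>i\<in>insert j I. c i * g i x) =
          (\<Sum>s\<in>S. (\<Sum>i\<in>insert j I. c i * g i s) * (\<Sum>i\<in>insert j I. a0 s i * g i x))" for c x
        using main[of c x] True unfolding f_def[symmetric] fa0 by simp
    qed (rule S)
  next
    case False
    then obtain y where y: "r y \<noteq> 0" by blast
    then have yS: "y \<notin> S" using r0 by blast
    \<comment> \<open>The summand 0 only brings the coefficients into the shape c1 + k c2 that
      \<open>lin\<close> handles.\<close>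
    define a1 where "a1 s = (if s = y then (\<lambda>i. 0 + inverse (r y) * b i)
      else (\<lambda>i. a0 s i + - (e s y / r y) * b i))" for s
    have "f (\<lambda>i. 0 + inverse (r y) * b i) x = r x / r y" for x
      by (subst lin) (simp add: fb f_def divide_inverse)
    then have fy: "f (a1 y) x = r x / r y" for x by (simp add: a1_def)
    have fs: "f (a1 s) x = e s x - e s y * r x / r y" if "s \<in> S" for s x
    proof -
      have "a1 s = (\<lambda>i. a0 s i + - (e s y / r y) * b i)" using that yS by (auto simp: a1_def)
      then show ?thesis by (simp only: lin fa0 fb) simp
    qed
    show ?thesis
    proof (intro exI[of _ "insert y S"] exI[of _ a1] conjI ballI allI)
      show "finite (insert y S)" using S by simp
      have e_delta: "e s s' = of_bool (s = s')" if "s \<in> S" "s' \<in> S" for s s'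
        using delta[OF that] by (simp add: e_def)
      have "f (a1 s) s' = of_bool (s = s')" if "s \<in> insert y S" "s' \<in> insert y S" for s s'
        using that yS y by (auto simp: fy fs r0 e_delta)
      then show "(\<Sum>i\<in>insert j I. a1 s i * g i s') = of_bool (s = s')"
        if "s \<in> insert y S" "s' \<in> insert y S" for s s'
        using that unfolding f_def by blast
      fix c x
      have "(\<Sum>s\<in>insert y S. f c s * f (a1 s) x) = f c y * (r x / r y) + (\<Sum>s\<in>S. f c s * f (a1 s) x)"
        using S yS by (simp add: fy)
      also have "(\<Sum>s\<in>S. f c s * f (a1 s) x) = (\<Sum>s\<in>S. f c s * e s x - f c s * e s y * (r x / r y))"
        by (intro sum.cong) (auto simp: fs right_diff_distrib)
      also have "\<dots> = (\<Sum>s\<in>S. f c s * e s x) - (\<Sum>s\<in>S. f c s * e s y) * (r x / r y)"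
        by (simp add: sum_subtractf sum_distrib_right sum_divide_distrib)
      also have "\<dots> = (f c x - c j * r x) - (f c y - c j * r y) * (r x / r y)"
        using main[of c x] main[of c y] by simp
      also have "f c y * (r x / r y) + \<dots> = f c x" using y by (simp add: field_simps)
      finally have "f c x = (\<Sum>s\<in>insert y S. f c s * f (a1 s) x)" by simp
      then show "(\<Sum>i\<in>insert j I. c i * g i x) =
          (\<Sum>s\<in>insert y S. (\<Sum>i\<in>insert j I. c i * g i s) * (\<Sum>i\<in>insert j I. a1 s i * g i x))"
        unfolding f_def .
    qed
  qed
qed

text \<open>Interpolating the images of the monomials under T yields dual functions that are
  themselves images of polynomials E s. Thus finitely many values of T p determine p modulo the
  kernel of T, through an explicit representative.\<close>

lemma operator_nodes:
  fixes T :: "('a::euclidean_space \<Rightarrow> real) \<Rightarrow> 'x \<Rightarrow> real"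
  assumes add: "\<And>p q. poly_fun d p \<Longrightarrow> poly_fun d q \<Longrightarrow> T (\<lambda>x. p x + q x) = (\<lambda>x. T p x + T q x)"
    and cmult: "\<And>c p. poly_fun d p \<Longrightarrow> T (\<lambda>x. c * p x) = (\<lambda>x. c * T p x)"
  shows "\<exists>S E. finite S \<and> (\<forall>s. poly_fun d (E s)) \<and>
    (\<forall>p. poly_fun d p \<longrightarrow> T p = T (\<lambda>x. \<Sum>s\<in>S. T p s * E s x))"
proof -
  have lin: "T (\<lambda>x. \<Sum>i\<in>I. c i * p i x) = (\<lambda>x. \<Sum>i\<in>I. c i * T (p i) x)"
    if "finite I" "\<And>i. i \<in> I \<Longrightarrow> poly_fun d (p i)" for I :: "'y set" and c p
    using that
  proof (induction I rule: finite_induct)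
    case empty
    show ?case using cmult[OF poly_fun.const[of d 0], of 0] by simp
  next
    case (insert i I)
    then show ?case
      using add[of "\<lambda>x. c i * p i x" "\<lambda>x. \<Sum>i\<in>I. c i * p i x"] cmult[of "p i" "c i"]
      by (simp add: poly_fun_cmult poly_fun_sum)
  qed
  let ?I = "{\<alpha> \<in> (Basis::'a set) \<rightarrow>\<^sub>E (UNIV :: nat set). (\<Sum>b\<in>Basis. \<alpha> b) \<le> d}"
  let ?m = "\<lambda>\<alpha> (x::'a). \<Prod>b\<in>Basis. (x \<bullet> b) ^ (\<alpha> b :: nat)"
  have fin: "finite ?I" by (rule finite_multi_index) simp
  have mono: "poly_fun d (?m \<alpha>)" if "\<alpha> \<in> ?I" for \<alpha>
    using that polys_in_imp_poly_fun[OF _ polys_in_monomial[of Basis \<alpha> d]] by auto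
  obtain S a where S: "finite S" and
    repr: "\<And>c x. (\<Sum>\<alpha>\<in>?I. c \<alpha> * T (?m \<alpha>) x) =
      (\<Sum>s\<in>S. (\<Sum>\<alpha>\<in>?I. c \<alpha> * T (?m \<alpha>) s) * (\<Sum>\<alpha>\<in>?I. a s \<alpha> * T (?m \<alpha>) x))"
    using interpolation_nodes[OF fin, of "\<lambda>\<alpha>. T (?m \<alpha>)"] by blast
  define E where "E s x = (\<Sum>\<alpha>\<in>?I. a s \<alpha> * ?m \<alpha> x)" for s x
  have E: "poly_fun d (E s)" for s
    unfolding E_def using mono by (intro poly_fun_sum poly_fun_cmult) auto
  have TE: "T (E s) = (\<lambda>x. \<Sum>\<alpha>\<in>?I. a s \<alpha> * T (?m \<alpha>) x)" for s
    unfolding E_def using mono by (intro lin[OF fin]) auto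
  have "T p = (\<lambda>x. \<Sum>s\<in>S. T p s * T (E s) x)" if p: "poly_fun d p" for p
  proof -
    obtain c where c: "p = (\<lambda>x. \<Sum>\<alpha>\<in>?I. c \<alpha> * ?m \<alpha> x)"
      using p[folded polys_iff_poly_fun] unfolding polys_in_def by blast
    have Tp: "T p = (\<lambda>x. \<Sum>\<alpha>\<in>?I. c \<alpha> * T (?m \<alpha>) x)"
      unfolding c using mono by (intro lin[OF fin]) auto
    show ?thesis unfolding Tp TE using repr by blast
  qed
  then have "T p = T (\<lambda>x. \<Sum>s\<in>S. T p s * E s x)" if p: "poly_fun d p" for p
    using that lin[OF S, of E "T p"] E by simp
  then show ?thesis using S E by blast
qed

section \<open>Distance of a polynomial to the kernel of a linear operator\<close>

lemma norm_on_sum_le: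
  assumes "is_norm_on (polys d) N" "finite S" "\<And>s. poly_fun d (E s)"
  shows "N (\<lambda>x. \<Sum>s\<in>S. c s * E s x) \<le> (\<Sum>s\<in>S. \<bar>c s\<bar> * N (E s))"
  using assms(2)
proof (induction S rule: finite_induct)
  case empty
  have "(\<lambda>x. 0) \<in> polys d" unfolding polys_iff_poly_fun by (rule poly_fun.const)
  then have "N (\<lambda>x. 0) = 0" using assms(1) unfolding is_norm_on_def by blast
  then show ?case by simp
next
  case (insert s S)
  have "(\<lambda>x. c s * E s x) \<in> polys d" "(\<lambda>x. \<Sum>s\<in>S. c s * E s x) \<in> polys d" "E s \<in> polys d"
    using assms(3) unfolding polys_iff_poly_fun by (auto intro!: poly_fun_sum intro: poly_fun_cmult)
  note mem = this
  have "N (\<lambda>x. c s * E s x + (\<Sum>s\<in>S. c s * E s x)) \<le> N (\<lambda>x. c s * E s x) + N (\<lambda>x. \<Sum>s\<in>S. c s * E s x)"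
    using conjunct2[OF conjunct2[OF assms(1)[unfolded is_norm_on_def]], rule_format, OF mem(1,2)] .
  also have "N (\<lambda>x. c s * E s x) = \<bar>c s\<bar> * N (E s)"
    using conjunct1[OF conjunct2[OF assms(1)[unfolded is_norm_on_def]], rule_format, OF mem(3)] .
  finally show ?case using insert by simp
qed

text \<open>The condition on all r with the same image says that p has distance at least c from the
  kernel of T. The representative built from the node values of T p is such an r, and its norm is at
  most a fixed linear combination of the absolute values at the nodes; so these cannot all be small.
  The argument applies to any norm, without a compactness or equivalence argument.\<close>

lemma distance_to_kernel:
  fixes T :: "('a::euclidean_space \<Rightarrow> real) \<Rightarrow> 'x \<Rightarrow> real"
  assumes add: "\<And>p q. poly_fun d p \<Longrightarrow> poly_fun d q \<Longrightarrow> T (\<lambda>x. p x + q x) = (\<lambda>x. T p x + T q x)"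
    and cmult: "\<And>c p. poly_fun d p \<Longrightarrow> T (\<lambda>x. c * p x) = (\<lambda>x. c * T p x)"
    and N: "is_norm_on (polys d) N" and "c > 0"
  shows "\<exists>S c'. finite S \<and> c' > 0 \<and> (\<forall>p. poly_fun d p \<longrightarrow>
    (\<forall>r. poly_fun d r \<longrightarrow> T r = T p \<longrightarrow> c \<le> N r) \<longrightarrow> (\<exists>s\<in>S. c' \<le> \<bar>T p s\<bar>))"
proof -
  have "\<exists>S E. finite S \<and> (\<forall>s. poly_fun d (E s)) \<and>
    (\<forall>p. poly_fun d p \<longrightarrow> T p = T (\<lambda>x. \<Sum>s\<in>S. T p s * E s x))"
    by (rule operator_nodes) (fact add cmult)+
  then obtain S E where S: "finite S" and E: "\<And>s. poly_fun d (E s)"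
    and repr: "\<And>p. poly_fun d p \<Longrightarrow> T p = T (\<lambda>x. \<Sum>s\<in>S. T p s * E s x)"
    by blast
  have N0: "N (E s) \<ge> 0" for s
    using N E[of s, folded polys_iff_poly_fun] unfolding is_norm_on_def by blast
  \<comment> \<open>The added 1 keeps K positive for empty S and makes the last inequality
    strict.\<close>
  define K where "K = (\<Sum>s\<in>S. N (E s)) + 1"
  have "K > 0" unfolding K_def using N0 by (simp add: add_nonneg_pos sum_nonneg)
  have "\<exists>s\<in>S. c / K \<le> \<bar>T p s\<bar>"
    if p: "poly_fun d p" and far: "\<And>r. poly_fun d r \<Longrightarrow> T r = T p \<Longrightarrow> c \<le> N r" for p
  proof (rule ccontr)
    assume "\<not> ?thesis"
    then have small: "\<And>s. s \<in> S \<Longrightarrow> \<bar>T p s\<bar> \<le> c / K" by force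
    have "c \<le> N (\<lambda>x. \<Sum>s\<in>S. T p s * E s x)"
      using far repr[OF p] E by (simp add: poly_fun_sum poly_fun_cmult)
    also have "\<dots> \<le> (\<Sum>s\<in>S. \<bar>T p s\<bar> * N (E s))" by (rule norm_on_sum_le[OF N S E])
    also have "\<dots> \<le> (\<Sum>s\<in>S. c / K * N (E s))" using small N0 by (intro sum_mono mult_right_mono) auto
    also have "\<dots> = c / K * (K - 1)" unfolding K_def by (simp add: sum_distrib_left)
    also have "\<dots> = c * ((K - 1) / K)" by simp
    also have "\<dots> < c * 1" using \<open>K > 0\<close> \<open>c > 0\<close> by (intro mult_strict_left_mono) auto
    finally show False by simp
  qed
  then show ?thesis using S \<open>c > 0\<close> \<open>K > 0\<close> by (intro exI[of _ S] exI[of _ "c / K"]) auto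
qed

section \<open>Oscillatory integrals with invariant factors\<close>

abbreviation vol_cball :: "'a::euclidean_space itself \<Rightarrow> real \<Rightarrow> real" where
  "vol_cball _ R \<equiv> measure lborel (cball (0::'a) R)"

lemma emeasure_cball_less_top: "emeasure lborel (cball c r) < top"
  using emeasure_lborel_cball_finite[of c r] by simp

lemma
  fixes h :: "'a::euclidean_space \<Rightarrow> 'b::{banach, second_countable_topology}"
  assumes h: "h \<in> borel_measurable borel" and bound: "\<And>x. norm x \<le> R \<Longrightarrow> norm (h x) \<le> B"
    and supp: "\<And>x. R < norm x \<Longrightarrow> h x = 0"
  shows integrable_supported: "integrable lborel h"

    and integral_supported: "norm (\<integral>x. h x \<partial>lborel) \<le> B * vol_cball TYPE('a) R"
proof -
  have ind: "integrable lborel (\<lambda>x. B * indicator (cball (0::'a) R) x :: real)"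
    by (intro integrable_mult_right integrable_real_indicator) (auto simp: emeasure_cball_less_top)
  have le: "norm (h x) \<le> B * indicator (cball (0::'a) R) x" for x
    using bound supp by (auto simp: indicator_def)
  show int: "integrable lborel h"
    by (rule Bochner_Integration.integrable_bound[OF ind])
      (use h le in \<open>auto intro!: AE_I2 intro: order_trans[OF _ abs_ge_self]\<close>)
  have "(\<integral>x. norm (h x) \<partial>lborel) \<le> (\<integral>x. B * indicator (cball (0::'a) R) x \<partial>lborel)"
    using int ind le by (intro integral_mono) auto
  then have le2: "(\<integral>x. norm (h x) \<partial>lborel) \<le> B * vol_cball TYPE('a) R"
    by simp
  show "norm (\<integral>x. h x \<partial>lborel) \<le> B * vol_cball TYPE('a) R"
    using integral_norm_bound[of lborel h] le2 by linarith
qed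

lemma integral_lborel_translate:
  fixes h :: "'a::euclidean_space \<Rightarrow> 'b::{banach, second_countable_topology}"
  assumes "h \<in> borel_measurable borel"
  shows "(\<integral>x. h (x + a) \<partial>lborel) = (\<integral>x. h x \<partial>lborel)"
proof -
  have "(\<integral>x. h x \<partial>lborel) = (\<integral>x. h x \<partial>distr lborel borel ((+) a))"
    by (simp only: lborel_distr_plus)
  also have "\<dots> = (\<integral>x. h (a + x) \<partial>lborel)"
    using assms by (intro integral_distr) auto
  finally show ?thesis by (simp add: add.commute)
qed

text \<open>One factor for each entry, in the order of the list used by \<open>dirderivs\<close>, so
  that an induction step strips the same direction from both.\<close>

inductive inv_prod :: "'a::euclidean_space list \<Rightarrow> ('a \<Rightarrow> complex) \<Rightarrow> bool" where
  Nil: "inv_prod [] (\<lambda>x. 1)"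
| Cons: "inv_prod ws F \<Longrightarrow> f \<in> borel_measurable borel \<Longrightarrow> (\<And>x. cmod (f x) \<le> 1) \<Longrightarrow>
    invariant_along w f \<Longrightarrow> inv_prod (w # ws) (\<lambda>x. f x * F x)"

lemma
  assumes "inv_prod ws F"
  shows inv_prod_measurable: "F \<in> borel_measurable borel"
    and inv_prod_le_1: "cmod (F x) \<le> 1"
proof -
  have "F \<in> borel_measurable borel \<and> (\<forall>x. cmod (F x) \<le> 1)"
    using assms by (induction rule: inv_prod.induct) (auto simp: norm_mult intro: mult_le_one)
  then show "F \<in> borel_measurable borel" "cmod (F x) \<le> 1" by auto
qed

lemma measurable_cnj[measurable]: "cnj \<in> borel_measurable borel"
  by (intro borel_measurable_continuous_onI continuous_intros)

lemma measurable_translate: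
  "f \<in> borel_measurable borel \<Longrightarrow> (\<lambda>x. f (x + a)) \<in> borel_measurable (borel :: 'a::euclidean_space measure)"
  by (rule measurable_compose[of "\<lambda>x. x + a"]) auto

text \<open>Translation commutes with invariance along w, so each factor may be correlated with its
  own translate. The class is therefore stable under the Cauchy--Schwarz step.\<close>

lemma inv_prod_correlation: "inv_prod ws F \<Longrightarrow> inv_prod ws (\<lambda>x. F x * cnj (F (x + a)))"
proof (induction rule: inv_prod.induct)
  case Nil
  then show ?case using inv_prod.Nil by simp
next
  case (Cons ws F f w)
  have "inv_prod (w # ws) (\<lambda>x. (f x * cnj (f (x + a))) * (F x * cnj (F (x + a))))"
  proof (rule inv_prod.Cons[OF Cons.IH])
    show "(\<lambda>x. f x * cnj (f (x + a))) \<in> borel_measurable borel"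
      using Cons.hyps(2) measurable_translate[OF Cons.hyps(2)] by measurable
    show "cmod (f x * cnj (f (x + a))) \<le> 1" for x
      using Cons.hyps(3) by (auto simp: norm_mult intro: mult_le_one)
    have "f (x + t *\<^sub>R w + a) = f (x + a)" for x t
      using Cons.hyps(4) unfolding invariant_along_def by (metis add.commute add.left_commute)
    then show "invariant_along w (\<lambda>x. f x * cnj (f (x + a)))"
      using Cons.hyps(4) by (simp add: invariant_along_def)
  qed
  then show ?case by (simp add: mult_ac)
qed

text \<open>A Lipschitz bound takes the place of a derivative, because only difference quotients of
  \<eta> are integrated. With all bounds equal to 1 the class is closed under correlation up to a
  factor 2.\<close>

definition amplitude :: "real \<Rightarrow> ('a::euclidean_space \<Rightarrow> complex) \<Rightarrow> bool" where
  "amplitude R \<eta> \<longleftrightarrow> (\<forall>x. R < norm x \<longrightarrow> \<eta> x = 0) \<and> (\<forall>x. cmod (\<eta> x) \<le> 1) \<and>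
     (\<forall>x y. cmod (\<eta> x - \<eta> y) \<le> dist x y)"

lemma amplitude_measurable:
  fixes \<eta> :: "'a::euclidean_space \<Rightarrow> complex"
  assumes "amplitude R \<eta>"
  shows "\<eta> \<in> borel_measurable borel"
proof (rule borel_measurable_continuous_onI)
  have "1-lipschitz_on UNIV \<eta>" using assms by (auto simp: amplitude_def lipschitz_on_def dist_norm)
  then show "continuous_on UNIV \<eta>" by (rule lipschitz_on_continuous_on)
qed

text \<open>The division by 2 compensates the product rule, which doubles the Lipschitz constant.
  The untranslated factor keeps the support in the ball of radius R, so R does not grow in the
  induction.\<close>

lemma amplitude_correlation:
  assumes "amplitude R \<eta>"
  shows "amplitude R (\<lambda>x. \<eta> x * cnj (\<eta> (x + a)) / 2)"
proof -
  note \<eta> = assms[unfolded amplitude_def]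
  have "cmod (\<eta> x * cnj (\<eta> (x + a)) / 2 - \<eta> y * cnj (\<eta> (y + a)) / 2) \<le> dist x y" for x y
  proof -
    have "cmod (\<eta> (x + a) - \<eta> (y + a)) \<le> dist (x + a) (y + a)" using \<eta> by blast
    then have tr: "cmod (\<eta> (x + a) - \<eta> (y + a)) \<le> dist x y" by simp
    have "\<eta> x * cnj (\<eta> (x + a)) - \<eta> y * cnj (\<eta> (y + a))
       = (\<eta> x - \<eta> y) * cnj (\<eta> (x + a)) + \<eta> y * cnj (\<eta> (x + a) - \<eta> (y + a))"
      by (simp add: algebra_simps)
    also have "cmod \<dots> \<le> cmod (\<eta> x - \<eta> y) * cmod (\<eta> (x + a)) + cmod (\<eta> y) * cmod (\<eta> (x + a) - \<eta> (y + a))"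
      by (metis norm_triangle_ineq norm_mult complex_mod_cnj)
    also have "\<dots> \<le> dist x y * 1 + 1 * dist x y"
      using \<eta> tr by (intro add_mono mult_mono) auto
    finally have "cmod (\<eta> x * cnj (\<eta> (x + a)) - \<eta> y * cnj (\<eta> (y + a))) \<le> 2 * dist x y" by simp
    then show ?thesis by (simp add: diff_divide_distrib[symmetric] norm_divide)
  qed
  moreover have "cmod (\<eta> x * cnj (\<eta> (x + a)) / 2) \<le> 1" for x
  proof -
    have "cmod (\<eta> x) * cmod (\<eta> (x + a)) \<le> 1" using \<eta> by (intro mult_le_one) auto
    then show ?thesis by (simp add: norm_mult norm_divide)
  qed
  ultimately show ?thesis using \<eta> unfolding amplitude_def by auto
qed

definition osc :: "('a::euclidean_space \<Rightarrow> real) \<Rightarrow> ('a \<Rightarrow> complex) \<Rightarrow> ('a \<Rightarrow> complex) \<Rightarrow> complex" where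
  "osc P F \<eta> = (\<integral>x. cis (P x) * F x * \<eta> x \<partial>lborel)"

lemma cis_measurable: "P \<in> borel_measurable M \<Longrightarrow> (\<lambda>x. cis (P x)) \<in> borel_measurable M"
  unfolding cis_conv_exp by measurable

lemma osc_le_vol:
  fixes P :: "'a::euclidean_space \<Rightarrow> real"
  assumes "P \<in> borel_measurable borel" "inv_prod ws F" "amplitude R \<eta>"
  shows "cmod (osc P F \<eta>) \<le> vol_cball TYPE('a) R"
proof -
  have "(\<lambda>x. cis (P x) * F x * \<eta> x) \<in> borel_measurable borel"
    using cis_measurable[OF assms(1)] inv_prod_measurable[OF assms(2)] amplitude_measurable[OF assms(3)]
    by measurable
  moreover have "cmod (cis (P x) * F x * \<eta> x) \<le> 1" for x
    using inv_prod_le_1[OF assms(2)] assms(3) by (auto simp: amplitude_def norm_mult intro: mult_le_one)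
  moreover have "cis (P x) * F x * \<eta> x = 0" if "R < norm x" for x
    using that assms(3) by (simp add: amplitude_def)
  ultimately show ?thesis
    using integral_supported[of "\<lambda>x. cis (P x) * F x * \<eta> x" R 1] by (simp add: osc_def)
qed

text \<open>Distinct grid points are at least h apart, so no z lies within less than h / 2 of two of
  them.\<close>

lemma card_near_points:
  fixes a h :: real
  assumes "finite Z" "0 < h"
  shows "card {j::nat. j < k \<and> (\<exists>z\<in>Z. \<bar>a + real j * h - z\<bar> < h / 2)} \<le> card Z"
proof -
  let ?J = "{j::nat. j < k \<and> (\<exists>z\<in>Z. \<bar>a + real j * h - z\<bar> < h / 2)}"
  have "\<forall>j\<in>?J. \<exists>z. z \<in> Z \<and> \<bar>a + real j * h - z\<bar> < h / 2" by blast
  from bchoice[OF this] obtain g where g: "\<And>j. j \<in> ?J \<Longrightarrow> g j \<in> Z \<and> \<bar>a + real j * h - g j\<bar> < h / 2"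
    by blast
  have "inj_on g ?J"
  proof (rule inj_onI)
    fix i j assume ij: "i \<in> ?J" "j \<in> ?J" "g i = g j"
    have "\<bar>(real i - real j) * h\<bar> < h"      using conjunct2[OF g[OF ij(1)]] conjunct2[OF g[OF ij(2)]] ij(3)
      unfolding left_diff_distrib by linarith
    then have "\<bar>real i - real j\<bar> < 1" using assms(2) by (simp add: abs_mult)
    then show "i = j" by linarith
  qed
  then show ?thesis using g assms(1) by (intro card_inj_on_le[of g]) auto
qed

text \<open>
  Averaging over translates along \<open>w\<close> replaces the disintegration of Lebesgue measure along \<open>w\<close>:
  the factor \<open>f\<close> does not see the translations, and Cauchy--Schwarz (in the form
  \<open>2 \<bar>h\<bar> \<le> 1 / \<theta> + \<theta> \<bar>h\<bar>\<^sup>2\<close>) removes it.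
\<close>

lemma averaged_Cauchy_Schwarz:
  fixes H f :: "'a::euclidean_space \<Rightarrow> complex"
  assumes f: "f \<in> borel_measurable borel" "\<And>x. cmod (f x) \<le> 1" "invariant_along w f"
    and H: "H \<in> borel_measurable borel" "\<And>x. cmod (H x) \<le> 1" "\<And>x. R < norm x \<Longrightarrow> H x = 0"
    and k: "(k::nat) > 0" and \<theta>: "\<theta> > 0"
  shows "cmod (\<integral>x. f x * H x \<partial>lborel) \<le> vol_cball TYPE('a) (R + norm w) / (2 * \<theta>) +
    \<theta> / 2 * ((\<Sum>(i, j)\<in>{..<k} \<times> {..<k}.
      cmod (\<integral>x. H x * cnj (H (x + ((real j - real i) / real k) *\<^sub>R w)) \<partial>lborel)) / (real k)\<^sup>2)"
proof -
  let ?R = "R + norm w" and ?V = "vol_cball TYPE('a) (R + norm w)"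
  define a where "a i = (real i / real k) *\<^sub>R w" for i
  have Hm: "(\<lambda>x. H (x + b)) \<in> borel_measurable borel" for b by (rule measurable_translate[OF H(1)])
  have Hs: "H (x + a i) = 0" if "i < k" "?R < norm x" for x i
  proof -
    have "norm (a i) \<le> 1 * norm w"
      unfolding a_def norm_scaleR using that(1) by (intro mult_right_mono) auto
    then have "R < norm (x + a i)" using norm_diff_ineq[of x "a i"] that(2) by simp
    then show ?thesis by (rule H(3))
  qed
  define h where "h x = (\<Sum>i<k. H (x + a i)) / real k" for x
  have hm: "h \<in> borel_measurable borel" unfolding h_def using Hm by measurable
  have hs: "h x = 0" if "?R < norm x" for x using Hs[OF _ that] by (simp add: h_def)
  have h1: "cmod (h x) \<le> 1" for x
  proof -
    have "cmod (\<Sum>i<k. H (x + a i)) \<le> (\<Sum>i<k. 1)" using H(2) by (intro sum_norm_le) auto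
    then show ?thesis using k by (simp add: h_def norm_divide)
  qed
  have finv: "f (x + a i) = f x" for x i using f(3) by (simp add: invariant_along_def a_def)
  have intfH: "integrable lborel (\<lambda>x. f x * H (x + a i))" if "i < k" for i
    by (rule integrable_supported[of _ ?R 1])
      (use f(1,2) Hm[of "a i"] H(2) Hs[OF that] in \<open>auto simp: norm_mult intro: mult_le_one\<close>)
  have "(\<integral>x. f x * H (x + a i) \<partial>lborel) = (\<integral>x. f x * H x \<partial>lborel)" for i
    using integral_lborel_translate[of "\<lambda>x. f x * H x" "a i"] f(1) H(1) by (simp add: finv)
  then have "(\<Sum>i<k. \<integral>x. f x * H (x + a i) \<partial>lborel) = of_nat k * (\<integral>x. f x * H x \<partial>lborel)"
    by simp
  moreover have "(\<integral>x. f x * h x \<partial>lborel) = (\<Sum>i<k. \<integral>x. f x * H (x + a i) \<partial>lborel) / of_nat k"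
    using intfH by (simp add: h_def sum_distrib_left Bochner_Integration.integral_sum)
  ultimately have avg: "(\<integral>x. f x * H x \<partial>lborel) = (\<integral>x. f x * h x \<partial>lborel)"
    using k by simp
  \<comment> \<open>The constant term is needed only where h can be nonzero. The shifts are shorter
    than w, so this is inside the ball of radius R + norm w. The weight \<theta> stays free until
    the two terms are balanced in \<open>decay_step\<close>.\<close>
  have pt: "cmod (f x * h x) \<le> indicator (cball 0 ?R) x / (2 * \<theta>) + \<theta> / 2 * (cmod (h x))\<^sup>2" for x
  proof (cases "?R < norm x")
    case True
    then show ?thesis using hs by simp
  next
    case False
    have "0 \<le> (1 - \<theta> * cmod (h x))\<^sup>2" by simp
    then have "2 * \<theta> * cmod (h x) \<le> 1 + \<theta>\<^sup>2 * (cmod (h x))\<^sup>2"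
      by (simp add: power2_eq_square algebra_simps)
    then have "cmod (h x) \<le> (1 + \<theta>\<^sup>2 * (cmod (h x))\<^sup>2) / (2 * \<theta>)" using \<theta> by (simp add: field_simps)
    also have "\<dots> = 1 / (2 * \<theta>) + \<theta> / 2 * (cmod (h x))\<^sup>2"
      using \<theta> by (simp add: field_simps power2_eq_square)
    finally have "cmod (h x) \<le> 1 / (2 * \<theta>) + \<theta> / 2 * (cmod (h x))\<^sup>2" .
    moreover have "cmod (f x * h x) \<le> 1 * cmod (h x)"
      unfolding norm_mult using f(2) by (intro mult_right_mono) auto
    ultimately show ?thesis using False by simp
  qed
  have int2: "integrable lborel (\<lambda>x. (cmod (h x))\<^sup>2)"
    by (rule integrable_supported[of _ ?R 1]) (use hm h1 hs in \<open>auto simp: power_le_one\<close>)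
  have intfh: "integrable lborel (\<lambda>x. f x * h x)"
    by (rule integrable_supported[of _ ?R 1]) (use f hm h1 hs in \<open>auto simp: norm_mult intro: mult_le_one\<close>)
  have intind: "integrable lborel (\<lambda>x. indicator (cball (0::'a) ?R) x / (2 * \<theta>) :: real)"
    by (intro integrable_divide integrable_real_indicator) (auto simp: emeasure_cball_less_top)
  have "cmod (\<integral>x. f x * h x \<partial>lborel) \<le> (\<integral>x. cmod (f x * h x) \<partial>lborel)" by (rule integral_norm_bound)
  also have "\<dots> \<le> (\<integral>x. indicator (cball 0 ?R) x / (2 * \<theta>) + \<theta> / 2 * (cmod (h x))\<^sup>2 \<partial>lborel)"
    using intfh intind int2 pt by (intro integral_mono) auto
  also have "\<dots> = ?V / (2 * \<theta>) + \<theta> / 2 * (\<integral>x. (cmod (h x))\<^sup>2 \<partial>lborel)"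
    using intind int2 by (subst Bochner_Integration.integral_add) auto
  also have "(\<integral>x. (cmod (h x))\<^sup>2 \<partial>lborel) \<le> (\<Sum>(i, j)\<in>{..<k} \<times> {..<k}.
      cmod (\<integral>x. H x * cnj (H (x + ((real j - real i) / real k) *\<^sub>R w)) \<partial>lborel)) / (real k)\<^sup>2"
  proof -
    let ?G = "\<lambda>(i, j) x. H (x + a i) * cnj (H (x + a j))"
    have intG: "integrable lborel (?G p)" if p: "p \<in> {..<k} \<times> {..<k}" for p
    proof -
      obtain i j where ij: "p = (i, j)" "i < k" "j < k" using p by auto
      show ?thesis unfolding ij(1) prod.case
        by (rule integrable_supported[of _ ?R 1])
          (use Hm[of "a i"] Hm[of "a j"] H(2) Hs ij in \<open>auto simp: norm_mult intro: mult_le_one\<close>)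
    qed
    have "complex_of_real ((cmod (h x))\<^sup>2) = (\<Sum>p\<in>{..<k} \<times> {..<k}. ?G p x) / of_real ((real k)\<^sup>2)" for x
    proof -
      have "complex_of_real ((cmod (h x))\<^sup>2) = h x * cnj (h x)"        by (metis complex_norm_square of_real_power)
      also have "\<dots> = (\<Sum>i<k. H (x + a i)) * (\<Sum>j<k. cnj (H (x + a j))) / of_real ((real k)\<^sup>2)"
        by (simp add: h_def power2_eq_square)
      finally show ?thesis by (simp add: sum_product sum.cartesian_product split_def)
    qed
    then have "complex_of_real (\<integral>x. (cmod (h x))\<^sup>2 \<partial>lborel)
        = (\<integral>x. (\<Sum>p\<in>{..<k} \<times> {..<k}. ?G p x) / of_real ((real k)\<^sup>2) \<partial>lborel)"
      by (simp flip: integral_complex_of_real)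
    also have "\<dots> = (\<Sum>p\<in>{..<k} \<times> {..<k}. \<integral>x. ?G p x \<partial>lborel) / of_real ((real k)\<^sup>2)"
      using intG by (simp add: Bochner_Integration.integral_sum)
    finally have eq: "complex_of_real (\<integral>x. (cmod (h x))\<^sup>2 \<partial>lborel) =
        (\<Sum>p\<in>{..<k} \<times> {..<k}. \<integral>x. ?G p x \<partial>lborel) / of_real ((real k)\<^sup>2)" .
    have "(\<integral>x. (cmod (h x))\<^sup>2 \<partial>lborel)
        = cmod ((\<Sum>p\<in>{..<k} \<times> {..<k}. \<integral>x. ?G p x \<partial>lborel) / of_real ((real k)\<^sup>2))"
      unfolding eq[symmetric] by simp
    also have "\<dots> = cmod (\<Sum>p\<in>{..<k} \<times> {..<k}. \<integral>x. ?G p x \<partial>lborel) / (real k)\<^sup>2"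
      by (simp add: norm_divide norm_power)
    also have "\<dots> \<le> (\<Sum>p\<in>{..<k} \<times> {..<k}. cmod (\<integral>x. ?G p x \<partial>lborel)) / (real k)\<^sup>2"
      by (intro divide_right_mono norm_sum) auto
    also have "(\<Sum>p\<in>{..<k} \<times> {..<k}. cmod (\<integral>x. ?G p x \<partial>lborel)) = (\<Sum>(i, j)\<in>{..<k} \<times> {..<k}.
      cmod (\<integral>x. H x * cnj (H (x + ((real j - real i) / real k) *\<^sub>R w)) \<partial>lborel))"
    proof (intro sum.cong refl)
      fix p assume "p \<in> {..<k} \<times> {..<k}"
      obtain i j where ij: "p = (i, j)" by (cases p)
      \<comment> \<open>By translation invariance a correlation depends only on the difference of
        its two shifts.\<close>
      have aji: "((real j - real i) / real k) *\<^sub>R w = a j - a i"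
        by (simp add: a_def diff_divide_distrib scaleR_diff_left)
      have "(\<lambda>x. H x * cnj (H (x + (a j - a i)))) \<in> borel_measurable borel"
        using H(1) Hm[of "a j - a i"] by measurable
      have shift: "x + a i + (a j - a i) = x + a j" for x by simp
      from integral_lborel_translate[OF \<open>(\<lambda>x. H x * cnj (H (x + (a j - a i)))) \<in> borel_measurable borel\<close>, of "a i"]
      show "cmod (\<integral>x. ?G p x \<partial>lborel) = (case p of (i, j) \<Rightarrow>
          cmod (\<integral>x. H x * cnj (H (x + ((real j - real i) / real k) *\<^sub>R w)) \<partial>lborel))"
        unfolding ij prod.case aji shift by (rule arg_cong)
    qed
    finally show ?thesis .
  qed
  finally show ?thesis using \<theta> unfolding avg by (simp add: mult_left_mono)
qed

section \<open>Induction on the number of directions\<close>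

lemma osc_correlation:
  fixes a :: "'a::euclidean_space"
  shows "(\<integral>x. (cis (P x) * F x * \<eta> x) * cnj (cis (P (x + a)) * F (x + a) * \<eta> (x + a)) \<partial>lborel)
    = 2 * osc (\<lambda>x. P x - P (x + a)) (\<lambda>x. F x * cnj (F (x + a))) (\<lambda>x. \<eta> x * cnj (\<eta> (x + a)) / 2)"
proof -
  have "(cis (P x) * F x * \<eta> x) * cnj (cis (P (x + a)) * F (x + a) * \<eta> (x + a))
     = 2 * (cis (P x - P (x + a)) * (F x * cnj (F (x + a))) * (\<eta> x * cnj (\<eta> (x + a)) / 2))" for x
  proof -
    have "cis (P x - P (x + a)) = cis (P x) * cnj (cis (P (x + a)))" by (simp add: cis_cnj cis_mult)
    then show ?thesis by (simp add: mult_ac)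
  qed
  then show ?thesis unfolding osc_def by (simp only: integral_mult_right_zero)
qed

text \<open>The constants depend on P only through its degree bound, and A is the sole measure of
  nondegeneracy. No frequency appears: multiplying P by a number multiplies A. The point x may vary
  in a fixed ball, which gives uniformity over finitely many nodes and over the phases arising in
  the induction.\<close>

definition decay :: "'a::euclidean_space list \<Rightarrow> nat \<Rightarrow> real \<Rightarrow> real \<Rightarrow> bool" where
  "decay ws d R r \<longleftrightarrow> (\<exists>\<epsilon>>0. \<exists>C\<ge>0. \<forall>P F \<eta> x A. poly_fun d P \<longrightarrow> inv_prod ws F \<longrightarrow> amplitude R \<eta> \<longrightarrow>
     norm x \<le> r \<longrightarrow> 0 < A \<longrightarrow> A \<le> \<bar>dirderivs ws P x\<bar> \<longrightarrow> cmod (osc P F \<eta>) \<le> C * A powr (- \<epsilon>))"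

lemma nat_between_powr:
  assumes "(A::real) \<ge> 1" "s \<ge> 0"
  obtains k :: nat where "k > 0" "A powr s \<le> real k" "real k \<le> 2 * A powr s"
proof
  have ge1: "A powr s \<ge> 1" using assms by (simp add: ge_one_powr_ge_zero)
  let ?k = "nat \<lceil>A powr s\<rceil>"
  show "A powr s \<le> real ?k" by linarith
  then show "?k > 0" using ge1 by (metis not_gr0 of_nat_0 less_le_trans zero_less_one leD)
  show "real ?k \<le> 2 * A powr s" using ge1 by linarith
qed

text \<open>With about A powr s shifts, the pairs whose difference falls near an exceptional point
  make up a fraction of order 1 / k and are estimated by the volume. For every other pair the
  difference phase is nondegenerate in the remaining directions, at the same point x, to the order
  of the square root of A.\<close>

lemma decay_step:
  fixes w :: "'a::euclidean_space"
  assumes "decay ws d R r"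
  shows "decay (w # ws) d R r"
proof -
  obtain \<epsilon> C where \<epsilon>: "\<epsilon> > 0" and C: "C \<ge> 0" and IH: "\<And>P F \<eta> x A. poly_fun d P \<Longrightarrow> inv_prod ws F \<Longrightarrow>
      amplitude R \<eta> \<Longrightarrow> norm x \<le> r \<Longrightarrow> 0 < A \<Longrightarrow> A \<le> \<bar>dirderivs ws P x\<bar> \<Longrightarrow>
      cmod (osc P F \<eta>) \<le> C * A powr (- \<epsilon>)"
    using assms unfolding decay_def by blast
  \<comment> \<open>Keeping a distance 1 / (2 k) from the exceptional points costs a factor of order
    k ^ (d + 1), which this exponent turns into A powr (1 / 2).\<close>
  define s where "s = 1 / (2 * (real d + 1))"
  \<comment> \<open>The exceptional pairs contribute A powr (- s); the others contribute the
    \<epsilon> of the hypothesis, applied to a multiple of A powr (1 / 2).\<close>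
  define \<sigma> where "\<sigma> = min s (\<epsilon> / 2)"
  define V where "V = vol_cball TYPE('a) (R + norm w)"
  \<comment> \<open>The 2 undoes the halved amplitude in \<open>osc_correlation\<close>. The base 16
    is the 8 from \<rho> / 4 = 1 / (8 k), doubled since k is known only to be at most 2 * A powr
    s.\<close>
  define B where "B = 2 * C * (16 ^ (d + 1)) powr \<epsilon>"
  define E where "E = (real d + 1) * V + B"
  have s: "s > 0" and \<sigma>: "\<sigma> > 0" using \<epsilon> by (auto simp: s_def \<sigma>_def)
  have V: "V \<ge> 0" by (simp add: V_def)
  have B: "B \<ge> 0" using C by (simp add: B_def)
  have E: "E \<ge> 0" using V B by (simp add: E_def)
  have volV: "vol_cball TYPE('a) R \<le> V"
    unfolding V_def by (rule measure_mono_fmeasurable[OF subset_cball])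
      (auto simp: fmeasurable_def emeasure_cball_less_top)
  have "cmod (osc P F0 \<eta>) \<le> (V + E) * A powr (- (\<sigma> / 2))"
    if P: "poly_fun d P" and F0: "inv_prod (w # ws) F0" and \<eta>: "amplitude R \<eta>" and x: "norm x \<le> r"
      and A: "0 < A" "A \<le> \<bar>dirderivs (w # ws) P x\<bar>" for P F0 \<eta> x A
  proof (cases "A \<ge> 1")
    case False
    have "cmod (osc P F0 \<eta>) \<le> V"
      using osc_le_vol[OF poly_fun_measurable[OF P] F0 \<eta>] volV by linarith
    also have "\<dots> \<le> (V + E) * 1" using E by simp
    also have "\<dots> \<le> (V + E) * A powr (- (\<sigma> / 2))"
    proof (rule mult_left_mono)
      have "A powr (\<sigma> / 2) \<le> 1" using False A \<sigma> by (simp add: powr_le_one_le powr_le1)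
      then show "1 \<le> A powr (- (\<sigma> / 2))" using A by (simp add: powr_minus one_le_inverse)
    qed (use V E in auto)
    finally show ?thesis .
  next
    case True
    obtain f F where F0_eq: "F0 = (\<lambda>x. f x * F x)" and F: "inv_prod ws F"
      and f: "f \<in> borel_measurable borel" "\<And>x. cmod (f x) \<le> 1" "invariant_along w f"
      using F0 by (cases rule: inv_prod.cases) auto
    define H where "H x = cis (P x) * F x * \<eta> x" for x
    have Hm: "H \<in> borel_measurable borel" unfolding H_def
      using cis_measurable[OF poly_fun_measurable[OF P]] inv_prod_measurable[OF F] amplitude_measurable[OF \<eta>]
      by measurable
    have H1: "cmod (H x) \<le> 1" for x
      using inv_prod_le_1[OF F] \<eta> by (auto simp: H_def amplitude_def norm_mult intro: mult_le_one)
    have Hs: "H x = 0" if "R < norm x" for x using that \<eta> by (simp add: H_def amplitude_def)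
    obtain k :: nat where k: "k > 0" "A powr s \<le> real k" "real k \<le> 2 * A powr s"
      using nat_between_powr[OF True, of s] s by auto
    define \<Gamma> where "\<Gamma> i j = cmod (\<integral>x. H x * cnj (H (x + ((real j - real i) / real k) *\<^sub>R w)) \<partial>lborel)" for i j
    have \<Gamma>V: "\<Gamma> i j \<le> V" for i j
    proof -
      have "(\<lambda>x. H x * cnj (H (x + ((real j - real i) / real k) *\<^sub>R w))) \<in> borel_measurable borel"
        using Hm measurable_translate[OF Hm] by measurable
      from integral_supported[OF this, of R 1] volV show ?thesis unfolding \<Gamma>_def
        using H1 Hs by (force simp: norm_mult intro: mult_le_one)
    qed
    define G where "G = dirderivs ws P"
    have G: "poly_fun d G" unfolding G_def by (rule poly_fun_dirderivs[OF P])
    have "A \<le> \<bar>dirderiv w G x\<bar>" using A(2) by (simp add: G_def)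
    from poly_fun_increment_sublevel[OF G this] A(1) obtain Z where Z: "finite Z" "card Z \<le> d + 1"
      and lower: "\<And>t \<rho>. \<bar>t\<bar> \<le> 1 \<Longrightarrow> 0 < \<rho> \<Longrightarrow> \<rho> \<le> 1 \<Longrightarrow> (\<forall>z\<in>Z. \<rho> \<le> \<bar>t - z\<bar>) \<Longrightarrow>
        A * (\<rho> / 4) ^ (d + 1) \<le> \<bar>G x - G (x + t *\<^sub>R w)\<bar>" by auto
    \<comment> \<open>For fixed i the differences (j - i) / k form a grid of spacing 1 / k, so each
      exceptional point spoils at most one j.\<close>
    define bad where "bad i = {j. j < k \<and> (\<exists>z\<in>Z. \<bar>- (real i / real k) + real j * (1 / real k) - z\<bar> < (1 / real k) / 2)}" for i
    have bad: "card (bad i) \<le> d + 1" for i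
      unfolding bad_def by (rule le_trans[OF card_near_points[OF Z(1)] Z(2)]) (use k(1) in simp)
    have good: "\<Gamma> i j \<le> B * A powr (- \<sigma>)" if ij: "i < k" "j < k" "j \<notin> bad i" for i j
    proof -
      define t where "t = (real j - real i) / real k"
      have "\<bar>real j - real i\<bar> \<le> real k" using ij(1,2) by linarith
      then have t1: "\<bar>t\<bar> \<le> 1" using k(1) by (simp add: t_def)
      have "- (real i / real k) + real j * (1 / real k) = t" by (simp add: t_def diff_divide_distrib)
      then have avoid: "\<forall>z\<in>Z. 1 / (2 * real k) \<le> \<bar>t - z\<bar>"
        using ij(2,3) unfolding bad_def by (force simp: not_less)
      have "A * ((1 / (2 * real k)) / 4) ^ (d + 1) \<le> \<bar>G x - G (x + t *\<^sub>R w)\<bar>"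
        using k(1) avoid by (intro lower t1) auto
      also have "G x - G (x + t *\<^sub>R w) = dirderivs ws (\<lambda>x. P x - P (x + t *\<^sub>R w)) x"
        using dirderivs_diff[OF P poly_fun_translate[OF P]] by (simp add: G_def dirderivs_translate)
      finally have low: "A * ((1 / (2 * real k)) / 4) ^ (d + 1) \<le> \<bar>dirderivs ws (\<lambda>x. P x - P (x + t *\<^sub>R w)) x\<bar>" .
      define A' where "A' = A powr (1 / 2) / 16 ^ (d + 1)"
      have A': "A' > 0" using A(1) by (simp add: A'_def)
      have "A' \<le> A * ((1 / (2 * real k)) / 4) ^ (d + 1)"
      proof -
        have "(8 * real k) ^ (d + 1) \<le> (16 * A powr s) ^ (d + 1)"
          using k(3) by (intro power_mono) auto
        also have "\<dots> = 16 ^ (d + 1) * A powr (1 / 2)"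
        proof -
          have "(A powr s) ^ (d + 1) = A powr (s * real (d + 1))"
            using A(1) by (simp add: powr_powr powr_realpow[symmetric] del: power_Suc)
          also have "s * real (d + 1) = 1 / 2" by (simp add: s_def field_simps)
          finally show ?thesis by (simp only: power_mult_distrib)
        qed
        finally have le: "(8 * real k) ^ (d + 1) \<le> 16 ^ (d + 1) * A powr (1 / 2)" .
        have AA: "A = A powr (1 / 2) * A powr (1 / 2)" using A(1) by (simp add: powr_add[symmetric])
        have "A' = A / (16 ^ (d + 1) * A powr (1 / 2))"
          unfolding A'_def by (subst (2) AA) (use A(1) in \<open>simp add: field_simps\<close>)
        also have "\<dots> \<le> A / (8 * real k) ^ (d + 1)"
          using le A(1) k(1) by (intro divide_left_mono) auto
        finally show ?thesis by (simp add: power_divide power_mult_distrib)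
      qed
      with low have low': "A' \<le> \<bar>dirderivs ws (\<lambda>x. P x - P (x + t *\<^sub>R w)) x\<bar>" by linarith
      have "\<Gamma> i j = 2 * cmod (osc (\<lambda>x. P x - P (x + t *\<^sub>R w)) (\<lambda>x. F x * cnj (F (x + t *\<^sub>R w)))
          (\<lambda>x. \<eta> x * cnj (\<eta> (x + t *\<^sub>R w)) / 2))"
        unfolding \<Gamma>_def H_def t_def[symmetric] osc_correlation by (simp add: norm_mult)
      also have "\<dots> \<le> 2 * (C * A' powr (- \<epsilon>))"
        by (intro mult_left_mono IH[OF poly_fun_diff[OF P poly_fun_translate[OF P]]
            inv_prod_correlation[OF F] amplitude_correlation[OF \<eta>] x A' low']) auto
      also have "2 * (C * A' powr (- \<epsilon>)) = B * A powr (- (\<epsilon> / 2))"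
      proof -
        have "A' powr (- \<epsilon>) = (A powr (1 / 2)) powr (- \<epsilon>) * (16 ^ (d + 1)) powr \<epsilon>"
          unfolding A'_def using A(1) by (simp add: powr_divide powr_minus field_simps)
        also have "(A powr (1 / 2)) powr (- \<epsilon>) = A powr (- (\<epsilon> / 2))" by (simp add: powr_powr)
        finally show ?thesis by (simp add: B_def)
      qed
      also have "\<dots> \<le> B * A powr (- \<sigma>)"
        using B True by (intro mult_left_mono powr_mono) (auto simp: \<sigma>_def)
      finally show ?thesis .
    qed
    have "(\<Sum>(i, j)\<in>{..<k} \<times> {..<k}. \<Gamma> i j) = (\<Sum>i<k. \<Sum>j<k. \<Gamma> i j)"
      by (simp add: sum.cartesian_product)
    also have "\<dots> \<le> (\<Sum>i<k. real (d + 1) * V + real k * (B * A powr (- \<sigma>)))"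
    proof (rule sum_mono)
      fix i assume i: "i \<in> {..<k}"
      have sub: "bad i \<subseteq> {..<k}" by (auto simp: bad_def)
      have "(\<Sum>j<k. \<Gamma> i j) = (\<Sum>j\<in>bad i. \<Gamma> i j) + (\<Sum>j\<in>{..<k} - bad i. \<Gamma> i j)"
        using sub by (simp add: sum.subset_diff add.commute)
      also have "\<dots> \<le> real (card (bad i)) * V + real (card ({..<k} - bad i)) * (B * A powr (- \<sigma>))"
        using good i \<Gamma>V by (intro add_mono sum_bounded_above) auto
      also have "\<dots> \<le> real (d + 1) * V + real k * (B * A powr (- \<sigma>))"
      proof (intro add_mono mult_right_mono)
        show "real (card (bad i)) \<le> real (d + 1)" using bad by (simp only: of_nat_le_iff)
        have "card ({..<k} - bad i) \<le> card {..<k}" by (intro card_mono) auto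
        then show "real (card ({..<k} - bad i)) \<le> real k" by simp
      qed (use V B in auto)
      finally show "(\<Sum>j<k. \<Gamma> i j) \<le> real (d + 1) * V + real k * (B * A powr (- \<sigma>))" .
    qed
    also have "\<dots> = (real k)\<^sup>2 * (real (d + 1) * V / real k + B * A powr (- \<sigma>))"
      using k(1) by (simp add: field_simps power2_eq_square)
    also have "\<dots> \<le> (real k)\<^sup>2 * (E * A powr (- \<sigma>))"
    proof (rule mult_left_mono)
      have "1 / real k \<le> 1 / A powr s" using k A(1) by (intro divide_left_mono) auto
      also have "\<dots> = A powr (- s)" by (simp add: powr_minus_divide)
      also have "\<dots> \<le> A powr (- \<sigma>)" using True by (intro powr_mono) (auto simp: \<sigma>_def)
      finally have "real (d + 1) * V * (1 / real k) \<le> real (d + 1) * V * A powr (- \<sigma>)"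
        using V by (intro mult_left_mono) auto
      then show "real (d + 1) * V / real k + B * A powr (- \<sigma>) \<le> E * A powr (- \<sigma>)"
        by (simp add: E_def distrib_right add.commute)
    qed auto
    finally have sumle: "(\<Sum>(i, j)\<in>{..<k} \<times> {..<k}. \<Gamma> i j) / (real k)\<^sup>2 \<le> E * A powr (- \<sigma>)"
      using k(1) by (simp add: divide_le_eq mult.commute)
    \<comment> \<open>This choice balances V / \<theta> against \<theta> * A powr (-
      \<sigma>).\<close>
    define \<theta> where "\<theta> = A powr (\<sigma> / 2)"
    have \<theta>: "\<theta> > 0" using A(1) by (simp add: \<theta>_def)
    have "cmod (osc P F0 \<eta>) = cmod (\<integral>x. f x * H x \<partial>lborel)"
      by (simp add: osc_def F0_eq H_def mult_ac)
    also have "\<dots> \<le> V / (2 * \<theta>) + \<theta> / 2 * ((\<Sum>(i, j)\<in>{..<k} \<times> {..<k}. \<Gamma> i j) / (real k)\<^sup>2)"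
      unfolding V_def \<Gamma>_def using averaged_Cauchy_Schwarz[OF f Hm H1 Hs k(1) \<theta>] .
    also have "\<dots> \<le> V / (2 * \<theta>) + \<theta> / 2 * (E * A powr (- \<sigma>))"
      using \<theta> sumle by (intro add_left_mono mult_left_mono) auto
    also have "\<dots> = (V + E) / 2 * A powr (- (\<sigma> / 2))"
    proof -
      have "1 / \<theta> = A powr (- (\<sigma> / 2))" by (simp add: \<theta>_def powr_minus_divide)
      moreover have "\<theta> * A powr (- \<sigma>) = A powr (- (\<sigma> / 2))"
        unfolding \<theta>_def using A(1) by (simp add: powr_add[symmetric])
      ultimately have e: "1 / \<theta> = A powr (- (\<sigma> / 2))" "\<theta> * A powr (- \<sigma>) = A powr (- (\<sigma> / 2))" by auto
      have "V / (2 * \<theta>) + \<theta> / 2 * (E * A powr (- \<sigma>)) = V / 2 * (1 / \<theta>) + E / 2 * (\<theta> * A powr (- \<sigma>))"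
        by simp
      then show ?thesis unfolding e by (simp add: algebra_simps add_divide_distrib)
    qed
    also have "\<dots> \<le> (V + E) * A powr (- (\<sigma> / 2))"
      using V E by (intro mult_right_mono) auto
    finally show ?thesis .
  qed
  then show ?thesis unfolding decay_def using \<sigma> V E
    by (intro exI[of _ "\<sigma> / 2"] conjI exI[of _ "V + E"]) auto
qed

section \<open>A single invariant factor\<close>

lemma poly_fun_node_bound:
  fixes w :: "'a::euclidean_space"
  shows "\<exists>r C. 0 < C \<and> (\<forall>\<phi>. poly_fun d \<phi> \<longrightarrow> (\<exists>y. norm y \<le> r \<and>
    (\<forall>x. norm x \<le> R \<longrightarrow> \<bar>\<phi> x\<bar> \<le> C * \<bar>\<phi> y\<bar> \<and> \<bar>dirderiv w \<phi> x\<bar> \<le> C * \<bar>\<phi> y\<bar>)))"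
proof -
  \<comment> \<open>Interpolation with T the identity: a polynomial is the combination of fixed E s
    with its node values as coefficients. At the node where it is largest it therefore controls its
    own size and that of its derivative on the whole ball.\<close>
  have "\<exists>S E. finite S \<and> (\<forall>s. poly_fun d (E s :: 'a \<Rightarrow> real)) \<and>
    (\<forall>p. poly_fun d p \<longrightarrow> p = (\<lambda>x. \<Sum>s\<in>S. p s * E s x))"
    by (rule operator_nodes[of d "\<lambda>p. p"]) auto
  then obtain S :: "'a set" and E where S: "finite S" and E: "\<And>s. poly_fun d (E s :: 'a \<Rightarrow> real)"
    and repr: "\<And>p. poly_fun d p \<Longrightarrow> p = (\<lambda>x. \<Sum>s\<in>S. p s * E s x)" by blast
  have bdd: "\<exists>B. \<forall>x. norm x \<le> R \<longrightarrow> \<bar>p x\<bar> \<le> B" if "poly_fun d p" for p :: "'a \<Rightarrow> real"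
  proof -
    have "bounded (p ` cball 0 R)"
      by (intro compact_imp_bounded compact_continuous_image poly_fun_continuous[OF that]) auto
    then obtain B where "\<forall>y\<in>p ` cball 0 R. norm y \<le> B" unfolding bounded_iff by blast
    then show ?thesis by (intro exI[of _ B]) auto
  qed
  obtain B where B: "\<And>s x. norm x \<le> R \<Longrightarrow> \<bar>E s x\<bar> \<le> B s" using bdd[OF E] by metis
  obtain B' where B': "\<And>s x. norm x \<le> R \<Longrightarrow> \<bar>dirderiv w (E s) x\<bar> \<le> B' s"
    using bdd[OF poly_fun_dirderiv'[OF E]] by metis
  define C where "C = (\<Sum>s\<in>S. \<bar>B s\<bar> + \<bar>B' s\<bar>) + 1"
  have C: "C > 0" unfolding C_def by (simp add: add_nonneg_pos sum_nonneg)
  have "\<exists>y. norm y \<le> (\<Sum>s\<in>S. norm s) \<and>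
    (\<forall>x. norm x \<le> R \<longrightarrow> \<bar>\<phi> x\<bar> \<le> C * \<bar>\<phi> y\<bar> \<and> \<bar>dirderiv w \<phi> x\<bar> \<le> C * \<bar>\<phi> y\<bar>)"
    if \<phi>: "poly_fun d \<phi>" for \<phi>
  proof -
    have d\<phi>: "dirderiv w \<phi> = (\<lambda>x. \<Sum>s\<in>S. \<phi> s * dirderiv w (E s) x)"
      by (subst repr[OF \<phi>]) (simp add: dirderiv_sum[OF poly_fun_cmult[OF E]] dirderiv_cmult[OF E])
    have "\<exists>y. norm y \<le> (\<Sum>s\<in>S. norm s) \<and> (\<forall>s\<in>S. \<bar>\<phi> s\<bar> \<le> \<bar>\<phi> y\<bar>)"
    proof (cases "S = {}")
      case True
      then show ?thesis by (intro exI[of _ 0]) auto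
    next
      case False
      have "Max ((\<lambda>s. \<bar>\<phi> s\<bar>) ` S) \<in> (\<lambda>s. \<bar>\<phi> s\<bar>) ` S" using S False by (intro Max_in) auto
      then obtain y where y: "y \<in> S" "Max ((\<lambda>s. \<bar>\<phi> s\<bar>) ` S) = \<bar>\<phi> y\<bar>" by auto
      have "\<bar>\<phi> s\<bar> \<le> \<bar>\<phi> y\<bar>" if "s \<in> S" for s using S that unfolding y(2)[symmetric] by (intro Max_ge) auto
      moreover have "norm y \<le> (\<Sum>s\<in>S. norm s)" using S y(1) by (intro member_le_sum) auto
      ultimately show ?thesis by blast
    qed
    then obtain y where y: "norm y \<le> (\<Sum>s\<in>S. norm s)" "\<And>s. s \<in> S \<Longrightarrow> \<bar>\<phi> s\<bar> \<le> \<bar>\<phi> y\<bar>" by blast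
    have bound: "\<bar>\<Sum>s\<in>S. \<phi> s * e s\<bar> \<le> C * \<bar>\<phi> y\<bar>" if "\<And>s. s \<in> S \<Longrightarrow> \<bar>e s\<bar> \<le> \<bar>B s\<bar> + \<bar>B' s\<bar>" for e
    proof -
      have "\<bar>\<Sum>s\<in>S. \<phi> s * e s\<bar> \<le> (\<Sum>s\<in>S. \<bar>\<phi> y\<bar> * (\<bar>B s\<bar> + \<bar>B' s\<bar>))"
        by (rule order_trans[OF sum_abs sum_mono]) (use y(2) that in \<open>auto simp: abs_mult intro!: mult_mono\<close>)
      also have "\<dots> = (C - 1) * \<bar>\<phi> y\<bar>" by (simp add: C_def sum_distrib_left mult.commute)
      also have "\<dots> \<le> C * \<bar>\<phi> y\<bar>" by (intro mult_right_mono) auto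
      finally show ?thesis .
    qed
    have "\<bar>\<phi> x\<bar> \<le> C * \<bar>\<phi> y\<bar> \<and> \<bar>dirderiv w \<phi> x\<bar> \<le> C * \<bar>\<phi> y\<bar>" if x: "norm x \<le> R" for x
    proof
      have "\<phi> x = (\<Sum>s\<in>S. \<phi> s * E s x)" using repr[OF \<phi>] by metis
      moreover have "\<bar>E s x\<bar> \<le> \<bar>B s\<bar> + \<bar>B' s\<bar>" for s using B[OF x, of s] by linarith
      ultimately show "\<bar>\<phi> x\<bar> \<le> C * \<bar>\<phi> y\<bar>" using bound[of "\<lambda>s. E s x"] by metis
      have "\<bar>dirderiv w (E s) x\<bar> \<le> \<bar>B s\<bar> + \<bar>B' s\<bar>" for s using B'[OF x, of s] by linarith
      then show "\<bar>dirderiv w \<phi> x\<bar> \<le> C * \<bar>\<phi> y\<bar>" unfolding d\<phi> by (intro bound)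
    qed
    with y(1) show ?thesis by blast
  qed
  with C show ?thesis by blast
qed

text \<open>
  Restricting to the lines through a point \<open>y\<close> where the polynomial is large reduces the estimate to one
  variable: the preimages of the sublevel set under \<open>k\<close> homotheties with centre \<open>y\<close> and ratio in
  \<open>[1/2, 1)\<close> are at least as large as the set itself, and no point lies in more than \<open>d\<close> of them.
\<close>

lemma poly_fun_sublevel_measure:
  fixes \<phi> :: "'a::euclidean_space \<Rightarrow> real"
  assumes \<phi>: "poly_fun d \<phi>" and y: "norm y \<le> r" and k: "(k::nat) > 0"
  shows "measure lborel {x\<in>cball 0 R. \<bar>\<phi> x\<bar> < \<bar>\<phi> y\<bar> * (1 / (16 * real k)) ^ d}
    \<le> real d * vol_cball TYPE('a) (r + 2 * (R + r)) / real k"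
proof -
  let ?E = "{x\<in>cball 0 R. \<bar>\<phi> x\<bar> < \<bar>\<phi> y\<bar> * (1 / (16 * real k)) ^ d}"
  \<comment> \<open>A ratio of at least 1/2 at most doubles distances from y in the preimage, so
    points over the ball of radius R lie within 2 * (R + r) of y.\<close>
  let ?B = "cball (0::'a) (r + 2 * (R + r))"
  \<comment> \<open>The ratios have spacing 1 / (2 k). Staying half a spacing away from the roots
    means \<rho> = 1 / (4 k), and then \<rho> / 4 is the 1 / (16 k) in the definition of the
    set.\<close>
  define t where "t i = 1 / 2 + real i * (1 / (2 * real k))" for i
  define Ei where "Ei i = {x. y + t i *\<^sub>R (x - y) \<in> ?E}" for i
  have t: "1 / 2 \<le> t i" "t i < 1" if "i < k" for i using that k by (auto simp: t_def field_simps)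
  have [measurable]: "\<phi> \<in> borel_measurable borel" by (rule poly_fun_measurable[OF \<phi>])
  have Em: "?E \<in> sets borel" by measurable
  have Eim: "Ei i \<in> sets borel" for i
  proof -
    have "(\<lambda>x. y + t i *\<^sub>R (x - y)) -` ?E \<inter> space borel \<in> sets borel"
      by (rule measurable_sets[OF _ Em]) measurable
    then show ?thesis by (simp add: Ei_def vimage_def)
  qed
  have sub: "Ei i \<subseteq> ?B" if i: "i < k" for i
  proof
    fix x assume "x \<in> Ei i"
    then have "norm (y + t i *\<^sub>R (x - y)) \<le> R" by (simp add: Ei_def)
    then have "norm (t i *\<^sub>R (x - y)) \<le> R + r"
      using norm_triangle_ineq4[of "y + t i *\<^sub>R (x - y)" y] y by simp
    then have "t i * norm (x - y) \<le> R + r" using t[OF i] by simp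
    moreover have "1 / 2 * norm (x - y) \<le> t i * norm (x - y)" using t[OF i] by (intro mult_right_mono) auto
    ultimately have "norm (x - y) \<le> 2 * (R + r)" by simp
    then show "x \<in> ?B" using y norm_triangle_ineq[of y "x - y"] by simp
  qed
  have fin: "emeasure lborel (Ei i) < \<infinity>" if "i < k" for i
    using le_less_trans[OF emeasure_mono[OF sub[OF that]] emeasure_cball_less_top] by simp
  have le: "measure lborel ?E \<le> measure lborel (Ei i)" if i: "i < k" for i
  proof -
    have img: "?E = (\<lambda>x. t i *\<^sub>R x + (1 - t i) *\<^sub>R y) ` Ei i"
    proof (intro equalityI subsetI)
      fix x assume x: "x \<in> ?E"
      let ?z = "y + (1 / t i) *\<^sub>R (x - y)"
      have "y + t i *\<^sub>R (?z - y) = x" using t[OF i] by simp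
      moreover have "y + t i *\<^sub>R (?z - y) = t i *\<^sub>R ?z + (1 - t i) *\<^sub>R y" by (simp add: algebra_simps)
      ultimately show "x \<in> (\<lambda>x. t i *\<^sub>R x + (1 - t i) *\<^sub>R y) ` Ei i"
        using x unfolding Ei_def by (intro image_eqI[of _ _ ?z]) auto
    next
      fix x assume "x \<in> (\<lambda>x. t i *\<^sub>R x + (1 - t i) *\<^sub>R y) ` Ei i"
      then obtain z where z: "z \<in> Ei i" "x = t i *\<^sub>R z + (1 - t i) *\<^sub>R y" by blast
      have "x = y + t i *\<^sub>R (z - y)" unfolding z(2) by (simp add: algebra_simps)
      then show "x \<in> ?E" using z(1) unfolding Ei_def by blast
    qed
    have "measure lborel ?E = measure lebesgue ?E" using Em by simp
    also have "\<dots> = \<bar>t i\<bar> ^ DIM('a) * measure lebesgue (Ei i)"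
      by (subst img) (rule measure_lebesgue_affine)
    also have "\<dots> \<le> 1 * measure lebesgue (Ei i)"
      using t[OF i] by (intro mult_right_mono power_le_one) auto
    also have "\<dots> = measure lborel (Ei i)" using Eim by simp
    finally show ?thesis .
  qed
  have "\<forall>x. \<exists>Z::real set. finite Z \<and> card Z \<le> d \<and> (\<forall>t \<rho>. \<bar>t\<bar> \<le> 1 \<longrightarrow> 0 < \<rho> \<longrightarrow> \<rho> \<le> 1 \<longrightarrow>
      (\<forall>z\<in>Z. \<rho> \<le> \<bar>t - z\<bar>) \<longrightarrow> \<bar>\<phi> y\<bar> * (\<rho> / 4) ^ d \<le> \<bar>\<phi> (y + t *\<^sub>R (x - y))\<bar>)"
    by (intro allI poly_fun_sublevel[OF \<phi> order_refl abs_ge_zero])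
  from choice[OF this] obtain Z where Z: "\<And>x. finite (Z x)" "\<And>x. card (Z x) \<le> d" and
    lower: "\<And>x t \<rho>. \<bar>t\<bar> \<le> 1 \<Longrightarrow> 0 < \<rho> \<Longrightarrow> \<rho> \<le> 1 \<Longrightarrow> (\<forall>z\<in>Z x. \<rho> \<le> \<bar>t - z\<bar>) \<Longrightarrow>
       \<bar>\<phi> y\<bar> * (\<rho> / 4) ^ d \<le> \<bar>\<phi> (y + t *\<^sub>R (x - y))\<bar>" by blast
  have mult: "(\<Sum>i<k. indicator (Ei i) x) \<le> real d * indicator ?B x" for x
  proof (cases "x \<in> ?B")
    case False
    then have "x \<notin> Ei i" if "i < k" for i using sub[OF that] by blast
    then show ?thesis using False by simp
  next
    case True
    let ?J = "{j. j < k \<and> (\<exists>z\<in>Z x. \<bar>1 / 2 + real j * (1 / (2 * real k)) - z\<bar> < (1 / (2 * real k)) / 2)}"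
    have "{i. i < k \<and> x \<in> Ei i} \<subseteq> ?J"
    proof
      fix i assume i: "i \<in> {i. i < k \<and> x \<in> Ei i}"
      have "\<not> (\<forall>z\<in>Z x. 1 / (4 * real k) \<le> \<bar>t i - z\<bar>)"
      proof
        assume "\<forall>z\<in>Z x. 1 / (4 * real k) \<le> \<bar>t i - z\<bar>"
        then have "\<bar>\<phi> y\<bar> * ((1 / (4 * real k)) / 4) ^ d \<le> \<bar>\<phi> (y + t i *\<^sub>R (x - y))\<bar>"
          using t[of i] i k by (intro lower) auto
        then show False using i by (simp add: Ei_def)
      qed
      then show "i \<in> ?J" using i by (auto simp: t_def not_le)
    qed
    then have "card {i. i < k \<and> x \<in> Ei i} \<le> card ?J" by (intro card_mono) auto
    also have "\<dots> \<le> card (Z x)" using k by (intro card_near_points Z(1)) auto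
    finally have "card {i. i < k \<and> x \<in> Ei i} \<le> d" using Z(2)[of x] by simp
    moreover have "(\<Sum>i<k. indicator (Ei i) x :: real) = real (card {i. i < k \<and> x \<in> Ei i})"
      by (simp add: indicator_def sum.If_cases Int_def lessThan_def)
    ultimately show ?thesis using True by simp
  qed
  have int: "integrable lborel (indicator (Ei i) :: 'a \<Rightarrow> real)" if "i < k" for i
    using Eim fin[OF that] by (intro integrable_real_indicator) auto
  have "real k * measure lborel ?E = (\<Sum>i<k. measure lborel ?E)" by simp
  also have "\<dots> \<le> (\<Sum>i<k. measure lborel (Ei i))" using le by (intro sum_mono) auto
  also have "\<dots> = (\<integral>x. (\<Sum>i<k. indicator (Ei i) x) \<partial>lborel)"
    using int Eim by (subst Bochner_Integration.integral_sum) auto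
  also have "\<dots> \<le> (\<integral>x. real d * indicator ?B x \<partial>lborel)"
  proof (rule integral_mono)
    show "integrable lborel (\<lambda>x. \<Sum>i<k. indicator (Ei i) x :: real)"
      using int by (intro Bochner_Integration.integrable_sum) auto
    show "integrable lborel (\<lambda>x. real d * indicator ?B x)"
      using emeasure_cball_less_top[of 0 "r + 2 * (R + r)"]
      by (intro integrable_mult_right integrable_real_indicator) auto
  qed (rule mult)
  also have "\<dots> = real d * measure lborel ?B" by simp
  finally show ?thesis using k by (simp add: field_simps)
qed

text \<open>
  Integration by parts along \<open>w\<close>, with the derivative of the Lipschitz function \<open>\<eta>\<close> replaced by
  difference quotients; no boundary terms or cross sections appear because the integral of
  \<open>f\<close> times a difference along \<open>w\<close> vanishes by translation invariance.
\<close>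

lemma integral_derivative_along_le:
  fixes w :: "'a::euclidean_space" and g g' :: "'a \<Rightarrow> complex"
  assumes f: "f \<in> borel_measurable borel" "\<And>x. cmod (f x) \<le> 1" "invariant_along w f"
    and \<eta>: "amplitude R \<eta>"
    and g: "g \<in> borel_measurable borel" "\<And>x. cmod (g x) \<le> B"
    and g': "\<And>x. norm x \<le> R + norm w \<Longrightarrow> cmod (g' x) \<le> B'"
    and deriv: "\<And>x t. ((\<lambda>t. g (x + t *\<^sub>R w)) has_vector_derivative g' (x + t *\<^sub>R w)) (at t)"
  shows "cmod (\<integral>x. f x * \<eta> x * g' x \<partial>lborel) \<le> B * norm w * vol_cball TYPE('a) (R + norm w)"
proof -
  \<comment> \<open>Steps of length at most 1 keep the segment from x to its translate inside the
    ball on which g' is bounded.\<close>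
  let ?t = "\<lambda>n::nat. 1 / (real n + 1)"
  define q where "q n x = f x * \<eta> x * ((g (x + ?t n *\<^sub>R w) - g x) / of_real (?t n))" for n x
  note \<eta>' = \<eta>[unfolded amplitude_def]
  have [measurable]: "f \<in> borel_measurable borel" "\<eta> \<in> borel_measurable borel" "g \<in> borel_measurable borel"
    using f(1) g(1) amplitude_measurable[OF \<eta>] by auto
  have qm: "q n \<in> borel_measurable borel" for n
    unfolding q_def using measurable_translate[OF g(1), of "?t n *\<^sub>R w"] by measurable
  have lim: "(\<lambda>n. q n x) \<longlonglongrightarrow> f x * \<eta> x * g' x" for x
  proof -
    have "((\<lambda>t. g (x + t *\<^sub>R w)) has_vector_derivative g' x) (at 0)" using deriv[of x 0] by simp
    then have "((\<lambda>t. norm (g (x + t *\<^sub>R w) - g x - t *\<^sub>R g' x) / norm t) \<longlongrightarrow> 0) (at 0)"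
      by (simp add: has_vector_derivative_def has_derivative_at)
    moreover have "norm (g (x + t *\<^sub>R w) - g x - t *\<^sub>R g' x) / norm t
        = norm ((1 / t) *\<^sub>R (g (x + t *\<^sub>R w) - g x) - g' x)" if "t \<noteq> 0" for t
    proof -
      have "(1 / t) *\<^sub>R (g (x + t *\<^sub>R w) - g x) - g' x = (1 / t) *\<^sub>R (g (x + t *\<^sub>R w) - g x - t *\<^sub>R g' x)"
        using that by (simp add: scaleR_diff_right)
      then show ?thesis by simp
    qed
    then have "\<forall>\<^sub>F t in at 0. norm (g (x + t *\<^sub>R w) - g x - t *\<^sub>R g' x) / norm t
        = norm ((1 / t) *\<^sub>R (g (x + t *\<^sub>R w) - g x) - g' x)"
      by (auto simp: eventually_at_filter)
    ultimately have "((\<lambda>t. norm ((1 / t) *\<^sub>R (g (x + t *\<^sub>R w) - g x) - g' x)) \<longlongrightarrow> 0) (at 0)"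
      by (rule Lim_transform_eventually)
    then have "((\<lambda>t. (1 / t) *\<^sub>R (g (x + t *\<^sub>R w) - g x)) \<longlongrightarrow> g' x) (at 0)"
      using Lim_null tendsto_norm_zero_iff by blast
    moreover have "filterlim ?t (at 0) sequentially"
    proof -
      have "?t \<longlonglongrightarrow> 0" using LIMSEQ_inverse_real_of_nat by (simp add: inverse_eq_divide add.commute)
      then show ?thesis unfolding filterlim_at by (auto intro!: eventuallyI)
    qed
    ultimately have "(\<lambda>n. (1 / ?t n) *\<^sub>R (g (x + ?t n *\<^sub>R w) - g x)) \<longlonglongrightarrow> g' x"
      by (rule filterlim_compose)
    then show ?thesis unfolding q_def
      by (intro tendsto_mult tendsto_const) (simp add: scaleR_conv_of_real divide_inverse mult.commute)
  qed
  have incr: "cmod (g (x + ?t n *\<^sub>R w) - g x) \<le> B' * ?t n" if x: "norm x \<le> R" for x n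
  proof -
    have "norm (g (x + ?t n *\<^sub>R w) - g (x + 0 *\<^sub>R w)) \<le> B' * norm (?t n - 0)"
    proof (rule differentiable_bound[where S = "{0..1}" and f = "\<lambda>t. g (x + t *\<^sub>R w)"
          and f' = "\<lambda>t h. h *\<^sub>R g' (x + t *\<^sub>R w)"])
      fix t :: real assume t: "t \<in> {0..1}"
      show "((\<lambda>t. g (x + t *\<^sub>R w)) has_derivative (\<lambda>h. h *\<^sub>R g' (x + t *\<^sub>R w))) (at t within {0..1})"
        using deriv[of x t] by (auto simp: has_vector_derivative_def intro: has_derivative_at_withinI)
      have "norm (x + t *\<^sub>R w) \<le> norm x + \<bar>t\<bar> * norm w" by (rule norm_triangle_le) simp
      also have "\<dots> \<le> R + 1 * norm w" using x t by (intro add_mono mult_right_mono) auto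
      finally have "cmod (g' (x + t *\<^sub>R w)) \<le> B'" by (intro g') simp
      then show "onorm (\<lambda>h. h *\<^sub>R g' (x + t *\<^sub>R w)) \<le> B'"
        by (intro onorm_le) (simp add: mult.commute[of B'] mult_left_mono)
    qed auto
    then show ?thesis by simp
  qed
  have q_bound: "cmod (q n x) \<le> B' * indicator (cball 0 R) x" for n x
  proof (cases "norm x \<le> R")
    case True
    have "cmod (z / of_real t) \<le> B'" if "0 < t" "cmod z \<le> B' * t" for z t
      using that by (simp add: norm_divide pos_divide_le_eq)
    from this[OF _ incr[OF True, of n]]
    have "cmod ((g (x + ?t n *\<^sub>R w) - g x) / of_real (?t n)) \<le> B'" by simp
    moreover have "cmod (f x * \<eta> x) \<le> 1" using f(2) \<eta>' by (auto simp: norm_mult intro: mult_le_one)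
    ultimately have "cmod (q n x) \<le> 1 * B'"
      unfolding q_def by (subst norm_mult) (intro mult_mono, auto)
    then show ?thesis using True by simp
  next
    case False
    then show ?thesis using \<eta>' by (simp add: q_def)
  qed
  have "(\<lambda>n. \<integral>x. q n x \<partial>lborel) \<longlonglongrightarrow> (\<integral>x. f x * \<eta> x * g' x \<partial>lborel)"
  proof (rule integral_dominated_convergence)
    \<comment> \<open>Measurability is inherited from the difference quotients, since g' comes
      without any.\<close>
    show "(\<lambda>x. f x * \<eta> x * g' x) \<in> borel_measurable lborel"
      by (rule borel_measurable_LIMSEQ_metric[of q]) (use qm lim in auto)
    show "integrable lborel (\<lambda>x. B' * indicator (cball (0::'a) R) x)"
      using emeasure_cball_less_top[of "0::'a" R]
      by (intro integrable_mult_right integrable_real_indicator) auto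
  qed (use qm lim q_bound in auto)
  moreover have "cmod (\<integral>x. q n x \<partial>lborel) \<le> B * norm w * vol_cball TYPE('a) (R + norm w)" for n
  proof -
    let ?a = "?t n *\<^sub>R w"
    have t1: "norm ?a \<le> norm w" by (simp add: divide_le_eq mult_le_cancel_left1)
    have finv: "f (x + ?a) = f x" for x using f(3) by (simp add: invariant_along_def)
    define p where "p x = f x * \<eta> x * g x / of_real (?t n)" for x
    define u where "u x = f x * g (x + ?a) * ((\<eta> (x + ?a) - \<eta> x) / of_real (?t n))" for x
    have pm: "p \<in> borel_measurable borel" unfolding p_def by measurable
    have um: "u \<in> borel_measurable borel" unfolding u_def
      using measurable_translate[OF g(1), of ?a] measurable_translate[of \<eta> ?a] by measurable
    have t0: "?t n > 0" by simp
    have pb: "cmod (p x) \<le> B / ?t n" for x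
    proof -
      have "cmod (f x * \<eta> x) \<le> 1" using f(2) \<eta>' by (auto simp: norm_mult intro: mult_le_one)
      then have "cmod (f x * \<eta> x) * cmod (g x) \<le> 1 * B" using g(2) by (intro mult_mono) auto
      then have le: "cmod (f x * \<eta> x * g x) \<le> B" by (simp only: norm_mult mult_1)
      have "cmod (z / of_real t) \<le> B / t" if "0 < t" "cmod z \<le> B" for z t
        using that by (simp add: norm_divide divide_right_mono)
      from this[OF t0 le] show ?thesis by (simp only: p_def)
    qed
    have ps: "p x = 0" if "R < norm x" for x using that \<eta>' by (simp add: p_def)
    have pint: "integrable lborel p" using integrable_supported[OF pm pb ps] .
    have us: "u x = 0" if "R + norm w < norm x" for x
    proof -
      have "R < norm (x + ?a)" using norm_diff_ineq[of x ?a] that t1 by linarith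
      moreover have "R < norm x" using that norm_ge_zero[of w] by linarith
      ultimately show ?thesis using \<eta>' by (simp add: u_def)
    qed
    have ub: "cmod (u x) \<le> B * norm w" for x
    proof -
      have "cmod (\<eta> (x + ?a) - \<eta> x) \<le> dist (x + ?a) x" using \<eta>' by blast
      then have "cmod (\<eta> (x + ?a) - \<eta> x) \<le> ?t n * norm w" by (simp add: dist_norm)
      moreover have "cmod (z / of_real t) \<le> b" if "0 < t" "cmod z \<le> t * b" for z t b
        using that by (simp add: norm_divide pos_divide_le_eq mult.commute)
      ultimately have "cmod ((\<eta> (x + ?a) - \<eta> x) / of_real (?t n)) \<le> norm w" using t0 by blast
      moreover have "cmod (f x * g (x + ?a)) \<le> 1 * B"
        unfolding norm_mult using f(2) g(2) by (intro mult_mono) auto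
      moreover have "0 \<le> B" using g(2)[of x] norm_ge_zero[of "g x"] by linarith
      ultimately show ?thesis unfolding u_def by (subst norm_mult) (intro mult_mono, auto)
    qed
    have uint: "integrable lborel u" by (rule integrable_supported[OF um, of "R + norm w" "B * norm w"]) (use us ub in auto)
    have pint': "integrable lborel (\<lambda>x. p (x + ?a))"
    proof (rule integrable_supported[OF measurable_translate[OF pm] pb])
      fix x :: 'a assume "R + norm w < norm x"
      then have "R < norm (x + ?a)" using norm_diff_ineq[of x ?a] t1 by linarith
      then show "p (x + ?a) = 0" by (rule ps)
    qed
    \<comment> \<open>Discrete product rule: the difference of g times \<eta> is the difference of
      the product minus the translated g times the difference of \<eta>. The first part integrates
      to 0, and the Lipschitz bound controls the second.\<close>
    have "a * e * ((h' - h) / c) = (a * e' * h' / c - a * e * h / c) - a * h' * ((e' - e) / c)"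
      for a e e' h h' c :: complex by (simp add: diff_divide_distrib algebra_simps)
    then have "q n x = (p (x + ?a) - p x) - u x" for x
      unfolding q_def p_def u_def finv .
    then have "(\<integral>x. q n x \<partial>lborel) = (\<integral>x. p (x + ?a) \<partial>lborel) - (\<integral>x. p x \<partial>lborel) - (\<integral>x. u x \<partial>lborel)"
      using pint pint' uint by (simp add: Bochner_Integration.integral_diff)
    also have "\<dots> = - (\<integral>x. u x \<partial>lborel)" using integral_lborel_translate[OF pm, of ?a] by simp
    finally show ?thesis
      using integral_supported[OF um, of "R + norm w" "B * norm w"] us ub by simp
  qed
  ultimately show ?thesis by (intro LIMSEQ_le_const2[OF tendsto_norm]) auto
qed

text \<open>
  Regularised integration by parts: \<open>\<phi> / (\<phi>\<^sup>2 + \<tau>\<^sup>2)\<close> stands in for \<open>1 / \<phi>\<close>, where \<open>\<phi>\<close> is the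
  derivative of the phase along \<open>w\<close>.
\<close>

lemma osc_le_regularized:
  fixes P :: "'a::euclidean_space \<Rightarrow> real"
  assumes P: "poly_fun d P" and f: "f \<in> borel_measurable borel" "\<And>x. cmod (f x) \<le> 1" "invariant_along w f"
    and \<eta>: "amplitude R \<eta>" and \<tau>: "\<tau> > 0"
    and \<phi>: "\<phi> = dirderiv w P" and K: "\<And>x. norm x \<le> R + norm w \<Longrightarrow> \<bar>dirderiv w \<phi> x\<bar> \<le> K"
  shows "cmod (osc P f \<eta>) \<le> norm w * vol_cball TYPE('a) (R + norm w) / (2 * \<tau>) +
    K / \<tau>\<^sup>2 * vol_cball TYPE('a) R + (\<integral>x. indicator (cball 0 R) x * (\<tau>\<^sup>2 / ((\<phi> x)\<^sup>2 + \<tau>\<^sup>2)) \<partial>lborel)"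
proof -
  define \<kappa> where "\<kappa> x = \<phi> x / ((\<phi> x)\<^sup>2 + \<tau>\<^sup>2)" for x
  define \<kappa>' where "\<kappa>' x = dirderiv w \<phi> x * (\<tau>\<^sup>2 - (\<phi> x)\<^sup>2) / ((\<phi> x)\<^sup>2 + \<tau>\<^sup>2)\<^sup>2" for x
  define g where "g x = cis (P x) * of_real (\<kappa> x)" for x
  \<comment> \<open>The derivative of g along w. As \<kappa> imitates 1 / \<phi>, it equals \<i>
    times the oscillating factor up to the term with \<kappa>' and the defect 1 - \<phi>
    \<kappa>.\<close>
  define g' where "g' x = cis (P x) * (\<i> * of_real (\<phi> x * \<kappa> x) + of_real (\<kappa>' x))" for x
  have \<phi>p: "poly_fun d \<phi>" unfolding \<phi> by (rule poly_fun_dirderiv'[OF P])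
  have \<phi>'p: "poly_fun d (dirderiv w \<phi>)" by (rule poly_fun_dirderiv'[OF \<phi>p])
  have pos: "(\<phi> x)\<^sup>2 + \<tau>\<^sup>2 > 0" for x using \<tau> by (simp add: add_nonneg_pos)
  have [measurable]: "P \<in> borel_measurable borel" "\<phi> \<in> borel_measurable borel"
    "dirderiv w \<phi> \<in> borel_measurable borel" "f \<in> borel_measurable borel" "\<eta> \<in> borel_measurable borel"
    using P \<phi>p \<phi>'p f(1) amplitude_measurable[OF \<eta>] by (auto intro: poly_fun_measurable)
  have [measurable]: "(\<lambda>x. cis (P x)) \<in> borel_measurable borel" by (rule cis_measurable) measurable
  have [measurable]: "\<kappa> \<in> borel_measurable borel" "\<kappa>' \<in> borel_measurable borel"
    unfolding \<kappa>_def \<kappa>'_def by measurable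
  have [measurable]: "g \<in> borel_measurable borel" "g' \<in> borel_measurable borel"
    unfolding g_def g'_def by measurable
  note \<eta>' = \<eta>[unfolded amplitude_def]
  have \<kappa>_le: "\<bar>\<kappa> x\<bar> \<le> 1 / (2 * \<tau>)" for x
  proof -
    have "0 \<le> (\<bar>\<phi> x\<bar> - \<tau>)\<^sup>2" by simp
    then have "2 * \<tau> * \<bar>\<phi> x\<bar> \<le> (\<phi> x)\<^sup>2 + \<tau>\<^sup>2" by (simp add: power2_diff mult_ac)
    moreover have "a / s \<le> 1 / b" if "b * a \<le> s" "s > 0" "b > 0" for a b s :: real
      using that by (simp add: field_simps)
    ultimately have "\<bar>\<phi> x\<bar> / ((\<phi> x)\<^sup>2 + \<tau>\<^sup>2) \<le> 1 / (2 * \<tau>)" using pos[of x] \<tau> by simp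
    then show ?thesis using pos[of x] by (simp add: \<kappa>_def abs_divide abs_of_pos)
  qed
  \<comment> \<open>The price of the regularisation: a function that is small where
    \<bar>\<phi>\<bar> is much larger than \<tau>. Its integral remains in the conclusion and is
    treated by \<open>integral_sublevel_le\<close>.\<close>
  have \<phi>\<kappa>: "1 - \<phi> x * \<kappa> x = \<tau>\<^sup>2 / ((\<phi> x)\<^sup>2 + \<tau>\<^sup>2)" for x
  proof -
    have "(\<phi> x)\<^sup>2 / ((\<phi> x)\<^sup>2 + \<tau>\<^sup>2) + \<tau>\<^sup>2 / ((\<phi> x)\<^sup>2 + \<tau>\<^sup>2) = 1"
      unfolding add_divide_distrib[symmetric] by (rule divide_self) (use pos[of x] in linarith)
    moreover have "\<phi> x * \<kappa> x = (\<phi> x)\<^sup>2 / ((\<phi> x)\<^sup>2 + \<tau>\<^sup>2)" by (simp add: \<kappa>_def power2_eq_square)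
    ultimately show ?thesis by linarith
  qed
  have \<phi>\<kappa>_le: "\<bar>\<phi> x * \<kappa> x\<bar> \<le> 1" for x
    using pos[of x] \<tau> by (simp add: \<kappa>_def abs_mult power2_eq_square divide_le_eq)
  have \<kappa>'_le: "\<bar>\<kappa>' x\<bar> \<le> K / \<tau>\<^sup>2" if "norm x \<le> R + norm w" for x
  proof -
    have "\<bar>\<tau>\<^sup>2 - (\<phi> x)\<^sup>2\<bar> \<le> (\<phi> x)\<^sup>2 + \<tau>\<^sup>2" by (simp add: abs_le_iff)
    moreover have "a / s\<^sup>2 \<le> 1 / s" if "a \<le> s" "s > 0" for a s :: real
      using that by (simp add: power2_eq_square field_simps)
    ultimately have "\<bar>\<tau>\<^sup>2 - (\<phi> x)\<^sup>2\<bar> / ((\<phi> x)\<^sup>2 + \<tau>\<^sup>2)\<^sup>2 \<le> 1 / ((\<phi> x)\<^sup>2 + \<tau>\<^sup>2)"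
      using pos[of x] by blast
    also have "\<dots> \<le> 1 / \<tau>\<^sup>2" using \<tau> by (intro divide_left_mono) (auto simp: pos intro!: mult_pos_pos)
    finally have "\<bar>dirderiv w \<phi> x\<bar> * (\<bar>\<tau>\<^sup>2 - (\<phi> x)\<^sup>2\<bar> / ((\<phi> x)\<^sup>2 + \<tau>\<^sup>2)\<^sup>2) \<le> K * (1 / \<tau>\<^sup>2)"
      using K[OF that] by (intro mult_mono) auto
    then show ?thesis by (simp add: \<kappa>'_def abs_mult)
  qed
  have deriv: "((\<lambda>t. g (x + t *\<^sub>R w)) has_vector_derivative g' (x + t *\<^sub>R w)) (at t)" for x t
  proof -
    let ?x = "x + t *\<^sub>R w"
    have DP: "((\<lambda>t. P (x + t *\<^sub>R w)) has_real_derivative \<phi> ?x) (at t)"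
      unfolding \<phi> by (rule poly_fun_DERIV[OF P])
    have D\<phi>: "((\<lambda>t. \<phi> (x + t *\<^sub>R w)) has_real_derivative dirderiv w \<phi> ?x) (at t)"
      by (rule poly_fun_DERIV[OF \<phi>p])
    have nz: "(\<phi> ?x)\<^sup>2 + \<tau>\<^sup>2 \<noteq> 0" by (rule less_imp_neq[OF pos, symmetric])
    have "((\<lambda>t. \<kappa> (x + t *\<^sub>R w)) has_real_derivative \<kappa>' ?x) (at t)"
      unfolding \<kappa>_def \<kappa>'_def
      by (rule derivative_eq_intros D\<phi> refl nz)+
        (use nz in \<open>simp add: power2_eq_square algebra_simps\<close>)
    then have D\<kappa>: "((\<lambda>t. complex_of_real (\<kappa> (x + t *\<^sub>R w))) has_vector_derivative of_real (\<kappa>' ?x)) (at t)"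
      by (intro has_vector_derivative_of_real) (simp add: has_real_derivative_iff_has_vector_derivative)
    have "((\<lambda>t. \<i> * complex_of_real (P (x + t *\<^sub>R w))) has_vector_derivative \<i> * of_real (\<phi> ?x)) (at t)"
      using DP by (intro has_vector_derivative_mult_right has_vector_derivative_of_real)
        (simp add: has_real_derivative_iff_has_vector_derivative)
    then have "((\<lambda>t. cis (P (x + t *\<^sub>R w))) has_vector_derivative (\<i> * of_real (\<phi> ?x)) * cis (P ?x)) (at t)"
      unfolding cis_conv_exp
      using field_vector_diff_chain_at[of "\<lambda>t. \<i> * complex_of_real (P (x + t *\<^sub>R w))" _ t exp]
      by (auto simp: o_def intro: DERIV_exp)
    from has_vector_derivative_mult[OF this D\<kappa>]
    show ?thesis unfolding g_def g'_def by (simp add: algebra_simps)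
  qed
  have gB: "cmod (g x) \<le> 1 / (2 * \<tau>)" for x using \<kappa>_le[of x] by (simp add: g_def norm_mult)
  have g'B: "cmod (g' x) \<le> 1 + K / \<tau>\<^sup>2" if "norm x \<le> R + norm w" for x
  proof -
    have "cmod (g' x) \<le> cmod (\<i> * of_real (\<phi> x * \<kappa> x)) + cmod (of_real (\<kappa>' x))"
      unfolding g'_def norm_mult[of "cis (P x)"] norm_cis mult_1 by (rule norm_triangle_ineq)
    also have "\<dots> \<le> 1 + K / \<tau>\<^sup>2"
      using \<phi>\<kappa>_le[of x] \<kappa>'_le[OF that] by (simp only: norm_mult[of \<i>] norm_ii norm_of_real mult_1 add_mono)
    finally show ?thesis .
  qed
  have mainterm: "cmod (\<integral>x. f x * \<eta> x * g' x \<partial>lborel) \<le> 1 / (2 * \<tau>) * norm w * vol_cball TYPE('a) (R + norm w)"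
    by (rule integral_derivative_along_le[OF f \<eta> _ gB g'B deriv]) measurable
  have f\<eta>: "cmod (f x * \<eta> x) \<le> 1" for x using f(2) \<eta>' by (auto simp: norm_mult intro: mult_le_one)
  have \<eta>0: "\<eta> x = 0" if "R < norm x" for x using \<eta>' that by blast
  have inR: "norm x \<le> R + norm w" if "norm x \<le> R" for x :: 'a using that norm_ge_zero[of w] by linarith
  define u where "u x = f x * \<eta> x * (\<i> * cis (P x) * of_real (\<kappa>' x))" for x
  define v where "v x = f x * \<eta> x * (cis (P x) * of_real (\<tau>\<^sup>2 / ((\<phi> x)\<^sup>2 + \<tau>\<^sup>2)))" for x
  have um: "u \<in> borel_measurable borel" and vm: "v \<in> borel_measurable borel"
    unfolding u_def v_def by measurable
  have us: "u x = 0" "v x = 0" if "R < norm x" for x using \<eta>0[OF that] by (simp_all add: u_def v_def)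
  have ub: "cmod (u x) \<le> K / \<tau>\<^sup>2" if "norm x \<le> R" for x
  proof -
    have "cmod (f x * \<eta> x) * \<bar>\<kappa>' x\<bar> \<le> 1 * (K / \<tau>\<^sup>2)"
      using f\<eta>[of x] \<kappa>'_le[OF inR[OF that]] by (intro mult_mono) auto
    then show ?thesis by (simp add: u_def norm_mult)
  qed
  have frac: "0 \<le> \<tau>\<^sup>2 / ((\<phi> x)\<^sup>2 + \<tau>\<^sup>2)" "\<tau>\<^sup>2 / ((\<phi> x)\<^sup>2 + \<tau>\<^sup>2) \<le> 1" for x
    using pos[of x] by (auto simp: divide_le_eq)
  have vb: "cmod (v x) \<le> \<tau>\<^sup>2 / ((\<phi> x)\<^sup>2 + \<tau>\<^sup>2)" for x
  proof -
    have "cmod (f x * \<eta> x) * (\<tau>\<^sup>2 / ((\<phi> x)\<^sup>2 + \<tau>\<^sup>2)) \<le> 1 * (\<tau>\<^sup>2 / ((\<phi> x)\<^sup>2 + \<tau>\<^sup>2))"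
      using f\<eta>[of x] frac(1)[of x] by (intro mult_right_mono) auto
    moreover have "cmod (v x) = cmod (f x * \<eta> x) * (\<tau>\<^sup>2 / ((\<phi> x)\<^sup>2 + \<tau>\<^sup>2))"
      unfolding v_def norm_mult norm_cis norm_of_real using frac(1)[of x] by simp
    ultimately show ?thesis by simp
  qed
  have vb1: "cmod (v x) \<le> 1" for x using vb[of x] frac(2)[of x] by linarith
  have uint: "integrable lborel u" by (rule integrable_supported[OF um ub us(1)])
  have vint: "integrable lborel v" by (rule integrable_supported[OF vm vb1 us(2)])
  have gint: "integrable lborel (\<lambda>x. f x * \<eta> x * g' x)"
  proof (rule integrable_supported[of _ R "1 + K / \<tau>\<^sup>2"])
    show "cmod (f x * \<eta> x * g' x) \<le> 1 + K / \<tau>\<^sup>2" if "norm x \<le> R" for x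
    proof -
      have "cmod (f x * \<eta> x) * cmod (g' x) \<le> 1 * (1 + K / \<tau>\<^sup>2)"
        using f\<eta>[of x] g'B[OF inR[OF that]] by (intro mult_mono) auto
      then show ?thesis by (simp add: norm_mult)
    qed
  qed (use \<eta>0 in auto)
  \<comment> \<open>The definition of g' solved for \<open>cis (P x)\<close>: the exact derivative,
    the contribution of \<kappa>', and the defect of the regularisation.\<close>
  have "cis (P x) * f x * \<eta> x = - \<i> * (f x * \<eta> x * g' x) + u x + v x" for x
  proof -
    have e: "complex_of_real (\<tau>\<^sup>2 / ((\<phi> x)\<^sup>2 + \<tau>\<^sup>2)) = 1 - of_real (\<phi> x * \<kappa> x)"
      unfolding \<phi>\<kappa>[symmetric] by simp
    have "c * a * e = - \<i> * (a * e * (c * (\<i> * y + z))) + a * e * (\<i> * c * z) + a * e * (c * (1 - y))"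
      for c a e y z :: complex by (simp add: algebra_simps)
    then show ?thesis unfolding u_def v_def g'_def e .
  qed
  then have "osc P f \<eta> = - \<i> * (\<integral>x. f x * \<eta> x * g' x \<partial>lborel) + (\<integral>x. u x \<partial>lborel) + (\<integral>x. v x \<partial>lborel)"
    unfolding osc_def using gint uint vint by simp
  also have "cmod \<dots> \<le> cmod (- \<i> * (\<integral>x. f x * \<eta> x * g' x \<partial>lborel)) + cmod (\<integral>x. u x \<partial>lborel) + cmod (\<integral>x. v x \<partial>lborel)"
    by (rule order_trans[OF norm_triangle_ineq add_right_mono[OF norm_triangle_ineq]])
  also have "\<dots> \<le> norm w * vol_cball TYPE('a) (R + norm w) / (2 * \<tau>) + K / \<tau>\<^sup>2 * vol_cball TYPE('a) R
      + (\<integral>x. indicator (cball 0 R) x * (\<tau>\<^sup>2 / ((\<phi> x)\<^sup>2 + \<tau>\<^sup>2)) \<partial>lborel)"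
  proof (intro add_mono)
    show "cmod (- \<i> * (\<integral>x. f x * \<eta> x * g' x \<partial>lborel)) \<le> norm w * vol_cball TYPE('a) (R + norm w) / (2 * \<tau>)"
      using mainterm by (simp add: norm_mult)
    show "cmod (\<integral>x. u x \<partial>lborel) \<le> K / \<tau>\<^sup>2 * vol_cball TYPE('a) R"
      by (rule integral_supported[OF um ub us(1)])
    have "(\<lambda>x. indicator (cball (0::'a) R) x * (\<tau>\<^sup>2 / ((\<phi> x)\<^sup>2 + \<tau>\<^sup>2))) \<in> borel_measurable borel"
      by (intro borel_measurable_times borel_measurable_indicator borel_measurable_divide
          borel_measurable_add borel_measurable_power borel_measurable_const poly_fun_measurable[OF \<phi>p]) simp
    then have "integrable lborel (\<lambda>x. indicator (cball (0::'a) R) x * (\<tau>\<^sup>2 / ((\<phi> x)\<^sup>2 + \<tau>\<^sup>2)))"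
      by (rule integrable_supported[of _ R 1]) (use frac in auto)
    then have "(\<integral>x. cmod (v x) \<partial>lborel) \<le> (\<integral>x. indicator (cball 0 R) x * (\<tau>\<^sup>2 / ((\<phi> x)\<^sup>2 + \<tau>\<^sup>2)) \<partial>lborel)"
      using vint vb us(2) by (intro integral_mono) (auto simp: indicator_def not_le)
    then show "cmod (\<integral>x. v x \<partial>lborel) \<le> (\<integral>x. indicator (cball 0 R) x * (\<tau>\<^sup>2 / ((\<phi> x)\<^sup>2 + \<tau>\<^sup>2)) \<partial>lborel)"
      using integral_norm_bound[of lborel v] by linarith
  qed
  finally show ?thesis .
qed

text \<open>The sublevel set is cut at M times the power d, whereas \<tau> carries the power d + 1.
  Off the set this extra factor makes \<tau> / \<bar>\<phi>\<bar> at most 1 / (16 k), hence the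
  integrand at most 1 / k; on the set the integrand is at most 1 and the measure is of order 1 /
  k.\<close>

lemma integral_sublevel_le:
  fixes \<phi> :: "'a::euclidean_space \<Rightarrow> real"
  assumes \<phi>: "poly_fun d \<phi>" and y: "norm y \<le> r" and k: "(k::nat) > 0"
    and M: "M = \<bar>\<phi> y\<bar>" "M > 0" and \<tau>: "\<tau> = M * (1 / (16 * real k)) ^ (d + 1)"
  shows "(\<integral>x. indicator (cball 0 R) x * (\<tau>\<^sup>2 / ((\<phi> x)\<^sup>2 + \<tau>\<^sup>2)) \<partial>lborel)
    \<le> (real d * vol_cball TYPE('a) (r + 2 * (R + r)) + vol_cball TYPE('a) R) / real k"
proof -
  let ?\<delta> = "(1 / (16 * real k)) ^ d"
  let ?E = "{x\<in>cball 0 R. \<bar>\<phi> x\<bar> < \<bar>\<phi> y\<bar> * ?\<delta>}"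
  have \<tau>0: "\<tau> > 0" using M k by (simp add: \<tau>)
  have [measurable]: "\<phi> \<in> borel_measurable borel" by (rule poly_fun_measurable[OF \<phi>])
  have Em: "?E \<in> sets borel" by measurable
  have pos: "(\<phi> x)\<^sup>2 + \<tau>\<^sup>2 > 0" for x using \<tau>0 by (simp add: add_nonneg_pos)
  have le1: "\<tau>\<^sup>2 / ((\<phi> x)\<^sup>2 + \<tau>\<^sup>2) \<le> 1" for x using pos[of x] by (simp add: divide_le_eq)
  have pt: "indicator (cball 0 R) x * (\<tau>\<^sup>2 / ((\<phi> x)\<^sup>2 + \<tau>\<^sup>2)) \<le> indicator ?E x + indicator (cball 0 R) x / real k" for x
  proof (cases "x \<in> cball 0 R \<and> x \<notin> ?E")
    case False
    then show ?thesis using le1[of x] by (auto simp: indicator_def intro: order_trans[OF le1])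
  next
    case True
    then have low: "M * ?\<delta> \<le> \<bar>\<phi> x\<bar>" by (simp add: M(1) not_less)
    have "0 < M * ?\<delta>" using M(2) k by simp
    then have sq: "(M * ?\<delta>)\<^sup>2 \<le> (\<phi> x)\<^sup>2" using low by (metis abs_le_square_iff abs_of_pos)
    have "\<tau>\<^sup>2 / ((\<phi> x)\<^sup>2 + \<tau>\<^sup>2) \<le> \<tau>\<^sup>2 / (M * ?\<delta>)\<^sup>2"
      using sq \<open>0 < M * ?\<delta>\<close> pos[of x] k by (intro divide_left_mono mult_pos_pos add_increasing2) (auto intro: add_increasing2)
    also have "\<dots> = (1 / (16 * real k))\<^sup>2"
      using M(2) k by (simp add: \<tau> power_mult_distrib power_divide)
    also have "\<dots> \<le> 1 / real k"
    proof -
      have "1 \<le> real k * real k" "1 \<le> real k" using k by (auto simp flip: of_nat_mult)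
      then show ?thesis using k by (simp add: power2_eq_square field_simps)
    qed
    finally show ?thesis using True by simp
  qed
  have intE: "integrable lborel (indicator ?E :: 'a \<Rightarrow> real)"
  proof (rule integrable_real_indicator)
    have "emeasure lborel ?E \<le> emeasure lborel (cball (0::'a) R)" by (rule emeasure_mono) auto
    then show "emeasure lborel ?E < \<infinity>" using le_less_trans[OF _ emeasure_cball_less_top] by simp
  qed (use Em in simp)
  have intB: "integrable lborel (indicator (cball (0::'a) R) :: 'a \<Rightarrow> real)"
    using emeasure_cball_less_top[of "0::'a" R] by (intro integrable_real_indicator) auto
  have "(\<lambda>x. indicator (cball (0::'a) R) x * (\<tau>\<^sup>2 / ((\<phi> x)\<^sup>2 + \<tau>\<^sup>2))) \<in> borel_measurable borel"
    by (intro borel_measurable_times borel_measurable_indicator borel_measurable_divide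
        borel_measurable_add borel_measurable_power borel_measurable_const poly_fun_measurable[OF \<phi>]) simp
  then have "integrable lborel (\<lambda>x. indicator (cball (0::'a) R) x * (\<tau>\<^sup>2 / ((\<phi> x)\<^sup>2 + \<tau>\<^sup>2)))"
    by (rule integrable_supported[of _ R 1]) (use le1 in auto)
  then have "(\<integral>x. indicator (cball 0 R) x * (\<tau>\<^sup>2 / ((\<phi> x)\<^sup>2 + \<tau>\<^sup>2)) \<partial>lborel)
      \<le> (\<integral>x. indicator ?E x + indicator (cball 0 R) x / real k \<partial>lborel)"
    using intE intB pt by (intro integral_mono) auto
  also have "\<dots> = measure lborel ?E + vol_cball TYPE('a) R / real k"
    using intE intB Em by (subst Bochner_Integration.integral_add) auto
  also have "\<dots> \<le> real d * vol_cball TYPE('a) (r + 2 * (R + r)) / real k + vol_cball TYPE('a) R / real k"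
    using poly_fun_sublevel_measure[OF \<phi> y k, of R] by simp
  finally show ?thesis by (simp add: add_divide_distrib)
qed

lemma decay_single:
  fixes w :: "'a::euclidean_space"
  shows "decay [w] d R r"
proof -
  \<comment> \<open>The radius must contain both the point x at which A is given and the ball on
    which \<open>osc_le_regularized\<close> asks for a bound on the derivative of \<phi>.\<close>
  obtain r' C1 where C1: "C1 > 0" and node: "\<And>\<phi>. poly_fun d \<phi> \<Longrightarrow> \<exists>y. norm y \<le> r' \<and>
    (\<forall>x. norm x \<le> max r (R + norm w) \<longrightarrow> \<bar>\<phi> x\<bar> \<le> C1 * \<bar>\<phi> y\<bar> \<and> \<bar>dirderiv w \<phi> x\<bar> \<le> C1 * \<bar>\<phi> y\<bar>)"
    using poly_fun_node_bound[of d "max r (R + norm w)" w] by blast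
  \<comment> \<open>With k about M powr \<theta>, the inverse square of \<delta> is of order k ^ (2
    * (d + 1)), that is M powr (1 / 2). Half of the power of M is left, more than the \<theta> that
    the sublevel set yields.\<close>
  define \<theta> where "\<theta> = 1 / (4 * (real d + 1))"
  define V where "V = vol_cball TYPE('a) R"
  define V1 where "V1 = norm w * vol_cball TYPE('a) (R + norm w)"
  define V2 where "V2 = real d * vol_cball TYPE('a) (r' + 2 * (R + r')) + V"
  define D where "D = (V1 + C1 * V) * 32 ^ (2 * (d + 1)) + V2"
  have \<theta>: "\<theta> > 0" by (simp add: \<theta>_def)
  have V: "V \<ge> 0" "V1 \<ge> 0" "V2 \<ge> 0" by (auto simp: V_def V1_def V2_def)
  have D: "D \<ge> 0" using V C1 by (auto simp: D_def)
  have "cmod (osc P F \<eta>) \<le> ((V + D) * C1 powr \<theta>) * A powr (- \<theta>)"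
    if P: "poly_fun d P" and F: "inv_prod [w] F" and \<eta>: "amplitude R \<eta>" and x: "norm x \<le> r"
      and A: "0 < A" "A \<le> \<bar>dirderivs [w] P x\<bar>" for P F \<eta> x A
  proof -
    define \<phi> where "\<phi> = dirderiv w P"
    have \<phi>p: "poly_fun d \<phi>" unfolding \<phi>_def by (rule poly_fun_dirderiv'[OF P])
    obtain y where y: "norm y \<le> r'" and ybound: "\<And>x. norm x \<le> max r (R + norm w) \<Longrightarrow>
        \<bar>\<phi> x\<bar> \<le> C1 * \<bar>\<phi> y\<bar> \<and> \<bar>dirderiv w \<phi> x\<bar> \<le> C1 * \<bar>\<phi> y\<bar>"
      using node[OF \<phi>p] by blast
    define M where "M = \<bar>\<phi> y\<bar>"
    have "A \<le> C1 * M" using A(2) ybound[of x] x by (simp add: M_def \<phi>_def le_max_iff_disj)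
    then have AM: "A / C1 \<le> M" using C1 by (simp add: field_simps)
    have M: "M > 0" using less_le_trans[OF divide_pos_pos[OF A(1) C1] AM] .
    have "M powr (- \<theta>) \<le> (A / C1) powr (- \<theta>)"
      using AM A(1) C1 \<theta> by (intro powr_mono2') auto
    also have "\<dots> = C1 powr \<theta> * A powr (- \<theta>)"
      using A(1) C1 by (simp add: powr_divide powr_minus field_simps)
    finally have Mle: "M powr (- \<theta>) \<le> C1 powr \<theta> * A powr (- \<theta>)" .
    have "cmod (osc P F \<eta>) \<le> (V + D) * M powr (- \<theta>)"
    proof (cases "M \<ge> 1")
      case False
      have "cmod (osc P F \<eta>) \<le> V"
        using osc_le_vol[OF poly_fun_measurable[OF P] F \<eta>] by (simp add: V_def)
      also have "\<dots> \<le> (V + D) * 1" using D by simp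
      also have "\<dots> \<le> (V + D) * M powr (- \<theta>)"
      proof (rule mult_left_mono)
        have "M powr \<theta> \<le> 1" using False M \<theta> by (simp add: powr_le1)
        then show "1 \<le> M powr (- \<theta>)" using M by (simp add: powr_minus one_le_inverse)
      qed (use V D in auto)
      finally show ?thesis .
    next
      case True
      obtain f where F_eq: "F = f" and f: "f \<in> borel_measurable borel" "\<And>x. cmod (f x) \<le> 1" "invariant_along w f"
        using F by (auto elim!: inv_prod.cases)
      obtain k :: nat where k: "k > 0" "M powr \<theta> \<le> real k" "real k \<le> 2 * M powr \<theta>"
        using nat_between_powr[OF True, of \<theta>] \<theta> by auto
      define \<delta> where "\<delta> = (1 / (16 * real k)) ^ (d + 1)"
      define \<tau> where "\<tau> = M * \<delta>"
      have \<delta>: "\<delta> > 0" "\<delta> \<le> 1"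
        unfolding \<delta>_def using k(1) by (simp, intro power_le_one, auto simp: divide_le_eq)
      have \<tau>: "\<tau> > 0" using M \<delta> by (simp add: \<tau>_def)
      have K: "\<bar>dirderiv w \<phi> x\<bar> \<le> C1 * M" if "norm x \<le> R + norm w" for x
        using ybound[of x] that by (simp add: M_def)
      have small: "1 / (M * \<delta>\<^sup>2) \<le> 32 ^ (2 * (d + 1)) * M powr (- \<theta>)"
      proof -
        have "1 / \<delta>\<^sup>2 = (16 * real k) ^ (2 * (d + 1))"
        proof -
          have "\<delta>\<^sup>2 = (1 / (16 * real k)) ^ (2 * (d + 1))"
            by (simp only: \<delta>_def power_mult mult.commute[of 2])
          then show ?thesis by (simp add: power_one_over del: power_Suc)
        qed
        also have "\<dots> \<le> (32 * M powr \<theta>) ^ (2 * (d + 1))"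
          using k(3) by (intro power_mono) auto
        also have "\<dots> = 32 ^ (2 * (d + 1)) * M powr (1 / 2)"
        proof -
          have "(M powr \<theta>) ^ (2 * (d + 1)) = M powr (\<theta> * real (2 * (d + 1)))"
            using M by (simp add: powr_powr powr_realpow[symmetric] del: power_Suc)
          also have "\<theta> * real (2 * (d + 1)) = 1 / 2" by (simp add: \<theta>_def field_simps)
          finally show ?thesis by (simp only: power_mult_distrib)
        qed
        finally have "1 / \<delta>\<^sup>2 \<le> 32 ^ (2 * (d + 1)) * M powr (1 / 2)" .
        then have "(1 / M) * (1 / \<delta>\<^sup>2) \<le> (1 / M) * (32 ^ (2 * (d + 1)) * M powr (1 / 2))"
          using M by (intro mult_left_mono) auto
        also have "\<dots> = 32 ^ (2 * (d + 1)) * M powr (- (1 / 2))"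
        proof -
          have "1 / M * M powr (1 / 2) = M powr (- 1) * M powr (1 / 2)"
            using M by (simp add: powr_minus_divide)
          also have "\<dots> = M powr (- (1 / 2))" by (simp only: powr_add[symmetric]) simp
          finally have e: "1 / M * M powr (1 / 2) = M powr (- (1 / 2))" .
          show ?thesis unfolding mult.left_commute[of "1 / M"] e ..
        qed
        also have "\<dots> \<le> 32 ^ (2 * (d + 1)) * M powr (- \<theta>)"
          using True by (intro mult_left_mono powr_mono) (auto simp: \<theta>_def field_simps)
        finally show ?thesis by simp
      qed
      have invk: "1 / real k \<le> M powr (- \<theta>)"
      proof -
        have "1 / real k \<le> 1 / M powr \<theta>" using k M by (intro divide_left_mono) auto
        then show ?thesis by (simp add: powr_minus_divide)
      qed
      have "cmod (osc P F \<eta>) \<le> norm w * vol_cball TYPE('a) (R + norm w) / (2 * \<tau>) +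
          C1 * M / \<tau>\<^sup>2 * vol_cball TYPE('a) R
          + (\<integral>x. indicator (cball 0 R) x * (\<tau>\<^sup>2 / ((\<phi> x)\<^sup>2 + \<tau>\<^sup>2)) \<partial>lborel)"
        unfolding F_eq by (rule osc_le_regularized[OF P f \<eta> \<tau> \<phi>_def K])
      also have "\<dots> \<le> V1 * (1 / (M * \<delta>\<^sup>2)) + C1 * V * (1 / (M * \<delta>\<^sup>2)) + V2 * (1 / real k)"
      proof (intro add_mono)
        have "M * \<delta>\<^sup>2 \<le> 2 * \<tau>"
        proof -
          have "M * \<delta> * \<delta> \<le> M * \<delta> * 1" using M \<delta> by (intro mult_left_mono) auto
          then show ?thesis using \<tau> by (simp add: \<tau>_def power2_eq_square mult.assoc)
        qed
        then have "V1 / (2 * \<tau>) \<le> V1 / (M * \<delta>\<^sup>2)"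
          using V M \<delta> \<tau> by (intro divide_left_mono) auto
        then show "norm w * vol_cball TYPE('a) (R + norm w) / (2 * \<tau>) \<le> V1 * (1 / (M * \<delta>\<^sup>2))"
          by (simp add: V1_def)
        show "C1 * M / \<tau>\<^sup>2 * vol_cball TYPE('a) R \<le> C1 * V * (1 / (M * \<delta>\<^sup>2))"
          using M \<delta> by (simp add: \<tau>_def V_def power2_eq_square mult_ac)
        show "(\<integral>x. indicator (cball 0 R) x * (\<tau>\<^sup>2 / ((\<phi> x)\<^sup>2 + \<tau>\<^sup>2)) \<partial>lborel) \<le> V2 * (1 / real k)"
          using integral_sublevel_le[OF \<phi>p y k(1) M_def M, of \<tau> R] by (simp add: V2_def V_def \<tau>_def \<delta>_def)
      qed
      also have "\<dots> = (V1 + C1 * V) * (1 / (M * \<delta>\<^sup>2)) + V2 * (1 / real k)" by (simp only: distrib_right)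
      also have "\<dots> \<le> (V1 + C1 * V) * (32 ^ (2 * (d + 1)) * M powr (- \<theta>)) + V2 * M powr (- \<theta>)"
        using V C1 small invk by (intro add_mono mult_left_mono) auto
      also have "\<dots> = D * M powr (- \<theta>)" by (simp only: D_def distrib_right mult.assoc)
      also have "\<dots> \<le> (V + D) * M powr (- \<theta>)" using V by (intro mult_right_mono) auto
      finally show ?thesis .
    qed
    also have "\<dots> \<le> (V + D) * (C1 powr \<theta> * A powr (- \<theta>))"
      using Mle V D by (intro mult_left_mono) auto
    finally show ?thesis by (simp only: mult.assoc)
  qed
  then show ?thesis unfolding decay_def using \<theta> V D
    by (intro exI[of _ \<theta>] conjI exI[of _ "(V + D) * C1 powr \<theta>"]) auto
qed

text \<open>The induction starts with one direction: for the empty list a large constant phase would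
  satisfy the hypotheses without any decay.\<close>

lemma decay_nonempty: "ws \<noteq> [] \<Longrightarrow> decay ws d R r"
  by (induction ws rule: list_nonempty_induct) (auto intro: decay_single decay_step)

section \<open>Functions on hyperplanes\<close>

lemma hyperplane_normal_exists:
  fixes V :: "'a::euclidean_space set"
  assumes "subspace V" "dim V + 1 = DIM('a)"
  shows "\<exists>w. norm w = 1 \<and> V = {x. x \<bullet> w = 0}"
proof -
  obtain a where a: "a \<noteq> 0" "\<And>y. y \<in> span V \<Longrightarrow> orthogonal a y"
    using orthogonal_to_subspace_exists[of V] assms(2) by auto
  have "V \<subseteq> {x. a \<bullet> x = 0}" using a(2) by (auto simp: orthogonal_def span_base)
  moreover have "dim {x. a \<bullet> x = 0} \<le> dim V" using dim_hyperplane[OF a(1)] assms(2) by simp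
  ultimately have "V = {x. a \<bullet> x = 0}"
    using subspace_dim_equal[OF assms(1) subspace_hyperplane] by blast
  then show ?thesis using a(1)
    by (intro exI[of _ "(1 / norm a) *\<^sub>R a"]) (auto simp: inner_commute)
qed

lemma orth_proj_unique:
  assumes V: "subspace V" and u: "u \<in> V" "\<And>v. v \<in> V \<Longrightarrow> orthogonal (x - u) v"
  shows "orth_proj V x = u"
proof -
  have m: "u - orth_proj V x \<in> V"
    using u(1) orth_proj(1)[OF V] by (rule subspace_diff[OF V])
  have "(x - u) \<bullet> (u - orth_proj V x) = 0" "(x - orth_proj V x) \<bullet> (u - orth_proj V x) = 0"
    using u(2)[OF m] orth_proj(2)[OF V m] by (auto simp: orthogonal_def)
  then have "(u - orth_proj V x) \<bullet> (u - orth_proj V x) = 0" by (simp add: inner_diff_left)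
  then show ?thesis by simp
qed

lemma linear_orth_proj:
  assumes V: "subspace V"
  shows "linear (orth_proj V)"
proof (rule linearI)
  fix x y and a :: real
  show "orth_proj V (x + y) = orth_proj V x + orth_proj V y"
  proof (rule orth_proj_unique[OF V])
    show "orth_proj V x + orth_proj V y \<in> V"
      by (intro subspace_add[OF V] orth_proj(1)[OF V])
    show "orthogonal (x + y - (orth_proj V x + orth_proj V y)) v" if "v \<in> V" for v
      using orth_proj(2)[OF V that, of x] orth_proj(2)[OF V that, of y]
      by (simp add: orthogonal_def inner_diff_left inner_add_left)
  qed
  show "orth_proj V (a *\<^sub>R x) = a *\<^sub>R orth_proj V x"
  proof (rule orth_proj_unique[OF V])
    show "a *\<^sub>R orth_proj V x \<in> V"
      by (intro subspace_scale[OF V] orth_proj(1)[OF V])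
    show "orthogonal (a *\<^sub>R x - a *\<^sub>R orth_proj V x) v" if "v \<in> V" for v
      using orth_proj(2)[OF V that, of x]
      by (simp add: orthogonal_def scaleR_diff_right[symmetric])
  qed
qed

lemma orth_proj_hyperplane:
  fixes w :: "'a::euclidean_space"
  assumes "norm w = 1" "V = {x. x \<bullet> w = 0}"
  shows "orth_proj V x = x - (x \<bullet> w) *\<^sub>R w"
proof (rule orth_proj_unique)
  show "subspace V" unfolding assms(2) using subspace_hyperplane2[of w] by simp
  have "w \<bullet> w = 1" using assms(1) by (simp add: norm_eq_1)
  then show "x - (x \<bullet> w) *\<^sub>R w \<in> V" by (simp add: assms(2) inner_diff_left)
  show "orthogonal (x - (x - (x \<bullet> w) *\<^sub>R w)) v" if "v \<in> V" for v
    using that by (simp add: assms(2) orthogonal_def inner_commute)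
qed

section \<open>Null sets under the projection onto a hyperplane\<close>

lemma distr_PiM_lborel_reindex:
  fixes I :: "'i set" and B :: "'j set"
  assumes I: "finite I" and \<gamma>: "bij_betw \<gamma> B I"
  shows "distr (\<Pi>\<^sub>M i\<in>I. lborel :: real measure) (\<Pi>\<^sub>M c\<in>B. lborel) (\<lambda>g. \<lambda>c\<in>B. g (\<gamma> c)) = (\<Pi>\<^sub>M c\<in>B. lborel)"
proof -
  interpret I: product_sigma_finite "\<lambda>_::'i. lborel :: real measure" ..
  interpret B: product_sigma_finite "\<lambda>_::'j. lborel :: real measure" ..
  have fB: "finite B" using I \<gamma> by (simp add: bij_betw_finite)
  have m: "(\<lambda>g. \<lambda>c\<in>B. g (\<gamma> c)) \<in> measurable (\<Pi>\<^sub>M i\<in>I. lborel) (\<Pi>\<^sub>M c\<in>B. lborel)"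
    using \<gamma> by (intro measurable_restrict measurable_component_singleton) (auto simp: bij_betw_def)
  show ?thesis
  proof (rule B.PiM_eqI[OF fB])
    fix A :: "'j \<Rightarrow> real set" assume A: "\<And>c. c \<in> B \<Longrightarrow> A c \<in> sets lborel"
    let ?A = "\<lambda>i. A (inv_into B \<gamma> i)"
    have inv: "inv_into B \<gamma> (\<gamma> c) = c" if "c \<in> B" for c
      using \<gamma> that by (simp add: bij_betw_def)
    have "(\<lambda>g. \<lambda>c\<in>B. g (\<gamma> c)) -` Pi\<^sub>E B A \<inter> space (\<Pi>\<^sub>M i\<in>I. lborel) = Pi\<^sub>E I ?A"
    proof (intro equalityI subsetI)
      fix g assume g: "g \<in> (\<lambda>g. \<lambda>c\<in>B. g (\<gamma> c)) -` Pi\<^sub>E B A \<inter> space (\<Pi>\<^sub>M i\<in>I. lborel)"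
      have "g i \<in> ?A i" if "i \<in> I" for i
      proof -
        obtain c where c: "c \<in> B" "i = \<gamma> c" using \<gamma> \<open>i \<in> I\<close> by (auto simp: bij_betw_def)
        then show ?thesis using g inv[OF c(1)] by (auto simp: PiE_iff)
      qed
      then show "g \<in> Pi\<^sub>E I ?A" using g by (auto simp: space_PiM PiE_iff)
    next
      fix g assume g: "g \<in> Pi\<^sub>E I ?A"
      have "g (\<gamma> c) \<in> A c" if "c \<in> B" for c
        using g \<gamma> that inv[OF that] by (auto simp: PiE_iff bij_betw_def)
      then show "g \<in> (\<lambda>g. \<lambda>c\<in>B. g (\<gamma> c)) -` Pi\<^sub>E B A \<inter> space (\<Pi>\<^sub>M i\<in>I. lborel)"
        using g by (auto simp: space_PiM PiE_iff)
    qed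
    then have "emeasure (distr (\<Pi>\<^sub>M i\<in>I. lborel) (\<Pi>\<^sub>M c\<in>B. lborel) (\<lambda>g. \<lambda>c\<in>B. g (\<gamma> c))) (Pi\<^sub>E B A)
        = emeasure (\<Pi>\<^sub>M i\<in>I. lborel) (Pi\<^sub>E I ?A)"
      using A fB by (subst emeasure_distr[OF m]) (auto intro!: sets_PiM_I_finite)
    also have "\<dots> = (\<Prod>i\<in>I. emeasure lborel (?A i))"
      using A \<gamma> I by (intro I.emeasure_PiM) (auto simp: bij_betw_def inv_into_into)
    also have "\<dots> = (\<Prod>c\<in>B. emeasure lborel (A c))"
      using inv by (subst prod.reindex_bij_betw[OF \<gamma>, symmetric]) (intro prod.cong, auto)
    finally show "emeasure (distr (\<Pi>\<^sub>M i\<in>I. lborel) (\<Pi>\<^sub>M c\<in>B. lborel) (\<lambda>g. \<lambda>c\<in>B. g (\<gamma> c))) (Pi\<^sub>E B A)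
        = (\<Prod>c\<in>B. emeasure lborel (A c))" .
  qed simp
qed

text \<open>By Fubini the slices in the new coordinate are empty over points outside N. Over N they
  are whole lines of infinite measure, which is harmless because infinity times 0 is 0.\<close>

lemma null_sets_PiM_insert:
  fixes I :: "'i set"
  assumes I: "finite I" "i \<notin> I" and N: "N \<in> null_sets (\<Pi>\<^sub>M i\<in>I. lborel :: real measure)"
  shows "{h \<in> space (\<Pi>\<^sub>M i\<in>insert i I. lborel). restrict h I \<in> N} \<in> null_sets (\<Pi>\<^sub>M i\<in>insert i I. lborel)"
proof -
  interpret product_sigma_finite "\<lambda>_::'i. lborel :: real measure" ..
  let ?P = "\<Pi>\<^sub>M i\<in>I. lborel :: real measure" and ?Q = "\<Pi>\<^sub>M i\<in>insert i I. lborel :: real measure"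
  let ?S = "{h \<in> space ?Q. restrict h I \<in> N}"
  have Nm: "N \<in> sets ?P" using N by auto
  have "(\<lambda>h. restrict h I) \<in> measurable ?Q ?P" by (rule measurable_restrict_subset) auto
  from measurable_sets[OF this Nm] have S: "?S \<in> sets ?Q" by (simp add: vimage_def Int_def conj_commute)
  have "emeasure ?Q ?S = (\<integral>\<^sup>+h. indicator ?S h \<partial>?Q)" using S by simp
  also have "\<dots> = (\<integral>\<^sup>+x. (\<integral>\<^sup>+y. indicator ?S (x(i := y)) \<partial>lborel) \<partial>?P)"
    using I S by (intro product_nn_integral_insert) auto
  also have "\<dots> = (\<integral>\<^sup>+x. (\<integral>\<^sup>+y. indicator N x \<partial>(lborel :: real measure)) \<partial>?P)"
  proof (intro nn_integral_cong)
    fix x :: "'i \<Rightarrow> real" and y :: real assume x: "x \<in> space ?P"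
    then have "restrict (x(i := y)) I = x" using I(2) by (auto simp: space_PiM PiE_def extensional_def fun_eq_iff)
    moreover have "x(i := y) \<in> space ?Q" using x by (auto simp: space_PiM PiE_def extensional_def)
    ultimately show "indicator ?S (x(i := y)) = (indicator N x :: ennreal)" by (simp add: indicator_def)
  qed
  also have "\<dots> = (\<integral>\<^sup>+x. emeasure lborel (UNIV :: real set) * indicator N x \<partial>?P)"
    by (intro nn_integral_cong) (simp add: mult.commute)
  also have "\<dots> = 0" using N Nm by (simp add: nn_integral_cmult null_setsD1)
  finally show ?thesis using S by auto
qed

text \<open>The measure on V is built from \<open>onb V\<close>, Lebesgue measure from the standard
  basis. Renaming coordinates by a bijection of \<open>onb V\<close> with the standard basis minus
  b0 turns N into a null set of standard coordinates, and the cylinder S over it is null. The linear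
  isometry T then carries S onto the preimage of N. Rotation invariance is avoided: differentiable
  maps preserve negligible sets.\<close>

lemma hyperplane_null_sets_pullback:
  fixes w :: "'a::euclidean_space"
  assumes w: "norm w = 1" and V: "V = {x. x \<bullet> w = 0}"
    and N: "N \<in> null_sets (distr (\<Pi>\<^sub>M b\<in>onb V. lborel) (restrict_space borel V) (\<lambda>g. \<Sum>b\<in>onb V. g b *\<^sub>R b))"
  shows "{x. orth_proj V x \<in> N} \<in> null_sets lborel"
proof -
  let ?B = "onb V"
  have sV: "subspace V" unfolding V using subspace_hyperplane2[of w] by simp
  note B = onb[OF sV] and fB = onb_finite[OF sV]
  have "independent ?B"
    by (rule pairwise_orthogonal_independent[OF B(2)]) (use B(3) in force)
  then have cB: "card ?B = dim V" using dim_span_eq_card_independent B(4) by metis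
  have "w \<noteq> 0" using w by auto
  then have dV: "dim V = DIM('a) - 1" using dim_hyperplane[of w] by (simp add: V inner_commute)
  obtain b0 :: 'a where b0: "b0 \<in> Basis" using nonempty_Basis by blast
  let ?I = "Basis - {b0}"
  have fI: "finite ?I" by simp
  obtain \<gamma> where \<gamma>: "bij_betw \<gamma> ?B ?I"
    using finite_same_card_bij[OF fB fI] cB dV b0 by (auto simp: card_Diff_singleton)
  have \<gamma>I: "\<gamma> c \<in> Basis" "\<gamma> c \<noteq> b0" if "c \<in> ?B" for c
    using \<gamma> that by (auto simp: bij_betw_def)
  have \<gamma>\<gamma>: "\<gamma> c \<bullet> \<gamma> c' = of_bool (c = c')" if "c \<in> ?B" "c' \<in> ?B" for c c'
    using that \<gamma>I \<gamma> by (auto simp: inner_Basis bij_betw_def inj_on_def)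
  have "closed V" by (rule closed_subspace[OF sV])
  then have Vb: "V \<in> sets borel" by simp
  have Nb: "N \<in> sets borel" "N \<subseteq> V"
    using null_setsD2[OF N] Vb by (auto simp: sets_restrict_space_iff)
  let ?PB = "\<Pi>\<^sub>M c\<in>?B. lborel :: real measure" and ?PI = "\<Pi>\<^sub>M i\<in>?I. lborel :: real measure"
    and ?PA = "\<Pi>\<^sub>M i\<in>Basis. lborel :: real measure"
  let ?\<Sigma> = "\<lambda>g. \<Sum>c\<in>?B. g c *\<^sub>R c"
  have \<Sigma>V: "?\<Sigma> g \<in> V" for g
    using B(1) by (intro subspace_sum[OF sV] subspace_scale[OF sV]) auto
  have \<Sigma>b: "?\<Sigma> \<in> measurable ?PB borel" by measurable
  have \<Sigma>m: "?\<Sigma> \<in> measurable ?PB (restrict_space borel V)"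
    using \<Sigma>b \<Sigma>V by (intro measurable_restrict_space2) auto
  have N1: "?\<Sigma> -` N \<inter> space ?PB \<in> null_sets ?PB"
    using N null_sets_distr_iff[OF \<Sigma>m] by blast
  let ?\<Gamma> = "\<lambda>g. \<lambda>c\<in>?B. g (\<gamma> c)"
  have \<Gamma>m: "?\<Gamma> \<in> measurable ?PI ?PB"
    using \<gamma> by (intro measurable_restrict measurable_component_singleton) (auto simp: bij_betw_def)
  have "?\<Gamma> -` (?\<Sigma> -` N \<inter> space ?PB) \<inter> space ?PI \<in> null_sets ?PI"
    using N1 null_sets_distr_iff[OF \<Gamma>m, unfolded distr_PiM_lborel_reindex[OF fI \<gamma>]] by blast
  from null_sets_PiM_insert[OF fI _ this, of b0]
  have "{h \<in> space ?PA. restrict h ?I \<in> ?\<Gamma> -` (?\<Sigma> -` N \<inter> space ?PB) \<inter> space ?PI} \<in> null_sets ?PA"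
    using b0 by (simp add: insert_absorb)
  moreover have "?\<Sigma> (?\<Gamma> (restrict h ?I)) = (\<Sum>c\<in>?B. h (\<gamma> c) *\<^sub>R c)" for h
    using \<gamma>I by (intro sum.cong) auto
  moreover have "restrict h ?I \<in> space ?PI" "?\<Gamma> (restrict h ?I) \<in> space ?PB" for h
    by (auto simp: space_PiM)
  ultimately have N2: "{h \<in> space ?PA. (\<Sum>c\<in>?B. h (\<gamma> c) *\<^sub>R c) \<in> N} \<in> null_sets ?PA"
    by simp
  define S where "S = {y. (\<Sum>c\<in>?B. (y \<bullet> \<gamma> c) *\<^sub>R c) \<in> N}"
  have Sm: "S \<in> sets borel"
  proof -
    have "(\<lambda>y. \<Sum>c\<in>?B. (y \<bullet> \<gamma> c) *\<^sub>R c) \<in> borel_measurable borel" by measurable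
    from measurable_sets[OF this Nb(1)] show ?thesis by (simp add: S_def vimage_def)
  qed
  have A: "(\<lambda>f. \<Sum>b\<in>Basis. f b *\<^sub>R b) \<in> measurable ?PA borel" by measurable
  have coord: "(\<Sum>b\<in>Basis. h b *\<^sub>R b) \<bullet> \<gamma> c = h (\<gamma> c)" if "c \<in> ?B" for h c
    using \<gamma>I[OF that] by (simp add: inner_sum_left_Basis)
  have "emeasure lborel S = emeasure ?PA ((\<lambda>f. \<Sum>b\<in>Basis. f b *\<^sub>R b) -` S \<inter> space ?PA)"
    by (subst lborel_eq) (rule emeasure_distr[OF A Sm])
  also have "(\<lambda>f. \<Sum>b\<in>Basis. f b *\<^sub>R b) -` S \<inter> space ?PA = {h \<in> space ?PA. (\<Sum>c\<in>?B. h (\<gamma> c) *\<^sub>R c) \<in> N}"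
    by (auto simp: S_def coord)
  also have "emeasure ?PA \<dots> = 0" using N2 by auto
  finally have "S \<in> null_sets lborel" using Sm by auto
  then have "negligible S" unfolding negligible_iff_null_sets by (rule null_sets_completionI)
  define T where "T y = (\<Sum>c\<in>?B. (y \<bullet> \<gamma> c) *\<^sub>R c) + (y \<bullet> b0) *\<^sub>R w" for y
  have "T differentiable_on S"
    unfolding T_def by (intro derivative_intros bounded_linear_imp_differentiable_on) 
      (auto intro!: bounded_linear_imp_differentiable_on bounded_linear_intros)
  then have "negligible (T ` S)"
    using negligible_differentiable_image_negligible[OF order_refl \<open>negligible S\<close>] by blast
  moreover have "{x. orth_proj V x \<in> N} \<subseteq> T ` S"
  proof
    fix x assume x: "x \<in> {x. orth_proj V x \<in> N}"
    \<comment> \<open>The preimage of x under T, obtained by exchanging the two orthonormal systems,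
      with b0 in the place of w.\<close>
    define y where "y = (\<Sum>c\<in>?B. (x \<bullet> c) *\<^sub>R \<gamma> c) + (x \<bullet> w) *\<^sub>R b0"
    have y\<gamma>: "y \<bullet> \<gamma> c = x \<bullet> c" if c: "c \<in> ?B" for c
    proof -
      have "b0 \<bullet> \<gamma> c = 0" using \<gamma>I[OF c] b0 by (simp add: inner_Basis)
      moreover have "(\<Sum>c'\<in>?B. (x \<bullet> c') * (\<gamma> c' \<bullet> \<gamma> c)) = (\<Sum>c'\<in>?B. if c' = c then x \<bullet> c else 0)"
        using \<gamma>\<gamma>[OF _ c] by (intro sum.cong) auto
      ultimately show ?thesis using c fB by (simp add: y_def inner_add_left inner_sum_left)
    qed
    have yb0: "y \<bullet> b0 = x \<bullet> w"
    proof -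
      have "\<gamma> c \<bullet> b0 = 0" if "c \<in> ?B" for c using \<gamma>I[OF that] b0 by (simp add: inner_Basis)
      then show ?thesis using b0 by (simp add: y_def inner_add_left inner_sum_left)
    qed
    have p: "orth_proj V x = x - (x \<bullet> w) *\<^sub>R w" by (rule orth_proj_hyperplane[OF w V])
    have "orth_proj V x = (\<Sum>c\<in>?B. (orth_proj V x \<bullet> c) *\<^sub>R c)"
      using orthonormal_expansion[OF B(2,3) _ fB] orth_proj(1)[OF sV, of x] B(4) by blast
    also have "\<dots> = (\<Sum>c\<in>?B. (x \<bullet> c) *\<^sub>R c)"
    proof (intro sum.cong refl)
      fix c assume "c \<in> ?B"
      then have "w \<bullet> c = 0" using B(1) V by (auto simp: inner_commute)
      then show "(orth_proj V x \<bullet> c) *\<^sub>R c = (x \<bullet> c) *\<^sub>R c" by (simp add: p inner_diff_left)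
    qed
    finally have e: "orth_proj V x = (\<Sum>c\<in>?B. (y \<bullet> \<gamma> c) *\<^sub>R c)" using y\<gamma> by simp
    then have "y \<in> S" using x by (simp add: S_def)
    moreover have "T y = x" unfolding T_def e[symmetric] yb0 p by simp
    ultimately show "x \<in> T ` S" by blast
  qed
  ultimately have "negligible {x. orth_proj V x \<in> N}" using negligible_subset by blast
  moreover have "{x. orth_proj V x \<in> N} \<in> sets borel"
  proof -
    have "(\<lambda>x. x - (x \<bullet> w) *\<^sub>R w) \<in> borel_measurable borel" by measurable
    from measurable_sets[OF this Nb(1)] show ?thesis
      by (simp add: vimage_def orth_proj_hyperplane[OF w V])
  qed
  ultimately show ?thesis by (simp add: negligible_iff_null_sets null_sets_completion_iff)
qed

section \<open>Borel representatives of bounded functions on a hyperplane\<close>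

lemma bounded_borel_representative:
  fixes f :: "'x \<Rightarrow> complex"
  assumes f: "f \<in> borel_measurable (completion M)" and B: "AE x in M. cmod (f x) \<le> B" "0 \<le> B"
  shows "\<exists>g\<in>borel_measurable M. (\<forall>x. cmod (g x) \<le> B) \<and> (AE x in M. f x = g x)"
proof -
  obtain f1 where f1: "f1 \<in> borel_measurable M" "AE x in M. Re (f x) = f1 x"
    using completion_ex_borel_measurable_real[of "\<lambda>x. Re (f x)" M] f by auto
  obtain f2 where f2: "f2 \<in> borel_measurable M" "AE x in M. Im (f x) = f2 x"
    using completion_ex_borel_measurable_real[of "\<lambda>x. Im (f x)" M] f by auto
  define h where "h x = complex_of_real (f1 x) + \<i> * complex_of_real (f2 x)" for x
  have h[measurable]: "h \<in> borel_measurable M" unfolding h_def using f1(1) f2(1) by measurable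
  \<comment> \<open>Truncation makes the bound hold everywhere, as \<open>inv_prod\<close> demands,
    and changes h only on a null set.\<close>
  have "(\<lambda>x. if cmod (h x) \<le> B then h x else 0) \<in> borel_measurable M" by measurable
  moreover have "AE x in M. f x = (if cmod (h x) \<le> B then h x else 0)"
    using f1(2) f2(2) B(1)
  proof eventually_elim
    case (elim x)
    then have "h x = f x" by (simp add: h_def complex_eq_iff)
    then show ?case using elim by simp
  qed
  ultimately show ?thesis using B(2) by (intro bexI[of _ "\<lambda>x. if cmod (h x) \<le> B then h x else 0"]) auto
qed

lemma Linf_borel_representative:
  fixes w :: "'a::euclidean_space"
  assumes w: "norm w = 1" and V: "V = {x. x \<bullet> w = 0}" and f: "f \<in> Linf V"
  shows "(\<lambda>x. f (orth_proj V x)) \<in> borel_measurable lebesgue"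
    and "\<exists>g\<in>borel_measurable borel. invariant_along w g \<and>
      (\<forall>x. cmod (g x) \<le> enn2real (Linf_norm V f)) \<and> (AE x in lebesgue. f (orth_proj V x) = g x)"
proof -
  let ?\<mu> = "distr (\<Pi>\<^sub>M b\<in>onb V. lborel) (restrict_space borel V) (\<lambda>g. \<Sum>b\<in>onb V. g b *\<^sub>R b)"
  let ?M = "enn2real (Linf_norm V f)"
  have ww: "w \<bullet> w = 1" using w by (simp add: norm_eq_1)
  have sV: "subspace V" unfolding V using subspace_hyperplane2[of w] by simp
  note p = orth_proj_hyperplane[OF w V]
  have pm: "orth_proj V \<in> measurable borel (restrict_space borel V)"
  proof (rule measurable_restrict_space2)
    show "orth_proj V \<in> measurable borel borel" unfolding p[abs_def] by measurable
  qed (use orth_proj(1)[OF sV] in auto)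
  then have pm': "orth_proj V \<in> measurable lborel ?\<mu>"
    by (simp cong: measurable_cong_sets)
  have null: "orth_proj V -` N \<inter> space lborel \<in> null_sets lborel" if "N \<in> null_sets ?\<mu>" for N
    using hyperplane_null_sets_pullback[OF w V that] by (simp add: vimage_def)
  have "orth_proj V \<in> measurable lebesgue (completion ?\<mu>)"
  \<comment> \<open>Measurability into the completion requires preimages of null sets to be null,
    which is the content of \<open>hyperplane_null_sets_pullback\<close>.\<close>
  proof (rule completion.measurable_completion2)
    show pl: "orth_proj V \<in> measurable lebesgue ?\<mu>" by (rule measurable_completion[OF pm'])
    show "null_sets ?\<mu> \<subseteq> null_sets (distr lebesgue ?\<mu> (orth_proj V))"
    proof
      fix N assume N: "N \<in> null_sets ?\<mu>"
      then have "orth_proj V -` N \<inter> space lebesgue \<in> null_sets lebesgue"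
        using null_sets_completionI[OF null[OF N]] by simp
      then show "N \<in> null_sets (distr lebesgue ?\<mu> (orth_proj V))"
        using N null_sets_distr_iff[OF pl] by blast
    qed
  qed
  moreover have fm: "f \<in> borel_measurable (completion ?\<mu>)"
    using f by (simp add: Linf_def subspace_lebesgue_def)
  ultimately show "(\<lambda>x. f (orth_proj V x)) \<in> borel_measurable lebesgue"
    by (rule measurable_compose)

  have "AE v in completion ?\<mu>. ennreal (cmod (f v)) \<le> Linf_norm V f"
    unfolding Linf_norm_def subspace_lebesgue_def by (rule esssup_AE)
  then have "AE v in ?\<mu>. ennreal (cmod (f v)) \<le> Linf_norm V f" by (simp add: AE_completion_iff)
  then have M: "AE v in ?\<mu>. cmod (f v) \<le> ?M"
  proof eventually_elim
    case (elim v)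
    have "Linf_norm V f = ennreal ?M" using f by (simp add: Linf_def)
    with elim have "ennreal (cmod (f v)) \<le> ennreal ?M" by metis
    then show ?case by (simp add: ennreal_le_iff)
  qed
  obtain g0 where g0m: "g0 \<in> borel_measurable ?\<mu>" and g0M: "\<And>v. cmod (g0 v) \<le> ?M"
    and g0: "AE v in ?\<mu>. f v = g0 v"
    using bounded_borel_representative[OF fm M] by auto
  then obtain N where N: "{v \<in> space ?\<mu>. \<not> f v = g0 v} \<subseteq> N" "N \<in> null_sets ?\<mu>"
    by (auto simp: eventually_ae_filter)
  have "AE x in lborel. f (orth_proj V x) = g0 (orth_proj V x)"
  proof (rule AE_I'[OF null[OF N(2)]])
    show "{x \<in> space lborel. \<not> f (orth_proj V x) = g0 (orth_proj V x)} \<subseteq> orth_proj V -` N \<inter> space lborel"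
      using N(1) orth_proj(1)[OF sV] by (auto simp: space_restrict_space)
  qed
  then have "AE x in lebesgue. f (orth_proj V x) = g0 (orth_proj V x)" by (simp add: AE_completion_iff)
  moreover have "(\<lambda>x. g0 (orth_proj V x)) \<in> borel_measurable borel"
    using measurable_compose[OF pm' g0m] by simp
  moreover have "invariant_along w (\<lambda>x. g0 (orth_proj V x))"
    unfolding invariant_along_def p by (simp add: inner_add_left ww scaleR_add_left)
  ultimately show "\<exists>g\<in>borel_measurable borel. invariant_along w g \<and> (\<forall>x. cmod (g x) \<le> ?M) \<and>
      (AE x in lebesgue. f (orth_proj V x) = g x)"
    using g0M by (intro bexI[of _ "\<lambda>x. g0 (orth_proj V x)"]) auto
qed

section \<open>Amplitudes and uniform decay\<close>

text \<open>A real supremum bounds its set only if the set is bounded above. Compact support ensures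
  this for \<eta> and for its derivative, which vanishes off the support; the mean value inequality
  then gives the Lipschitz bound.\<close>

lemma C1_norm_bounds:
  fixes \<eta> :: "'a::euclidean_space \<Rightarrow> complex"
  assumes C1: "C1 \<eta>" and K: "compact K" "closure {x. \<eta> x \<noteq> 0} \<subseteq> K"
  shows "0 \<le> C1_norm \<eta>" "cmod (\<eta> x) \<le> C1_norm \<eta>" "cmod (\<eta> x - \<eta> y) \<le> C1_norm \<eta> * dist x y"
proof -
  obtain D :: "'a \<Rightarrow> 'a \<Rightarrow>\<^sub>L complex" where D: "\<And>x. (\<eta> has_derivative blinfun_apply (D x)) (at x)"
    and Dc: "continuous_on UNIV D" using C1 unfolding C1_def by blast
  have fd: "frechet_derivative \<eta> (at x) = blinfun_apply (D x)" for x
    using frechet_derivative_at[OF D] by simp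
  have on: "onorm (frechet_derivative \<eta> (at x)) = norm (D x)" for x by (simp add: fd norm_blinfun.rep_eq)
  have D0: "D x = 0" if "x \<notin> closure {x. \<eta> x \<noteq> 0}" for x
  proof -
    let ?S = "- closure {x. \<eta> x \<noteq> 0}"
    have "open ?S" by (intro open_Compl closed_closure)
    moreover have "x \<in> ?S" using that by simp
    moreover have "0 = \<eta> y" if "y \<in> ?S" for y
      using that closure_subset[of "{x. \<eta> x \<noteq> 0}"] by auto
    ultimately have "(\<eta> has_derivative (\<lambda>h. 0)) (at x)"
      by (rule has_derivative_transform_within_open[OF has_derivative_const])
    then have "blinfun_apply (D x) = (\<lambda>h. 0)" using D has_derivative_unique by blast
    then show ?thesis by (intro blinfun_eqI) simp
  qed
  have bdd: "bdd_above (range h)" if h: "continuous_on UNIV h" "\<And>x. x \<notin> K \<Longrightarrow> h x = 0" for h :: "'a \<Rightarrow> real"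
  proof -
    have "compact (h ` K)" using h(1) K(1) by (intro compact_continuous_image) (auto intro: continuous_on_subset)
    then have "bdd_above (insert 0 (h ` K))" by (simp add: bounded_imp_bdd_above compact_imp_bounded)
    moreover have "range h \<subseteq> insert 0 (h ` K)" using h(2) by blast
    ultimately show ?thesis by (rule bdd_above_mono)
  qed
  have \<eta>c: "continuous_on UNIV \<eta>"
    using D by (auto intro!: continuous_at_imp_continuous_on has_derivative_continuous)
  have b1: "bdd_above (range (\<lambda>x. cmod (\<eta> x)))"
    using \<eta>c K(2) closure_subset[of "{x. \<eta> x \<noteq> 0}"] by (intro bdd continuous_on_norm) auto
  have b2: "bdd_above (range (\<lambda>x. norm (D x)))"
    using Dc D0 K(2) by (intro bdd continuous_on_norm) auto
  have l1: "cmod (\<eta> x) \<le> (SUP x. cmod (\<eta> x))" for x using b1 by (rule cSUP_upper[OF UNIV_I])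
  have l2: "norm (D x) \<le> (SUP x. norm (D x))" for x using b2 by (rule cSUP_upper[OF UNIV_I])
  have e: "C1_norm \<eta> = (SUP x. cmod (\<eta> x)) + (SUP x. norm (D x))" by (simp add: C1_norm_def on)
  have n1: "0 \<le> (SUP x. cmod (\<eta> x))" using order_trans[OF norm_ge_zero l1] .
  have n2: "0 \<le> (SUP x. norm (D x))" using order_trans[OF norm_ge_zero l2] .
  show "0 \<le> C1_norm \<eta>" "cmod (\<eta> x) \<le> C1_norm \<eta>" using l1[of x] n1 n2 unfolding e by linarith+
  have "norm (\<eta> x - \<eta> y) \<le> C1_norm \<eta> * norm (x - y)"
  proof (rule differentiable_bound[of UNIV \<eta> "\<lambda>x. blinfun_apply (D x)"])
    show "onorm (blinfun_apply (D x)) \<le> C1_norm \<eta>" for x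
      using l2[of x] n1 unfolding e norm_blinfun.rep_eq[symmetric] by linarith
  qed (use D in auto)
  then show "cmod (\<eta> x - \<eta> y) \<le> C1_norm \<eta> * dist x y" by (simp add: dist_norm)
qed

section \<open>Decay in the frequency\<close>

lemma decay_uniform:
  fixes ws :: "'a::euclidean_space list"
  assumes "decay ws d R (norm x)" "c > 0"
  shows "\<exists>\<epsilon>>0. \<exists>C\<ge>0. \<forall>l P F \<eta>. poly_fun d P \<longrightarrow> inv_prod ws F \<longrightarrow> amplitude R \<eta> \<longrightarrow>
    c \<le> \<bar>dirderivs ws P x\<bar> \<longrightarrow> cmod (osc (\<lambda>x. l * P x) F \<eta>) \<le> C * (1 + \<bar>l\<bar>) powr (- \<epsilon>)"
proof -
  obtain \<epsilon> C where \<epsilon>: "\<epsilon> > 0" and C: "C \<ge> 0" and dec: "\<And>P F \<eta> A. poly_fun d P \<Longrightarrow> inv_prod ws F \<Longrightarrow>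
      amplitude R \<eta> \<Longrightarrow> 0 < A \<Longrightarrow> A \<le> \<bar>dirderivs ws P x\<bar> \<Longrightarrow> cmod (osc P F \<eta>) \<le> C * A powr (- \<epsilon>)"
    using assms(1) unfolding decay_def by blast
  define V where "V = vol_cball TYPE('a) R"
  have V: "V \<ge> 0" by (simp add: V_def)
  define D where "D = (V + C * c powr (- \<epsilon>)) * 2 powr \<epsilon>"
  have D: "D \<ge> 0" using V C by (simp add: D_def)
  have "cmod (osc (\<lambda>x. l * P x) F \<eta>) \<le> D * (1 + \<bar>l\<bar>) powr (- \<epsilon>)"
    if P: "poly_fun d P" and F: "inv_prod ws F" and \<eta>: "amplitude R \<eta>" and low: "c \<le> \<bar>dirderivs ws P x\<bar>"
    for l P F \<eta>
  proof -
    have lP: "poly_fun d (\<lambda>x. l * P x)" by (rule poly_fun_cmult[OF P])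
    \<comment> \<open>Applied with y = \<bar>l\<bar> when \<bar>l\<bar> is at least 1, and otherwise
      with y = 1, where the volume bound suffices.\<close>
    have half: "y powr (- \<epsilon>) \<le> 2 powr \<epsilon> * (1 + \<bar>l\<bar>) powr (- \<epsilon>)" if "(1 + \<bar>l\<bar>) / 2 \<le> y" for y
    proof -
      have "y powr (- \<epsilon>) \<le> ((1 + \<bar>l\<bar>) / 2) powr (- \<epsilon>)" using that \<epsilon> by (intro powr_mono2') auto
      also have "\<dots> = 2 powr \<epsilon> * (1 + \<bar>l\<bar>) powr (- \<epsilon>)" by (simp add: powr_divide powr_minus field_simps)
      finally show ?thesis .
    qed
    have "cmod (osc (\<lambda>x. l * P x) F \<eta>) \<le> (V + C * c powr (- \<epsilon>)) * (2 powr \<epsilon> * (1 + \<bar>l\<bar>) powr (- \<epsilon>))"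
    proof (cases "\<bar>l\<bar> \<ge> 1")
      case True
      have "0 < \<bar>l\<bar> * c" using True assms(2) by simp
      moreover have "\<bar>l\<bar> * c \<le> \<bar>dirderivs ws (\<lambda>x. l * P x) x\<bar>"
        using low by (simp add: dirderivs_cmult[OF P] abs_mult mult_left_mono)
      ultimately have "cmod (osc (\<lambda>x. l * P x) F \<eta>) \<le> C * (\<bar>l\<bar> * c) powr (- \<epsilon>)"
        by (rule dec[OF lP F \<eta>])
      also have "\<dots> = C * c powr (- \<epsilon>) * \<bar>l\<bar> powr (- \<epsilon>)" using assms(2) by (simp add: powr_mult)
      also have "\<dots> \<le> (V + C * c powr (- \<epsilon>)) * (2 powr \<epsilon> * (1 + \<bar>l\<bar>) powr (- \<epsilon>))"
        using V C half[of "\<bar>l\<bar>"] True by (intro mult_mono) auto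
      finally show ?thesis .
    next
      case False
      have "cmod (osc (\<lambda>x. l * P x) F \<eta>) \<le> V * 1"
        using osc_le_vol[OF poly_fun_measurable[OF lP] F \<eta>] by (simp add: V_def)
      also have "\<dots> \<le> (V + C * c powr (- \<epsilon>)) * (2 powr \<epsilon> * (1 + \<bar>l\<bar>) powr (- \<epsilon>))"
        using V C half[of 1] False by (intro mult_mono) auto
      finally show ?thesis .
    qed
    then show ?thesis by (simp add: D_def mult.assoc)
  qed
  then show ?thesis using \<epsilon> D by blast
qed

lemma decay_uniform_finite:
  fixes S :: "('a::euclidean_space \<times> 'a list) set"
  assumes "finite S" "\<And>x ws. (x, ws) \<in> S \<Longrightarrow> ws \<noteq> []" "c > 0"
  shows "\<exists>\<epsilon>>0. \<exists>C\<ge>0. \<forall>x ws l P F \<eta>. (x, ws) \<in> S \<longrightarrow> poly_fun d P \<longrightarrow> inv_prod ws F \<longrightarrow> amplitude R \<eta> \<longrightarrow>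
    c \<le> \<bar>dirderivs ws P x\<bar> \<longrightarrow> cmod (osc (\<lambda>x. l * P x) F \<eta>) \<le> C * (1 + \<bar>l\<bar>) powr (- \<epsilon>)"
  using assms(1,2)
proof (induction S rule: finite_induct)
  case empty
  then show ?case by (intro exI[of _ 1] conjI exI[of _ 0]) auto
next
  case (insert s S)
  obtain x0 ws0 where s: "s = (x0, ws0)" by (cases s)
  have "ws0 \<noteq> []" using insert.prems s by blast
  then obtain \<epsilon>1 C1 where 1: "\<epsilon>1 > 0" "C1 \<ge> 0" "\<And>l P F \<eta>. poly_fun d P \<Longrightarrow> inv_prod ws0 F \<Longrightarrow> amplitude R \<eta> \<Longrightarrow>
      c \<le> \<bar>dirderivs ws0 P x0\<bar> \<Longrightarrow> cmod (osc (\<lambda>x. l * P x) F \<eta>) \<le> C1 * (1 + \<bar>l\<bar>) powr (- \<epsilon>1)"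
    using decay_uniform[OF decay_nonempty assms(3)] by metis
  obtain \<epsilon>2 C2 where 2: "\<epsilon>2 > 0" "C2 \<ge> 0" "\<And>x ws l P F \<eta>. (x, ws) \<in> S \<Longrightarrow> poly_fun d P \<Longrightarrow> inv_prod ws F \<Longrightarrow>
      amplitude R \<eta> \<Longrightarrow> c \<le> \<bar>dirderivs ws P x\<bar> \<Longrightarrow> cmod (osc (\<lambda>x. l * P x) F \<eta>) \<le> C2 * (1 + \<bar>l\<bar>) powr (- \<epsilon>2)"
    using insert.IH insert.prems by (metis insertI2)
  have "C1 * (1 + \<bar>l\<bar>) powr (- \<epsilon>1) \<le> (C1 + C2) * (1 + \<bar>l\<bar>) powr (- min \<epsilon>1 \<epsilon>2)"
    "C2 * (1 + \<bar>l\<bar>) powr (- \<epsilon>2) \<le> (C1 + C2) * (1 + \<bar>l\<bar>) powr (- min \<epsilon>1 \<epsilon>2)" for l :: real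
    using 1 2 by (auto intro!: mult_mono powr_mono)
  then have "cmod (osc (\<lambda>x. l * P x) F \<eta>) \<le> (C1 + C2) * (1 + \<bar>l\<bar>) powr (- min \<epsilon>1 \<epsilon>2)"
    if "(x, ws) \<in> insert s S" "poly_fun d P" "inv_prod ws F" "amplitude R \<eta>" "c \<le> \<bar>dirderivs ws P x\<bar>"
    for x ws l P F \<eta>
    using that 1(3)[of P F \<eta> l] 2(3)[of x ws P F \<eta> l] s by (fastforce intro: order_trans)
  then show ?case using 1 2 by (intro exI[of _ "min \<epsilon>1 \<epsilon>2"] conjI exI[of _ "C1 + C2"]) auto
qed

text \<open>Hyperplanes may repeat, so several indices can share a direction, and for n = 0 a
  direction has no index at all. The factors are grouped by direction; an empty group is the
  constant 1.\<close>

lemma inv_prod_prod: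
  fixes G :: "nat \<Rightarrow> 'a::euclidean_space \<Rightarrow> complex"
  assumes "finite J" "w ` J \<subseteq> set ws" "distinct ws"
    and "\<And>j. j \<in> J \<Longrightarrow> G j \<in> borel_measurable borel" "\<And>j x. j \<in> J \<Longrightarrow> cmod (G j x) \<le> 1"
    and "\<And>j. j \<in> J \<Longrightarrow> invariant_along (w j) (G j)"
  shows "inv_prod ws (\<lambda>x. \<Prod>j\<in>J. G j x)"
  using assms
proof (induction ws arbitrary: J)
  case Nil
  then show ?case using inv_prod.Nil by simp
next
  case (Cons v ws J)
  let ?J1 = "{j\<in>J. w j = v}" and ?J2 = "{j\<in>J. w j \<noteq> v}"
  have "inv_prod ws (\<lambda>x. \<Prod>j\<in>?J2. G j x)"
    using Cons.prems by (intro Cons.IH) auto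
  then have "inv_prod (v # ws) (\<lambda>x. (\<Prod>j\<in>?J1. G j x) * (\<Prod>j\<in>?J2. G j x))"
  proof (rule inv_prod.Cons)
    show "(\<lambda>x. \<Prod>j\<in>?J1. G j x) \<in> borel_measurable borel"
      using Cons.prems by (intro borel_measurable_prod) auto
    show "cmod (\<Prod>j\<in>?J1. G j x) \<le> 1" for x
      unfolding prod_norm[symmetric] using Cons.prems by (intro prod_le_1) auto
    show "invariant_along v (\<lambda>x. \<Prod>j\<in>?J1. G j x)"
      using Cons.prems(6) unfolding invariant_along_def by (auto intro!: prod.cong)
  qed
  moreover have "(\<Prod>j\<in>?J1. G j x) * (\<Prod>j\<in>?J2. G j x) = (\<Prod>j\<in>J. G j x)" for x
    using Cons.prems(1) by (subst prod.union_disjoint[symmetric]) (auto intro!: prod.cong)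
  ultimately show ?case by simp
qed

section \<open>The relative norm\<close>

text \<open>A real infimum is a lower bound only for sets bounded below. Here this follows from
  nonnegativity of N, which is known only on polynomials of degree at most d; so the functions
  composed with the projections must first be recognised as such.\<close>

lemma relative_norm_le:
  assumes N: "is_norm_on (polys d) N" and P: "poly_fun d P" and n: "n \<noteq> 0"
    and V: "\<And>j. j \<in> {1..n} \<Longrightarrow> subspace (V j)"
    and p: "\<And>j. j \<in> {1..n} \<Longrightarrow> p j \<in> polys_on (V j) d"
  shows "relative_norm N d n V P \<le> N (\<lambda>x. P x - (\<Sum>j=1..n. p j (orth_proj (V j) x)))"
proof -
  have proj: "poly_fun d (\<lambda>x. q (orth_proj (V j) x))" if j: "j \<in> {1..n}" and q: "q \<in> polys_on (V j) d" for j q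
  proof -
    obtain q' where q': "q' \<in> polys_in (onb (V j)) d" "\<forall>v\<in>V j. q v = q' v"
      using q unfolding polys_on_def by blast
    have "poly_fun d q'" by (rule polys_in_imp_poly_fun[OF onb_finite[OF V[OF j]] q'(1)])
    from poly_fun_linear[OF this linear_orth_proj[OF V[OF j]]] show ?thesis
      using q'(2) orth_proj(1)[OF V[OF j]] by simp
  qed
  have "0 \<le> N (\<lambda>x. P x - (\<Sum>j=1..n. p j (orth_proj (V j) x)))"
    if "\<forall>j\<in>{1..n}. p j \<in> polys_on (V j) d" for p
  proof -
    have "poly_fun d (\<lambda>x. P x - (\<Sum>j=1..n. p j (orth_proj (V j) x)))"
      using that by (intro poly_fun_diff[OF P] poly_fun_sum proj) auto
    then show ?thesis using N unfolding is_norm_on_def polys_iff_poly_fun[symmetric] by blast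
  qed
  then have "bdd_below ((\<lambda>p. N (\<lambda>x. P x - (\<Sum>j=1..n. p j (orth_proj (V j) x)))) ` {p. \<forall>j\<in>{1..n}. p j \<in> polys_on (V j) d})"
    by (intro bdd_belowI[of _ 0]) auto
  then have "(INF p\<in>{p. \<forall>j\<in>{1..n}. p j \<in> polys_on (V j) d}. N (\<lambda>x. P x - (\<Sum>j=1..n. p j (orth_proj (V j) x))))
      \<le> N (\<lambda>x. P x - (\<Sum>j=1..n. p j (orth_proj (V j) x)))"
    by (rule cINF_lower) (use p in auto)
  then show ?thesis using n by (simp add: relative_norm_def)
qed

lemma relative_norm_0_le:
  assumes "is_norm_on (polys d) N" "poly_fun d P"
  shows "relative_norm N d 0 V P \<le> N (\<lambda>x. P x - a)"
proof -
  have "0 \<le> N (\<lambda>x. P x - a)" for a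
    using assms(1) poly_fun_diff[OF assms(2) poly_fun.const, of a]
    unfolding is_norm_on_def polys_iff_poly_fun[symmetric] by blast
  then have "bdd_below (range (\<lambda>a. N (\<lambda>x. P x - a)))" by (intro bdd_belowI[of _ 0]) auto
  from cINF_lower[OF this UNIV_I] show ?thesis by (simp add: relative_norm_def)
qed

lemma hyperplane_normals_not_parallel:
  assumes "norm w = 1" "norm v = 1" "{x. x \<bullet> w = 0} \<noteq> {x. x \<bullet> v = 0}"
  shows "w \<notin> span {v}"
proof
  assume "w \<in> span {v}"
  then obtain c where c: "w = c *\<^sub>R v" by (auto simp: span_singleton)
  then have "c \<noteq> 0" using assms(1) by auto
  then show False using assms(3) by (simp add: c)
qed

text \<open>
  For \<open>n = 0\<close> one direction does not suffice to detect nonconstant polynomials, which is why the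
  list of directions may depend on the node.
\<close>

lemma relative_norm_nodes:
  fixes V :: "nat \<Rightarrow> 'a::euclidean_space set"
  assumes N: "is_norm_on (polys d) N" and c: "c > 0"
    and w: "\<And>j. j \<in> {1..n} \<Longrightarrow> norm (w j) = 1 \<and> V j = {x. x \<bullet> w j = 0}"
    and wV: "\<And>i j. V i = V j \<Longrightarrow> w i = w j"
  shows "\<exists>S c'. finite S \<and> c' > 0 \<and>
    (\<forall>(x, ws)\<in>S. ws \<noteq> [] \<and> distinct ws \<and> w ` {1..n} \<subseteq> set ws) \<and>
    (\<forall>P. poly_fun d P \<longrightarrow> c \<le> relative_norm N d n V P \<longrightarrow> (\<exists>(x, ws)\<in>S. c' \<le> \<bar>dirderivs ws P x\<bar>))"
proof (cases "n = 0")
  case True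
  \<comment> \<open>All directional derivatives together form one operator whose argument is a point
    with a direction. Its kernel is the constants, and its nodes select the directions.\<close>
  let ?T = "\<lambda>p (x, b). dirderiv b p x :: real"
  have "\<exists>S c'. finite S \<and> c' > 0 \<and> (\<forall>p. poly_fun d p \<longrightarrow>
    (\<forall>r. poly_fun d r \<longrightarrow> ?T r = ?T p \<longrightarrow> c \<le> N r) \<longrightarrow> (\<exists>s\<in>S. c' \<le> \<bar>?T p s\<bar>))"
    by (rule distance_to_kernel[OF _ _ N c]) (simp_all add: dirderiv_add dirderiv_cmult split_def)
  then obtain S :: "('a \<times> 'a) set" and c' where S: "finite S" "c' > 0" and
    far: "\<And>p. poly_fun d p \<Longrightarrow> (\<And>r. poly_fun d r \<Longrightarrow> ?T r = ?T p \<Longrightarrow> c \<le> N r) \<Longrightarrow> \<exists>s\<in>S. c' \<le> \<bar>?T p s\<bar>"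
    by blast
  have "\<exists>s\<in>S. c' \<le> \<bar>?T P s\<bar>" if P: "poly_fun d P" and low: "c \<le> relative_norm N d n V P" for P
  proof (rule far[OF P])
    fix r assume r: "poly_fun d r" "?T r = ?T P"
    have "dirderiv b (\<lambda>x. P x - r x) = (\<lambda>x. 0)" for b
      using fun_cong[OF r(2), of "(_, b)"] dirderiv_diff[OF P r(1)] by simp
    from dirderiv_zero_imp_invariant[OF poly_fun_diff[OF P r(1)] this]
    have "P (0 + 1 *\<^sub>R x) - r (0 + 1 *\<^sub>R x) = P 0 - r 0" for x
      unfolding invariant_along_def by blast
    then have "r = (\<lambda>x. P x - (P 0 - r 0))" by (auto simp: fun_eq_iff algebra_simps)
    then have "relative_norm N d n V P \<le> N r" using relative_norm_0_le[OF N P, of V "P 0 - r 0"] True by simp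
    then show "c \<le> N r" using low by simp
  qed
  note key = this
  let ?S = "(\<lambda>(x, b). (x, [b])) ` S"
  have "\<exists>(x, ws)\<in>?S. c' \<le> \<bar>dirderivs ws P x\<bar>" if P: "poly_fun d P" "c \<le> relative_norm N d n V P" for P
  proof -
    obtain x b where "(x, b) \<in> S" "c' \<le> \<bar>dirderiv b P x\<bar>" using key[OF P] by auto
    then show ?thesis by (intro bexI[of _ "(x, [b])"]) auto
  qed
  moreover have "\<forall>(x, ws)\<in>?S. ws \<noteq> [] \<and> distinct ws \<and> w ` {1..n} \<subseteq> set ws" using True by auto
  ultimately show ?thesis using S by (intro exI[of _ ?S] exI[of _ c']) simp
next
  case False
  obtain ws where ws: "set ws = w ` {1..n}" "distinct ws"
    using finite_distinct_list[of "w ` {1..n}"] by auto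
  have ws0: "ws \<noteq> []" using ws(1) False by auto
  have sV: "subspace (V j)" if "j \<in> {1..n}" for j
    using w[OF that] subspace_hyperplane2[of "w j"] by simp
  have np: "pairwise (\<lambda>w v. w \<notin> span {v}) (set ws)"
  proof (rule pairwiseI)
    fix u v assume uv: "u \<in> set ws" "v \<in> set ws" "u \<noteq> v"
    then obtain i j where ij: "i \<in> {1..n}" "j \<in> {1..n}" "u = w i" "v = w j" unfolding ws(1) by blast
    then have "V i \<noteq> V j" using wV uv(3) by blast
    then show "u \<notin> span {v}" using w[OF ij(1)] w[OF ij(2)] ij(3,4)
      by (intro hyperplane_normals_not_parallel) auto
  qed
  have "\<exists>S c'. finite S \<and> c' > 0 \<and> (\<forall>p. poly_fun d p \<longrightarrow>
    (\<forall>r. poly_fun d r \<longrightarrow> dirderivs ws r = dirderivs ws p \<longrightarrow> c \<le> N r) \<longrightarrow> (\<exists>s\<in>S. c' \<le> \<bar>dirderivs ws p s\<bar>))"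
    by (rule distance_to_kernel[OF _ _ N c]) (simp_all add: dirderivs_add dirderivs_cmult)
  then obtain S :: "'a set" and c' where S: "finite S" "c' > 0" and
    far: "\<And>p. poly_fun d p \<Longrightarrow> (\<And>r. poly_fun d r \<Longrightarrow> dirderivs ws r = dirderivs ws p \<Longrightarrow> c \<le> N r) \<Longrightarrow>
      \<exists>s\<in>S. c' \<le> \<bar>dirderivs ws p s\<bar>"
    by blast
  have "\<exists>s\<in>S. c' \<le> \<bar>dirderivs ws P s\<bar>" if P: "poly_fun d P" and low: "c \<le> relative_norm N d n V P" for P
  proof (rule far[OF P])
    fix r assume r: "poly_fun d r" "dirderivs ws r = dirderivs ws P"
    have "dirderivs ws (\<lambda>x. P x - r x) = (\<lambda>x. 0)" using dirderivs_diff[OF P r(1)] r(2) by simp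
    from dirderivs_kernel[OF poly_fun_diff[OF P r(1)] this ws(2) np]
    obtain q where q: "\<And>v. v \<in> set ws \<Longrightarrow> poly_fun d (q v) \<and> invariant_along v (q v)"
      "(\<lambda>x. P x - r x) = (\<lambda>x. \<Sum>v\<in>set ws. q v x)" by blast
    \<comment> \<open>Several indices may have the same normal. \<open>inv_into\<close> picks one of
      them to carry the component q; the others receive 0.\<close>
    let ?J = "inv_into {1..n} w ` set ws"
    let ?p = "\<lambda>j. if j \<in> ?J then q (w j) else (\<lambda>x. 0)"
    have J: "?J \<subseteq> {1..n}" unfolding ws(1) by (auto intro: inv_into_into)
    have qproj: "q (w j) (orth_proj (V j) x) = q (w j) x" if j: "j \<in> {1..n}" for j x
    proof -
      have "orth_proj (V j) x = x + (- (x \<bullet> w j)) *\<^sub>R w j"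
        using orth_proj_hyperplane[of "w j" "V j" x] w[OF j] by simp
      moreover have "invariant_along (w j) (q (w j))" using q(1) j ws(1) by blast
      ultimately show ?thesis unfolding invariant_along_def by metis
    qed
    have "(\<Sum>j=1..n. ?p j (orth_proj (V j) x)) = (\<Sum>v\<in>set ws. q v x)" for x
    proof -
      have "(\<Sum>j=1..n. ?p j (orth_proj (V j) x)) = (\<Sum>j=1..n. if j \<in> ?J then q (w j) x else 0)"
        using qproj by (intro sum.cong) auto
      also have "\<dots> = (\<Sum>j\<in>?J. q (w j) x)"
        using J by (simp add: sum.inter_restrict[symmetric] Int_absorb1)
      also have "\<dots> = (\<Sum>v\<in>set ws. q (w (inv_into {1..n} w v)) x)"
        unfolding ws(1) by (rule sum.reindex[OF inj_on_inv_into[OF order_refl], unfolded o_def])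
      also have "\<dots> = (\<Sum>v\<in>set ws. q v x)"
        unfolding ws(1) by (intro sum.cong) (auto simp: f_inv_into_f)
      finally show ?thesis .
    qed
    then have eq: "(\<lambda>x. P x - (\<Sum>j=1..n. ?p j (orth_proj (V j) x))) = r"
      using fun_cong[OF q(2)] by (auto simp: fun_eq_iff algebra_simps)
    have mem: "?p j \<in> polys_on (V j) d" if j: "j \<in> {1..n}" for j
    proof (rule poly_fun_imp_polys_on[OF sV[OF j]])
      show "poly_fun d (?p j)" using q(1) j ws(1) poly_fun.const[of d 0] by auto
    qed
    have "relative_norm N d n V P \<le> N (\<lambda>x. P x - (\<Sum>j=1..n. ?p j (orth_proj (V j) x)))"
      by (rule relative_norm_le[OF N P False]) (fact sV mem)+
    then have "relative_norm N d n V P \<le> N r" unfolding eq .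
    then show "c \<le> N r" using low by simp
  qed
  note key = this
  let ?S = "(\<lambda>x. (x, ws)) ` S"
  have "\<exists>(x, ws)\<in>?S. c' \<le> \<bar>dirderivs ws P x\<bar>" if P: "poly_fun d P" "c \<le> relative_norm N d n V P" for P
    using key[OF P] by auto
  moreover have "\<forall>(x, ws)\<in>?S. ws \<noteq> [] \<and> distinct ws \<and> w ` {1..n} \<subseteq> set ws" using ws ws0 by auto
  ultimately show ?thesis using S by (intro exI[of _ ?S] exI[of _ c']) simp
qed

section \<open>The main theorem\<close>

lemma uniform_power_decay_hyperplanes:
  fixes V :: "nat \<Rightarrow> 'a::euclidean_space set"
  assumes N: "\<And>d. is_norm_on (polys d) (N d)"
    and V: "\<And>j. j \<in> {1..n} \<Longrightarrow> subspace (V j) \<and> dim (V j) + 1 = DIM('a)"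
  shows "uniform_power_decay N n V"
proof -
  \<comment> \<open>The choice depends on V j alone, so equal hyperplanes get the same normal and
    never opposite ones.\<close>
  define w where "w j = (SOME w. norm w = 1 \<and> V j = {x. x \<bullet> w = 0})" for j
  have w: "norm (w j) = 1 \<and> V j = {x. x \<bullet> w j = 0}" if "j \<in> {1..n}" for j
    unfolding w_def by (rule someI_ex) (use hyperplane_normal_exists V[OF that] in blast)
  have wV: "w i = w j" if "V i = V j" for i j by (simp add: w_def that)
  show ?thesis unfolding uniform_power_decay_def
  proof (intro allI impI)
    fix d :: nat and c :: real and K :: "'a set"
    assume c: "0 < c" and K: "compact K"
    obtain R where R: "\<And>x. x \<in> K \<Longrightarrow> norm x \<le> R"
      using compact_imp_bounded[OF K] by (auto simp: bounded_iff)
    have "\<exists>S c'. finite S \<and> c' > 0 \<and>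
      (\<forall>(x, ws)\<in>S. ws \<noteq> [] \<and> distinct ws \<and> w ` {1..n} \<subseteq> set ws) \<and>
      (\<forall>P. poly_fun d P \<longrightarrow> c \<le> relative_norm (N d) d n V P \<longrightarrow> (\<exists>(x, ws)\<in>S. c' \<le> \<bar>dirderivs ws P x\<bar>))"
      by (rule relative_norm_nodes[OF N c]) (fact w wV)+
    then obtain S c' where *: "finite S" "c' > 0" "\<forall>(x, ws)\<in>S. ws \<noteq> [] \<and> distinct ws \<and> w ` {1..n} \<subseteq> set ws"
      "\<forall>P. poly_fun d P \<longrightarrow> c \<le> relative_norm (N d) d n V P \<longrightarrow> (\<exists>(x, ws)\<in>S. c' \<le> \<bar>dirderivs ws P x\<bar>)"
      by (elim exE conjE)
    have S: "finite S" "c' > 0" "\<And>x ws. (x, ws) \<in> S \<Longrightarrow> ws \<noteq> []"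
      "\<And>x ws. (x, ws) \<in> S \<Longrightarrow> distinct ws" "\<And>x ws. (x, ws) \<in> S \<Longrightarrow> w ` {1..n} \<subseteq> set ws"
      by (fact *(1), fact *(2), (use bspec[OF *(3)] in force)+)
    have nodes: "\<exists>(x, ws)\<in>S. c' \<le> \<bar>dirderivs ws P x\<bar>"
      if "poly_fun d P" "c \<le> relative_norm (N d) d n V P" for P
      using *(4) that by blast
    have "\<exists>\<epsilon>>0. \<exists>C\<ge>0. \<forall>x ws l P F \<eta>. (x, ws) \<in> S \<longrightarrow> poly_fun d P \<longrightarrow> inv_prod ws F \<longrightarrow>
        amplitude R \<eta> \<longrightarrow> c' \<le> \<bar>dirderivs ws P x\<bar> \<longrightarrow>
        cmod (osc (\<lambda>x. l * P x) F \<eta>) \<le> C * (1 + \<bar>l\<bar>) powr (- \<epsilon>)"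
      by (rule decay_uniform_finite) (fact S)+
    then obtain \<epsilon> C where \<epsilon>: "\<epsilon> > 0" and C: "C \<ge> 0" and
      dec: "\<And>x ws l P F \<eta>. (x, ws) \<in> S \<Longrightarrow> poly_fun d P \<Longrightarrow> inv_prod ws F \<Longrightarrow> amplitude R \<eta> \<Longrightarrow>
        c' \<le> \<bar>dirderivs ws P x\<bar> \<Longrightarrow> cmod (osc (\<lambda>x. l * P x) F \<eta>) \<le> C * (1 + \<bar>l\<bar>) powr (- \<epsilon>)"
      by blast
    have "cmod (osc_form n V P \<eta> l f)
        \<le> C * C1_norm \<eta> * (1 + \<bar>l\<bar>) powr (- \<epsilon>) * (\<Prod>j=1..n. enn2real (Linf_norm (V j) (f j)))"
      if f: "\<forall>j\<in>{1..n}. f j \<in> Linf (V j)" and \<eta>: "C1 \<eta>" "closure {x. \<eta> x \<noteq> 0} \<subseteq> K"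
        and P: "P \<in> polys d" and low: "c \<le> relative_norm (N d) d n V P" for l f \<eta> P
    proof -
      have Pp: "poly_fun d P" using P by (simp add: polys_iff_poly_fun)
      let ?M = "\<lambda>j. enn2real (Linf_norm (V j) (f j))"
      note \<eta>b = C1_norm_bounds[OF \<eta>(1) K \<eta>(2)]
      have "\<forall>j\<in>{1..n}. \<exists>g. g \<in> borel_measurable borel \<and> invariant_along (w j) g \<and>
          (\<forall>x. cmod (g x) \<le> ?M j) \<and> (AE x in lebesgue. f j (orth_proj (V j) x) = g x)"
      proof
        fix j assume j: "j \<in> {1..n}"
        then have "f j \<in> Linf (V j)" using f by blast
        from Linf_borel_representative(2)[OF conjunct1[OF w[OF j]] conjunct2[OF w[OF j]] this]
        show "\<exists>g. g \<in> borel_measurable borel \<and> invariant_along (w j) g \<and>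
          (\<forall>x. cmod (g x) \<le> ?M j) \<and> (AE x in lebesgue. f j (orth_proj (V j) x) = g x)"
          by (elim bexE) (intro exI conjI; assumption | blast)
      qed
      from bchoice[OF this] obtain g where g: "\<And>j. j \<in> {1..n} \<Longrightarrow> g j \<in> borel_measurable borel"
        "\<And>j. j \<in> {1..n} \<Longrightarrow> invariant_along (w j) (g j)"
        "\<And>j x. j \<in> {1..n} \<Longrightarrow> cmod (g j x) \<le> ?M j"
        "\<And>j. j \<in> {1..n} \<Longrightarrow> AE x in lebesgue. f j (orth_proj (V j) x) = g j x" by blast
      have \<eta>c: "continuous_on UNIV \<eta>"
      proof -
        have "(C1_norm \<eta>)-lipschitz_on UNIV \<eta>" using \<eta>b by (auto simp: lipschitz_on_def dist_norm)
        then show ?thesis by (rule lipschitz_on_continuous_on)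
      qed
      have [measurable]: "\<eta> \<in> borel_measurable borel" "P \<in> borel_measurable borel"
        using \<eta>c poly_fun_measurable[OF Pp] by (auto intro: borel_measurable_continuous_onI)
      have [measurable]: "(\<lambda>x. cis (l * P x)) \<in> borel_measurable borel" by (rule cis_measurable) measurable
      have gm: "(\<lambda>x. cis (l * P x) * (\<Prod>j=1..n. g j x) * \<eta> x) \<in> borel_measurable borel"
        using g(1) by (intro borel_measurable_times borel_measurable_prod) auto
      have "osc_form n V P \<eta> l f = (\<integral>x. cis (l * P x) * (\<Prod>j=1..n. g j x) * \<eta> x \<partial>lebesgue)"
        unfolding osc_form_def cis_conv_exp[symmetric]
      proof (rule integral_cong_AE)
        have "(\<lambda>x. f j (orth_proj (V j) x)) \<in> borel_measurable lebesgue" if "j \<in> {1..n}" for j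
          using Linf_borel_representative(1) w f that by blast
        moreover have "(\<lambda>x. cis (l * P x)) \<in> borel_measurable lebesgue" "\<eta> \<in> borel_measurable lebesgue"
          by (rule measurable_completion, simp)+
        ultimately show "(\<lambda>x. cis (l * P x) * (\<Prod>j=1..n. f j (orth_proj (V j) x)) * \<eta> x) \<in> borel_measurable lebesgue"
          by (intro borel_measurable_times borel_measurable_prod) auto
        show "(\<lambda>x. cis (l * P x) * (\<Prod>j=1..n. g j x) * \<eta> x) \<in> borel_measurable lebesgue"
          using gm by (intro measurable_completion) simp
        have "AE x in lebesgue. \<forall>j\<in>{1..n}. f j (orth_proj (V j) x) = g j x"
          using g(4) by (intro AE_finite_allI) auto
        then show "AE x in lebesgue. cis (l * P x) * (\<Prod>j=1..n. f j (orth_proj (V j) x)) * \<eta> x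
            = cis (l * P x) * (\<Prod>j=1..n. g j x) * \<eta> x"
          by eventually_elim (auto intro!: prod.cong)
      qed
      also have "\<dots> = (\<integral>x. cis (l * P x) * (\<Prod>j=1..n. g j x) * \<eta> x \<partial>lborel)"
        using gm by (intro integral_completion) simp
      finally have form: "osc_form n V P \<eta> l f = (\<integral>x. cis (l * P x) * (\<Prod>j=1..n. g j x) * \<eta> x \<partial>lborel)" .
      show ?thesis
      \<comment> \<open>If a norm vanishes, normalising is impossible, but then the integrand is
        identically 0, since the bounds on \<eta> and on the representatives hold
        everywhere.\<close>
      proof (cases "C1_norm \<eta> = 0 \<or> (\<exists>j\<in>{1..n}. ?M j = 0)")
        case True
        have "cis (l * P x) * (\<Prod>j=1..n. g j x) * \<eta> x = 0" for x
        proof (cases "C1_norm \<eta> = 0")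
          case False
          then obtain j where "j \<in> {1..n}" "?M j = 0" using True by blast
          then have "g j x = 0" using g(3)[of j x] by simp
          then have "(\<Prod>j=1..n. g j x) = 0" using \<open>j \<in> {1..n}\<close> by (intro prod_zero) auto
          then show ?thesis by simp
        qed (use \<eta>b(2)[of x] in simp)
        then have "osc_form n V P \<eta> l f = 0" unfolding form by (simp only: integral_zero)
        moreover have "0 \<le> C * C1_norm \<eta> * (1 + \<bar>l\<bar>) powr (- \<epsilon>) * (\<Prod>j=1..n. ?M j)"
          using C \<eta>b(1) by (intro mult_nonneg_nonneg prod_nonneg) auto
        ultimately show ?thesis by simp
      next
        case False
        then have M: "?M j > 0" if "j \<in> {1..n}" for j
          using that enn2real_nonneg[of "Linf_norm (V j) (f j)"] by (metis less_eq_real_def)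
        let ?E = "C1_norm \<eta>"
        have E: "?E > 0" using False \<eta>b(1) by linarith
        let ?G = "\<lambda>j x. g j x / of_real (?M j)" and ?\<eta> = "\<lambda>x. \<eta> x / of_real ?E"
        have amp: "amplitude R ?\<eta>" unfolding amplitude_def
        proof (intro conjI allI impI)
          fix x y :: 'a
          show "?\<eta> x = 0" if "R < norm x"
          proof -
            have "x \<notin> K" using R[of x] that by auto
            then show ?thesis using \<eta>(2) closure_subset[of "{x. \<eta> x \<noteq> 0}"] by auto
          qed
          show "cmod (?\<eta> x) \<le> 1" using \<eta>b(2)[of x] E by (simp add: norm_divide)
          have "cmod (\<eta> x - \<eta> y) / ?E \<le> dist x y" using \<eta>b(3)[of x y] E by (simp add: pos_divide_le_eq mult.commute)
          then show "cmod (?\<eta> x - ?\<eta> y) \<le> dist x y"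
            using E by (simp add: diff_divide_distrib[symmetric] norm_divide)
        qed
        \<comment> \<open>The node and its list of directions depend on P; the constants in
          \<open>dec\<close> do not.\<close>
        obtain x ws where x: "(x, ws) \<in> S" "c' \<le> \<bar>dirderivs ws P x\<bar>" using nodes[OF Pp low] by blast
        have inv: "inv_prod ws (\<lambda>x. \<Prod>j=1..n. ?G j x)"
        proof (rule inv_prod_prod[OF _ S(5)[OF x(1)] S(4)[OF x(1)]])
          fix j assume j: "j \<in> {1..n}"
          show "?G j \<in> borel_measurable borel" using g(1)[OF j] by measurable
          show "cmod (?G j x) \<le> 1" for x using g(3)[OF j, of x] M[OF j] by (simp add: norm_divide)
          show "invariant_along (w j) (?G j)" using g(2)[OF j] by (simp add: invariant_along_def)
        qed simp
        have "cis (l * P x) * (\<Prod>j=1..n. g j x) * \<eta> x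
          = of_real (?E * (\<Prod>j=1..n. ?M j)) * (cis (l * P x) * (\<Prod>j=1..n. ?G j x) * ?\<eta> x)" for x
        proof -
          have "(\<Prod>j=1..n. complex_of_real (?M j)) \<noteq> 0" using M by (auto simp: prod_zero_iff less_imp_neq[symmetric])
          then show ?thesis using E by (simp add: prod_dividef)
        qed
        then have "osc_form n V P \<eta> l f
          = of_real (?E * (\<Prod>j=1..n. ?M j)) * osc (\<lambda>x. l * P x) (\<lambda>x. \<Prod>j=1..n. ?G j x) ?\<eta>"
          unfolding form osc_def by (simp only: integral_mult_right_zero)
        then have "cmod (osc_form n V P \<eta> l f)
          = \<bar>?E * (\<Prod>j=1..n. ?M j)\<bar> * cmod (osc (\<lambda>x. l * P x) (\<lambda>x. \<Prod>j=1..n. ?G j x) ?\<eta>)"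
          by (simp only: norm_mult norm_of_real)
        also have "\<dots> \<le> \<bar>?E * (\<Prod>j=1..n. ?M j)\<bar> * (C * (1 + \<bar>l\<bar>) powr (- \<epsilon>))"
          by (intro mult_left_mono dec[OF x(1) Pp inv amp x(2)]) simp
        also have "\<bar>?E * (\<Prod>j=1..n. ?M j)\<bar> = ?E * (\<Prod>j=1..n. ?M j)"
          using E by (intro abs_of_nonneg mult_nonneg_nonneg prod_nonneg) auto
        finally show ?thesis by (simp add: mult_ac)
      qed
    qed
    then show "\<exists>\<epsilon>>0. \<exists>C. \<forall>l f \<eta> P. (\<forall>j\<in>{1..n}. f j \<in> Linf (V j)) \<longrightarrow> C1 \<eta> \<longrightarrow>
      closure {x. \<eta> x \<noteq> 0} \<subseteq> K \<longrightarrow> P \<in> polys d \<longrightarrow> c \<le> relative_norm (N d) d n V P \<longrightarrow>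
      cmod (osc_form n V P \<eta> l f)
        \<le> C * C1_norm \<eta> * (1 + \<bar>l\<bar>) powr (- \<epsilon>) * (\<Prod>j=1..n. enn2real (Linf_norm (V j) (f j)))"
      using \<epsilon> by blast
  qed
qed

theorem theorem2p2:
  fixes V :: "nat \<Rightarrow> (real ^ 'm) set" and n :: nat
    and N :: "nat \<Rightarrow> (real ^ 'm \<Rightarrow> real) \<Rightarrow> real"
  assumes "CARD('m) \<ge> 2"
    and "\<And>d. is_norm_on (polys d) (N d)"
    and "\<And>j. j \<in> {1..n} \<Longrightarrow> subspace (V j) \<and> dim (V j) + 1 = CARD('m)"
  shows "uniform_power_decay N n V"
  using assms(2,3) by (intro uniform_power_decay_hyperplanes) auto

end
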